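(* Let $u$ be a (classical) solution in $\mathbb{R}^2$ of $$\Delta u=W'(u)\ \text{ in } \Omega:=\{u>0\},\qquad u=0\ \text{ outside }\Omega,\qquad |\nabla u|=\sqrt{2W(0)}\ \text{ on }\partial\Omega .$$ If $\Omega$ is not connected, then $u$ is one dimensional.
   Context: The potential $W\in C^2[0,+\infty)$ satisfies: (W1) $W\ge0$, $W(1)=0$ and $W>0$ in $[0,1)$; (W2) $W'\le0$ on $[0,1]$; (W3) there are constants $\kappa>0$ and $\gamma\in(0,1)$ with $W''\ge\kappa>0$ on $[\gamma,+\infty)$; (W4) there is a constant $p>1$ such that $W'(u)\ge c(u-1)^p$ for $u>1$ (for some $c>0$). A solution is always understood as a classical solution: $\Omega=\{u>0\}$ is an open set in $\mathbb{R}^2$ with smooth boundary, $u\in C(\mathbb{R}^2)\cap C^2(\overline\Omega)$, and the equation and the boundary conditions hold pointwise (on $\partial\Omega$ the gradient is taken from inside $\Omega$). "One dimensional" means that there is a unit vector $e$ such that $u$ depends only on $x\cdot e$. No stability condition is assumed. *)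

theory Defs
  imports "HOL-Analysis.Analysis"
begin

text \<open>The derivatives at \<open>0\<close> are one-sided; the values of \<open>W\<close>, \<open>W'\<close>, \<open>W''\<close> at negative
  arguments are irrelevant.\<close>

definition C2_half_line :: "(real \<Rightarrow> real) \<Rightarrow> (real \<Rightarrow> real) \<Rightarrow> (real \<Rightarrow> real) \<Rightarrow> bool" where
  "C2_half_line W W' W'' \<longleftrightarrow>
     (\<forall>t\<ge>0. (W has_real_derivative W' t) (at t within {0..})) \<and>
     (\<forall>t\<ge>0. (W' has_real_derivative W'' t) (at t within {0..})) \<and>
     continuous_on {0..} W''"

definition admissible_potential ::
    "(real \<Rightarrow> real) \<Rightarrow> (real \<Rightarrow> real) \<Rightarrow> (real \<Rightarrow> real) \<Rightarrow> bool" where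
  "admissible_potential W W' W'' \<longleftrightarrow>
     C2_half_line W W' W'' \<and>
     ((\<forall>t\<ge>0. W t \<ge> 0) \<and> W 1 = 0 \<and> (\<forall>t\<in>{0..<1}. W t > 0)) \<and>
     (\<forall>t\<in>{0..1}. W' t \<le> 0) \<and>
     (\<exists>\<kappa>>0. \<exists>\<gamma>\<in>{0<..<1}. \<forall>t\<ge>\<gamma>. W'' t \<ge> \<kappa>) \<and>
     (\<exists>p>1. \<exists>c>0. \<forall>t>1. W' t \<ge> c * (t - 1) powr p)"

definition smooth_real :: "(real \<Rightarrow> real) \<Rightarrow> bool" where
  "smooth_real g \<longleftrightarrow> (\<forall>n. (deriv ^^ n) g differentiable_on UNIV)"

text \<open>Near each boundary point, in suitable orthonormal coordinates \<open>(x \<bullet> \<tau>, x \<bullet> \<nu>)\<close>, the set is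
  the strict epigraph of a smooth function; in particular it lies locally on one side of its
  boundary.\<close>

definition smooth_boundary :: "(real^2) set \<Rightarrow> bool" where
  "smooth_boundary \<Omega> \<longleftrightarrow>
     (\<forall>x0\<in>frontier \<Omega>. \<exists>r>0. \<exists>\<tau> \<nu> g.
        norm \<tau> = 1 \<and> norm \<nu> = 1 \<and> \<tau> \<bullet> \<nu> = 0 \<and> smooth_real g \<and>
        (\<forall>x\<in>ball x0 r. x \<in> \<Omega> \<longleftrightarrow> g (x \<bullet> \<tau>) < x \<bullet> \<nu>))"

text \<open>\<open>u\<close> is of class \<open>C\<^sup>2\<close> up to the boundary of the open set \<open>\<Omega>\<close>: inside \<open>\<Omega>\<close> the gradient \<open>G\<close> and
  the Hessian \<open>H\<close> exist, and both extend continuously to the closure. On the frontier \<open>G\<close> is thus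
  the limit of the gradient from inside \<open>\<Omega>\<close>, and it is determined there by \<open>u\<close>.\<close>

definition C2_closure ::
    "(real^'n) set \<Rightarrow> (real^'n \<Rightarrow> real) \<Rightarrow> (real^'n \<Rightarrow> real^'n) \<Rightarrow> (real^'n \<Rightarrow> real^'n^'n) \<Rightarrow> bool" where
  "C2_closure \<Omega> u G H \<longleftrightarrow>
     (\<forall>x\<in>\<Omega>. GDERIV u x :> G x) \<and>
     (\<forall>x\<in>\<Omega>. (G has_derivative (\<lambda>h. H x *v h)) (at x)) \<and>
     continuous_on (closure \<Omega>) u \<and> continuous_on (closure \<Omega>) G \<and> continuous_on (closure \<Omega>) H"

text \<open>The Laplacian is the trace of the Hessian.\<close>

definition classical_solution ::
    "(real \<Rightarrow> real) \<Rightarrow> (real \<Rightarrow> real) \<Rightarrow> (real^2 \<Rightarrow> real) \<Rightarrow> bool" where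
  "classical_solution W W' u \<longleftrightarrow>
     (let \<Omega> = {x. u x > 0} in
        open \<Omega> \<and> smooth_boundary \<Omega> \<and> continuous_on UNIV u \<and>
        (\<exists>G H. C2_closure \<Omega> u G H \<and>
           (\<forall>x\<in>\<Omega>. trace (H x) = W' (u x)) \<and>
           (\<forall>x. x \<notin> \<Omega> \<longrightarrow> u x = 0) \<and>
           (\<forall>x\<in>frontier \<Omega>. norm (G x) = sqrt (2 * W 0))))"

definition one_dimensional :: "(real^2 \<Rightarrow> real) \<Rightarrow> bool" where
  "one_dimensional u \<longleftrightarrow> (\<exists>e f. norm e = 1 \<and> (\<forall>x. u x = f (x \<bullet> e)))"

end

theory Submission
  imports Defs
begin

text \<open>Let \<open>\<Omega> = {u > 0}\<close> be the disjoint union of two nonempty open sets \<open>A\<close> and \<open>B\<close>. The proof finds a half plane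
inside \<open>A\<close> on which \<open>u\<close> is the one dimensional profile, another one inside \<open>B\<close>, and then shows
that there is nothing else.

\<^bold>\<open>Bounds.\<close> The superlinear growth of \<open>W'\<close> forces \<open>u \<le> 1\<close> (\<open>u_le_1\<close>), so that \<open>W' (u) \<le> 0\<close>. Then the
Modica inequality \<open>|\<nabla>u|\<^sup>2 \<le> 2 W (u)\<close> holds in \<open>\<Omega>\<close> (\<open>modica\<close>). The function
\<open>P = |\<nabla>u|\<^sup>2 - 2 W (u)\<close> is in the plane a subsolution of an elliptic equation where it is positive,
and it vanishes on \<open>\<partial>\<Omega>\<close>. As \<open>W\<close> and \<open>u\<close> are only of class \<open>C\<^sup>2\<close>, \<open>P\<close> may fail to have second derivatives; the
differential inequality is read at points where a smooth function touches \<open>P\<close> from above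
(\<open>gradient_touching\<close>). A test function that blows up on the boundary of a large ball replaces
compactness at infinity.

\<^bold>\<open>Convexity.\<close> By the free boundary condition \<open>P\<close> attains its maximum \<open>0\<close> along \<open>\<partial>\<Omega>\<close>, and its normal
derivative there is a positive multiple of the second derivative of the boundary graph. So the
complement of \<open>\<Omega>\<close> is locally convex: \<open>\<Omega>\<close> is locally the epigraph of a concave function
(\<open>graph_concave\<close>). Hence no point of \<open>closure A\<close> or
\<open>closure B\<close> is a strictly convex tip (\<open>tip_free_closure_piece\<close>).

\<^bold>\<open>A boundary line.\<close> For a closed set without tips, the components of the complement are convex;
this is the Tietze--Nakajima theorem (\<open>visibility_transitive\<close>). Let \<open>C\<close> be the component of the complement of
\<open>closure A\<close> that contains a point of \<open>B\<close>. If \<open>C\<close> contained no line parallel to one of its supporting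
lines, then it would lie in a wedge, and the part of \<open>closure B\<close> in \<open>C\<close> would have a tip at the
bottom of that wedge. So \<open>C\<close> is bounded by a straight line, which belongs to \<open>\<partial>A\<close>
(\<open>disjoint_tip_free_boundary_line\<close>).

\<^bold>\<open>Rigidity.\<close> The function \<open>Psi (u)\<close>, where \<open>Psi\<close> inverts the one dimensional profile, has slope at most \<open>1\<close>
by Modica. So \<open>w = dist - Psi (u)\<close> is nonnegative beyond the line, where \<open>dist\<close> is the distance to the line.
It satisfies \<open>\<Delta>w \<le> M |\<nabla>w|\<close>, and by the free boundary condition it vanishes to first order on the
line. Hopf's lemma gives \<open>w = 0\<close> on the half plane beyond the line, which therefore lies in \<open>A\<close>
(\<open>half_plane_solution\<close>).

\<^bold>\<open>Conclusion.\<close> In the same way \<open>B\<close> contains a half plane. Disjoint half planes have opposite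
normals. If \<open>\<Omega>\<close> had a further part between them, the same argument would put a third half plane into
a strip. So \<open>u\<close> depends only on the coordinate across the two parallel lines.\<close>

section \<open>Second order calculus in the plane\<close>

text \<open>The gradient and the Hessian are carried along as functions, the latter as a linear map at each
point. So the rules below compute the Laplacian of a composite function as the trace of an explicit map.\<close>
definition twice_diff ::
    "(real^2 \<Rightarrow> real) \<Rightarrow> (real^2 \<Rightarrow> real^2) \<Rightarrow> (real^2 \<Rightarrow> real^2 \<Rightarrow> real^2) \<Rightarrow> (real^2) set \<Rightarrow> bool" where
  "twice_diff f g L N \<longleftrightarrow>
     open N \<and> (\<forall>x\<in>N. GDERIV f x :> g x \<and> (g has_derivative L x) (at x))"

definition tr :: "(real^2 \<Rightarrow> real^2) \<Rightarrow> real" where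
  "tr L = L (axis 1 1) \<bullet> axis 1 1 + L (axis 2 1) \<bullet> axis 2 1"

lemma inner2: "(x::real^2) \<bullet> y = x $ 1 * y $ 1 + x $ 2 * y $ 2"
  by (simp add: inner_vec_def sum_2)

lemma axis2 [simp]:
  "(axis 1 (1::real) :: real^2) $ 1 = 1" "(axis 1 (1::real) :: real^2) $ 2 = 0"
  "(axis 2 (1::real) :: real^2) $ 1 = 0" "(axis 2 (1::real) :: real^2) $ 2 = 1"
  by (auto simp: axis_def)

lemma tr_add: "tr (\<lambda>h. L h + M h) = tr L + tr M"
  and tr_diff: "tr (\<lambda>h. L h - M h) = tr L - tr M"
  and tr_scaleR: "tr (\<lambda>h. c *\<^sub>R L h) = c * tr L"
  and tr_outer: "tr (\<lambda>h. (h \<bullet> p) *\<^sub>R q) = p \<bullet> q"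
  and tr_id: "tr (\<lambda>h. h) = 2"
  by (simp_all add: tr_def inner2 algebra_simps)

lemma tr_outer_mult: "tr (\<lambda>h. (c * (h \<bullet> p)) *\<^sub>R q) = c * (p \<bullet> q)"
  by (simp add: tr_def inner2 algebra_simps)

lemma tr_matrix: "tr (\<lambda>h. (A::real^2^2) *v h) = trace A"
  by (simp add: tr_def trace_def sum_2 inner2 matrix_vector_mult_def)

lemma twice_diff_subset: "twice_diff f g L N \<Longrightarrow> open M \<Longrightarrow> M \<subseteq> N \<Longrightarrow> twice_diff f g L M"
  by (auto simp: twice_diff_def)

lemma twice_diff_compose:
  assumes "twice_diff f g L N"
    and "\<And>x. x \<in> N \<Longrightarrow> (\<phi> has_real_derivative \<phi>1 (f x)) (at (f x))"
    and "\<And>x. x \<in> N \<Longrightarrow> (\<phi>1 has_real_derivative \<phi>2 (f x)) (at (f x))"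
  shows "twice_diff (\<lambda>x. \<phi> (f x)) (\<lambda>x. \<phi>1 (f x) *\<^sub>R g x)
     (\<lambda>x h. (\<phi>2 (f x) * (h \<bullet> g x)) *\<^sub>R g x + \<phi>1 (f x) *\<^sub>R L x h) N"
  unfolding twice_diff_def
proof (intro conjI ballI)
  show "open N" using assms(1) by (simp add: twice_diff_def)
  fix x assume x: "x \<in> N"
  have f: "GDERIV f x :> g x" and g: "(g has_derivative L x) (at x)"
    using assms(1) x by (auto simp: twice_diff_def)
  show "GDERIV (\<lambda>x. \<phi> (f x)) x :> \<phi>1 (f x) *\<^sub>R g x"
    using GDERIV_DERIV_compose[OF f assms(2)[OF x]] .
  have "GDERIV (\<lambda>x. \<phi>1 (f x)) x :> \<phi>2 (f x) *\<^sub>R g x"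
    using GDERIV_DERIV_compose[OF f assms(3)[OF x]] .
  then have "((\<lambda>x. \<phi>1 (f x)) has_derivative (\<lambda>h. h \<bullet> (\<phi>2 (f x) *\<^sub>R g x))) (at x)"
    by (simp add: gderiv_def)
  from has_derivative_scaleR[OF this g]
  show "((\<lambda>x. \<phi>1 (f x) *\<^sub>R g x) has_derivative
      (\<lambda>h. (\<phi>2 (f x) * (h \<bullet> g x)) *\<^sub>R g x + \<phi>1 (f x) *\<^sub>R L x h)) (at x)"
    by (simp add: add.commute algebra_simps)
qed

lemma twice_diff_add:
  assumes "twice_diff f g L N" "twice_diff f' g' L' N"
  shows "twice_diff (\<lambda>x. f x + f' x) (\<lambda>x. g x + g' x) (\<lambda>x h. L x h + L' x h) N"
  using assms by (auto simp: twice_diff_def intro: GDERIV_add has_derivative_add)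

lemma twice_diff_diff:
  assumes "twice_diff f g L N" "twice_diff f' g' L' N"
  shows "twice_diff (\<lambda>x. f x - f' x) (\<lambda>x. g x - g' x) (\<lambda>x h. L x h - L' x h) N"
  using assms by (auto simp: twice_diff_def intro: GDERIV_diff has_derivative_diff)

lemma twice_diff_cmult:
  assumes "twice_diff f g L N"
  shows "twice_diff (\<lambda>x. c * f x) (\<lambda>x. c *\<^sub>R g x) (\<lambda>x h. c *\<^sub>R L x h) N"
proof -
  have 1: "((\<lambda>t. c * t) has_real_derivative c) (at t)"
    and 2: "((\<lambda>t::real. c) has_real_derivative 0) (at t)" for t
    by (auto intro!: derivative_eq_intros)
  show ?thesis using twice_diff_compose[OF assms, of "\<lambda>t. c * t" "\<lambda>t. c" "\<lambda>t. 0"] 1 2 by simp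
qed

lemma twice_diff_mult:
  assumes "twice_diff f g L N" "twice_diff f' g' L' N"
  shows "twice_diff (\<lambda>x. f x * f' x) (\<lambda>x. f x *\<^sub>R g' x + f' x *\<^sub>R g x)
    (\<lambda>x h. (h \<bullet> g x) *\<^sub>R g' x + f x *\<^sub>R L' x h + ((h \<bullet> g' x) *\<^sub>R g x + f' x *\<^sub>R L x h)) N"
  unfolding twice_diff_def
proof (intro conjI ballI)
  show "open N" using assms(1) by (simp add: twice_diff_def)
  fix x assume x: "x \<in> N"
  have f: "GDERIV f x :> g x" and g: "(g has_derivative L x) (at x)"
    and f': "GDERIV f' x :> g' x" and g': "(g' has_derivative L' x) (at x)"
    using assms x by (auto simp: twice_diff_def)
  show "GDERIV (\<lambda>x. f x * f' x) x :> f x *\<^sub>R g' x + f' x *\<^sub>R g x"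
    by (rule GDERIV_mult[OF f f'])
  have df: "(f has_derivative (\<lambda>h. h \<bullet> g x)) (at x)"
    and df': "(f' has_derivative (\<lambda>h. h \<bullet> g' x)) (at x)"
    using f f' by (auto simp: gderiv_def)
  show "((\<lambda>x. f x *\<^sub>R g' x + f' x *\<^sub>R g x) has_derivative
    (\<lambda>h. (h \<bullet> g x) *\<^sub>R g' x + f x *\<^sub>R L' x h + ((h \<bullet> g' x) *\<^sub>R g x + f' x *\<^sub>R L x h))) (at x)"
    using has_derivative_add[OF has_derivative_scaleR[OF df g'] has_derivative_scaleR[OF df' g]]
    by (simp add: add.commute)
qed

lemma twice_diff_dist_sq:
  assumes "open N"
  shows "twice_diff (\<lambda>x. (x - a) \<bullet> (x - a)) (\<lambda>x. 2 *\<^sub>R (x - a)) (\<lambda>x h. 2 *\<^sub>R h) N"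
  unfolding twice_diff_def gderiv_def using assms
  by (auto intro!: derivative_eq_intros simp: inner_commute)

lemma twice_diff_const: "open N \<Longrightarrow> twice_diff (\<lambda>x. c) (\<lambda>x. 0) (\<lambda>x h. 0) N"
  by (simp add: twice_diff_def GDERIV_const)

lemma twice_diff_inner:
  assumes "open N" shows "twice_diff (\<lambda>x. x \<bullet> n) (\<lambda>x. n) (\<lambda>x h. 0) N"
  unfolding twice_diff_def gderiv_def using assms
  by (auto intro!: derivative_eq_intros)

lemma twice_diff_translate:
  assumes "twice_diff f g L N"
  shows "twice_diff (\<lambda>x. f (x + v)) (\<lambda>x. g (x + v)) (\<lambda>x. L (x + v)) ((\<lambda>x. x - v) ` N)"
  unfolding twice_diff_def
proof (intro conjI ballI)
  show "open ((\<lambda>x. x - v) ` N)"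
    using assms open_translation_subtract[of N v] by (simp add: twice_diff_def)
  fix x assume "x \<in> (\<lambda>x. x - v) ` N"
  then have x: "x + v \<in> N" by auto
  have t: "((\<lambda>x. x + v) has_derivative (\<lambda>h. h)) (at x)" by (auto intro!: derivative_eq_intros)
  have "(f has_derivative (\<lambda>h. h \<bullet> g (x+v))) (at (x+v))" "(g has_derivative L (x+v)) (at (x+v))"
    using assms x by (auto simp: twice_diff_def gderiv_def)
  from has_derivative_compose[OF t this(1)] has_derivative_compose[OF t this(2)]
  show "GDERIV (\<lambda>x. f (x + v)) x :> g (x + v)" "((\<lambda>x. g (x + v)) has_derivative L (x + v)) (at x)"
    by (auto simp: gderiv_def)
qed

lemma twice_diff_along_line:
  assumes "twice_diff f g L N" "x + s *\<^sub>R v \<in> N"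
  shows "((\<lambda>s. f (x + s *\<^sub>R v)) has_real_derivative (g (x + s *\<^sub>R v) \<bullet> v)) (at s)"
    and "((\<lambda>s. g (x + s *\<^sub>R v) \<bullet> p) has_real_derivative (L (x + s *\<^sub>R v) v \<bullet> p)) (at s)"
proof -
  have l: "((\<lambda>s. x + s *\<^sub>R v) has_derivative (\<lambda>h. h *\<^sub>R v)) (at s)"
    by (auto intro!: derivative_eq_intros)
  have 1: "(f has_derivative (\<lambda>h. h \<bullet> g (x + s *\<^sub>R v))) (at (x + s *\<^sub>R v))"
    and 2: "(g has_derivative L (x + s *\<^sub>R v)) (at (x + s *\<^sub>R v))"
    using assms by (auto simp: twice_diff_def gderiv_def)
  have lin: "linear (L (x + s *\<^sub>R v))" using 2 has_derivative_linear by blast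
  from has_derivative_compose[OF l 1]
  show "((\<lambda>s. f (x + s *\<^sub>R v)) has_real_derivative (g (x + s *\<^sub>R v) \<bullet> v)) (at s)"
    by (auto simp: has_field_derivative_def inner_commute mult.commute elim!: has_derivative_eq_rhs)
  from has_derivative_inner_left[OF has_derivative_compose[OF l 2], of p]
  show "((\<lambda>s. g (x + s *\<^sub>R v) \<bullet> p) has_real_derivative (L (x + s *\<^sub>R v) v \<bullet> p)) (at s)"
    by (auto simp: has_field_derivative_def linear_cmul[OF lin] mult.commute elim!: has_derivative_eq_rhs)
qed

lemma orthonormal_expansion:
  fixes x \<tau> \<nu> :: "real^2"
  assumes "norm \<tau> = 1" "norm \<nu> = 1" "\<tau> \<bullet> \<nu> = 0"
  shows "x = (x \<bullet> \<tau>) *\<^sub>R \<tau> + (x \<bullet> \<nu>) *\<^sub>R \<nu>"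
proof -
  define y where "y = x - ((x \<bullet> \<tau>) *\<^sub>R \<tau> + (x \<bullet> \<nu>) *\<^sub>R \<nu>)"
  have t: "\<tau> \<bullet> \<tau> = 1" "\<nu> \<bullet> \<nu> = 1" using assms by (simp_all add: norm_eq_1)
  have y: "y \<bullet> \<tau> = 0" "y \<bullet> \<nu> = 0"
    using t assms(3) by (auto simp: y_def inner_simps inner_commute)
  define D where "D = \<tau> $ 1 * \<nu> $ 2 - \<tau> $ 2 * \<nu> $ 1"
  have "D\<^sup>2 = (\<tau> \<bullet> \<tau>) * (\<nu> \<bullet> \<nu>) - (\<tau> \<bullet> \<nu>)\<^sup>2"
    by (simp add: D_def inner2 power2_eq_square algebra_simps)
  then have D: "D \<noteq> 0" using t assms(3) by auto
  have "y $ 1 * D = (y \<bullet> \<tau>) * \<nu> $ 2 - (y \<bullet> \<nu>) * \<tau> $ 2" "y $ 2 * D = (y \<bullet> \<nu>) * \<tau> $ 1 - (y \<bullet> \<tau>) * \<nu> $ 1"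
    by (simp_all add: D_def inner2 algebra_simps)
  then have "y = 0" using y D by (simp add: vec_eq_iff forall_2)
  then show ?thesis by (simp add: y_def)
qed

lemma exists_orthogonal_unit:
  fixes n :: "real^2" assumes "norm n = 1"
  obtains e where "norm e = 1" "e \<bullet> n = 0"
proof -
  define e :: "real^2" where "e = vector [- n $ 2, n $ 1]"
  have e: "e $ 1 = - n $ 2" "e $ 2 = n $ 1" by (simp_all add: e_def)
  have "n \<bullet> n = 1" using assms by (simp add: norm_eq_1)
  then have "e \<bullet> e = 1" by (simp add: inner2 e)
  then have "norm e = 1" by (simp add: norm_eq_1)
  moreover have "e \<bullet> n = 0" by (simp add: inner2 e)
  ultimately show ?thesis by (rule that)
qed

lemma trace_orthonormal:
  fixes A :: "real^2^2"
  assumes "norm \<tau> = 1" "norm \<nu> = 1" "\<tau> \<bullet> \<nu> = 0"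
  shows "(A *v \<tau>) \<bullet> \<tau> + (A *v \<nu>) \<bullet> \<nu> = trace A"
proof -
  note ex = orthonormal_expansion[OF assms]
  have 1: "\<tau> $ 1 * \<tau> $ 1 + \<nu> $ 1 * \<nu> $ 1 = 1" "\<tau> $ 1 * \<tau> $ 2 + \<nu> $ 1 * \<nu> $ 2 = 0"
    "\<tau> $ 2 * \<tau> $ 2 + \<nu> $ 2 * \<nu> $ 2 = 1"
    using arg_cong[OF ex[of "axis 1 1"], of "\<lambda>x. x $ 1"] arg_cong[OF ex[of "axis 1 1"], of "\<lambda>x. x $ 2"]
      arg_cong[OF ex[of "axis 2 1"], of "\<lambda>x. x $ 2"] by (simp_all add: inner2)
  have "(A *v \<tau>) \<bullet> \<tau> + (A *v \<nu>) \<bullet> \<nu> = A $ 1 $ 1 * (\<tau> $ 1 * \<tau> $ 1 + \<nu> $ 1 * \<nu> $ 1)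
     + (A $ 1 $ 2 + A $ 2 $ 1) * (\<tau> $ 1 * \<tau> $ 2 + \<nu> $ 1 * \<nu> $ 2) + A $ 2 $ 2 * (\<tau> $ 2 * \<tau> $ 2 + \<nu> $ 2 * \<nu> $ 2)"
    by (simp add: inner2 matrix_vector_mult_def sum_2 algebra_simps)
  then show ?thesis using 1 by (simp add: trace_def sum_2)
qed

text \<open>The Cayley--Hamilton theorem in disguise. If \<open>A\<close> is the Hessian of \<open>u\<close> and \<open>v = \<nabla>u\<close>, then \<open>g\<close> is the
gradient of \<open>P = |\<nabla>u|\<^sup>2 - 2 W (u)\<close>, and the bracket on the left is \<open>- 4 det A\<close>, which takes the part
of \<open>\<Delta>P\<close>. So the identity expresses \<open>\<Delta>P\<close> by \<open>\<nabla>P\<close>; it is special to two dimensions.\<close>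
lemma symmetric_matrix_identity:
  fixes A :: "real^2^2" and v :: "real^2"
  assumes "\<And>h k. (A *v h) \<bullet> k = (A *v k) \<bullet> h"
  defines "t \<equiv> trace A" and "g \<equiv> 2 *\<^sub>R (A *v v) - (2 * trace A) *\<^sub>R v"
  shows "(v \<bullet> v) * (2 * ((norm (A *v axis 1 1))\<^sup>2 + (norm (A *v axis 2 1))\<^sup>2) - 2 * t\<^sup>2)
     = 2 * t * (v \<bullet> g) + g \<bullet> g"
proof -
  have 1: "A $ 1 $ 2 = A $ 2 $ 1" using assms(1)[of "axis 1 1" "axis 2 1"]
    by (simp add: inner2 matrix_vector_mult_def sum_2)
  show ?thesis
    unfolding power2_norm_eq_inner t_def g_def trace_def
    by (simp add: inner2 matrix_vector_mult_def sum_2 1 power2_eq_square) (simp add: algebra_simps)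
qed

lemma continuous_on_matrix_quadratic [continuous_intros]:
  fixes A :: "'a::topological_space \<Rightarrow> real^2^2"
  assumes "continuous_on S A" "continuous_on S v" "continuous_on S w"
  shows "continuous_on S (\<lambda>x. (A x *v v x) \<bullet> w x)"
  unfolding inner2 matrix_vector_mult_def sum_2
  using assms by (auto intro!: continuous_intros)

lemma MVT_open:
  fixes f f' :: "real \<Rightarrow> real"
  assumes "a < b" "continuous_on {a..b} f"
    and "\<And>x. a < x \<Longrightarrow> x < b \<Longrightarrow> (f has_real_derivative f' x) (at x)"
  obtains z where "a < z" "z < b" "f b - f a = (b - a) * f' z"
proof -
  have "\<exists>l z. a < z \<and> z < b \<and> DERIV f z :> l \<and> f b - f a = (b - a) * l"
    using assms by (intro MVT) (auto simp: real_differentiable_def)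
  then show ?thesis using that assms(3) DERIV_unique by blast
qed

text \<open>The second difference \<open>\<Phi> h k s\<close> of \<open>u\<close> is symmetric in \<open>h\<close> and \<open>k\<close>, and by the mean value theorem it is
\<open>s\<^sup>2 (L x k \<bullet> h) + o(s\<^sup>2)\<close>.\<close>
lemma hessian_symmetric:
  assumes td: "twice_diff u G L N" and x: "x \<in> N"
  shows "L x h \<bullet> k = L x k \<bullet> h"
proof -
  have op: "open N" and der: "(G has_derivative L x) (at x)" using td x by (auto simp: twice_diff_def)
  have lin: "linear (L x)" using der has_derivative_linear by blast
  obtain r where r: "r > 0" "ball x r \<subseteq> N" using x op open_contains_ball by blast
  define \<Phi> where "\<Phi> = (\<lambda>h k s. u (x + s *\<^sub>R k + s *\<^sub>R h) - u (x + s *\<^sub>R h) - u (x + s *\<^sub>R k) + u x)"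
  have key: "\<exists>d>0. \<forall>s. 0 < s \<and> s < d \<longrightarrow> \<bar>\<Phi> h k s - s\<^sup>2 * (L x k \<bullet> h)\<bar> \<le> e * s\<^sup>2"
    if e: "e > 0" for h k e
  proof -
    define C where "C = 2 * (norm h + norm k + 1) * (norm h + 1)"
    have C: "C > 0" unfolding C_def by (intro mult_pos_pos) (auto intro: add_nonneg_pos)
    obtain d where d: "d > 0" "\<And>y. norm (y - x) < d \<Longrightarrow> norm (G y - G x - L x (y - x)) \<le> e / C * norm (y - x)"
      using der e C unfolding has_derivative_at_alt by (meson divide_pos_pos)
    define m where "m = norm h + norm k + 1"
    have m: "m > 0" by (simp add: m_def add_nonneg_pos)
    have "\<bar>\<Phi> h k s - s\<^sup>2 * (L x k \<bullet> h)\<bar> \<le> e * s\<^sup>2" if s: "0 < s" "s < min d r / m" for s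
    proof -
      have sm: "s * m < d" "s * m < r" using s m by (auto simp: field_simps)
      have b: "norm (a *\<^sub>R h + b *\<^sub>R k) \<le> s * (norm h + norm k)" if "0 \<le> a" "a \<le> s" "0 \<le> b" "b \<le> s" for a b
      proof -
        have "norm (a *\<^sub>R h + b *\<^sub>R k) \<le> a * norm h + b * norm k"
          using norm_triangle_ineq[of "a *\<^sub>R h" "b *\<^sub>R k"] that by simp
        also have "\<dots> \<le> s * norm h + s * norm k" using that by (intro add_mono mult_right_mono) auto
        finally show ?thesis by (simp add: algebra_simps)
      qed
      have sml: "s * (norm h + norm k) < s * m" using s by (simp add: m_def)
      have inN: "x + b *\<^sub>R k + a *\<^sub>R h \<in> N" if "0 \<le> a" "a \<le> s" "0 \<le> b" "b \<le> s" for a b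
      proof -
        have "dist x (x + b *\<^sub>R k + a *\<^sub>R h) = norm (a *\<^sub>R h + b *\<^sub>R k)"
          using norm_minus_cancel[of "a *\<^sub>R h + b *\<^sub>R k"] by (simp add: dist_norm algebra_simps)
        then have "dist x (x + b *\<^sub>R k + a *\<^sub>R h) < r" using b[OF that] sm sml by linarith
        then show ?thesis using r by auto
      qed
      have "\<exists>z>0. z < s \<and> (u (x + s *\<^sub>R k + s *\<^sub>R h) - u (x + s *\<^sub>R h)) - (u (x + s *\<^sub>R k + 0 *\<^sub>R h) - u (x + 0 *\<^sub>R h))
         = (s - 0) * (G (x + s *\<^sub>R k + z *\<^sub>R h) \<bullet> h - G (x + z *\<^sub>R h) \<bullet> h)"
        by (rule MVT2[where f="\<lambda>z. u (x + s *\<^sub>R k + z *\<^sub>R h) - u (x + z *\<^sub>R h)"])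
          (use s inN[of _ s] inN[of _ 0] in \<open>auto intro!: DERIV_diff twice_diff_along_line(1)[OF td]\<close>)
      then obtain z where z: "z > 0" "z < s"
        and eq: "\<Phi> h k s = s * ((G (x + s *\<^sub>R k + z *\<^sub>R h) - G (x + z *\<^sub>R h)) \<bullet> h)"
        by (auto simp: \<Phi>_def algebra_simps inner_simps)
      define R where "R = (\<lambda>y. G y - G x - L x (y - x))"
      have R: "norm (R (x + b *\<^sub>R k + z *\<^sub>R h)) \<le> e / C * (s * (norm h + norm k))" if "0 \<le> b" "b \<le> s" for b
      proof -
        have n: "norm (x + b *\<^sub>R k + z *\<^sub>R h - x) \<le> s * (norm h + norm k)"
          using b[of z b] that z by (simp add: add.commute)
        then have "norm (R (x + b *\<^sub>R k + z *\<^sub>R h)) \<le> e / C * norm (x + b *\<^sub>R k + z *\<^sub>R h - x)"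
          unfolding R_def using sm sml by (intro d(2)) linarith
        also have "\<dots> \<le> e / C * (s * (norm h + norm k))" using n e C by (intro mult_left_mono) auto
        finally show ?thesis .
      qed
      have R1: "norm (R (x + s *\<^sub>R k + z *\<^sub>R h)) \<le> e / C * (s * (norm h + norm k))"
        and R0: "norm (R (x + 0 *\<^sub>R k + z *\<^sub>R h)) \<le> e / C * (s * (norm h + norm k))"
        by (intro R; use s in simp)+
      have RR: "norm (R (x + s *\<^sub>R k + z *\<^sub>R h) - R (x + 0 *\<^sub>R k + z *\<^sub>R h))
          \<le> e / C * (s * (norm h + norm k)) + e / C * (s * (norm h + norm k))"
        using norm_triangle_ineq4 R1 R0 by (rule order_trans[OF _ add_mono])
      have Geq: "G (x + s *\<^sub>R k + z *\<^sub>R h) - G (x + z *\<^sub>R h) = s *\<^sub>R L x k + (R (x + s *\<^sub>R k + z *\<^sub>R h) - R (x + 0 *\<^sub>R k + z *\<^sub>R h))"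
        by (simp add: R_def linear_add[OF lin] linear_cmul[OF lin] algebra_simps)
      have "\<Phi> h k s - s\<^sup>2 * (L x k \<bullet> h) = s * ((R (x + s *\<^sub>R k + z *\<^sub>R h) - R (x + 0 *\<^sub>R k + z *\<^sub>R h)) \<bullet> h)"
        unfolding eq Geq by (simp add: inner_simps algebra_simps power2_eq_square)
      also have "\<bar>\<dots>\<bar> \<le> s * (norm (R (x + s *\<^sub>R k + z *\<^sub>R h) - R (x + 0 *\<^sub>R k + z *\<^sub>R h)) * norm h)"
        using s Cauchy_Schwarz_ineq2 by (auto simp: abs_mult intro!: mult_left_mono)
      also have "\<dots> \<le> s * ((e / C * (s * (norm h + norm k)) + e / C * (s * (norm h + norm k))) * norm h)"
        using s RR by (intro mult_left_mono mult_right_mono) auto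
      also have "\<dots> = (2 * e) * s\<^sup>2 * (((norm h + norm k) * norm h) / C)" by (simp add: power2_eq_square field_simps)
      also have "\<dots> \<le> (2 * e) * s\<^sup>2 * (1 / 2)"
      proof (intro mult_left_mono)
        have "(norm h + norm k) * norm h \<le> (norm h + norm k + 1) * (norm h + 1)" by (intro mult_mono) auto
        then have "2 * ((norm h + norm k) * norm h) \<le> C" by (simp add: C_def algebra_simps)
        then show "((norm h + norm k) * norm h) / C \<le> 1 / 2" using C by (simp add: field_simps)
      qed (use e in auto)
      finally show ?thesis by simp
    qed
    then show ?thesis using d r m by (intro exI[of _ "min d r / m"]) auto
  qed
  show ?thesis
  proof (rule ccontr)
    assume ne: "L x h \<bullet> k \<noteq> L x k \<bullet> h"
    define e where "e = \<bar>L x h \<bullet> k - L x k \<bullet> h\<bar> / 3"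
    have e: "e > 0" using ne by (simp add: e_def)
    obtain d d' where d: "d > 0" "\<And>s. 0 < s \<Longrightarrow> s < d \<Longrightarrow> \<bar>\<Phi> h k s - s\<^sup>2 * (L x k \<bullet> h)\<bar> \<le> e * s\<^sup>2"
      and d': "d' > 0" "\<And>s. 0 < s \<Longrightarrow> s < d' \<Longrightarrow> \<bar>\<Phi> k h s - s\<^sup>2 * (L x h \<bullet> k)\<bar> \<le> e * s\<^sup>2"
      using key[OF e, of h k] key[OF e, of k h] by blast
    define s where "s = min d d' / 2"
    have s: "s > 0" "s < d" "s < d'" using d d' by (auto simp: s_def min_def)
    have "\<Phi> h k s = \<Phi> k h s" by (simp add: \<Phi>_def add_ac)
    with d(2)[OF s(1,2)] d'(2)[OF s(1,3)]
    have "\<bar>s\<^sup>2 * (L x h \<bullet> k) - s\<^sup>2 * (L x k \<bullet> h)\<bar> \<le> 2 * e * s\<^sup>2" by linarith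
    also have "\<bar>s\<^sup>2 * (L x h \<bullet> k) - s\<^sup>2 * (L x k \<bullet> h)\<bar> = s\<^sup>2 * (3 * e)"
      by (simp add: e_def abs_mult flip: right_diff_distrib)
    finally show False using s e by simp
  qed
qed

section \<open>Maximum principles\<close>

text \<open>If the second derivative in direction \<open>v\<close> were positive, the first derivative along \<open>v\<close> would vanish
at \<open>x\<close> and be positive just after it, so \<open>f\<close> would increase.\<close>
lemma local_max_test:
  assumes td: "twice_diff f g L N" and x: "x \<in> N" and max: "\<And>y. y \<in> N \<Longrightarrow> f y \<le> f x"
  shows "g x = 0" "tr (L x) \<le> 0"
proof -
  have "open N" using td by (simp add: twice_diff_def)
  then obtain r where r: "r > 0" "ball x r \<subseteq> N" using x open_contains_ball by blast
  have "((\<lambda>h. h \<bullet> g x)) = (\<lambda>h. 0)"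
    by (rule differential_zero_maxmin[of x N f])
      (use td x max \<open>open N\<close> in \<open>auto simp: twice_diff_def gderiv_def\<close>)
  then have "g x \<bullet> g x = 0" by metis
  then show g0: "g x = 0" by simp
  have key: "L x v \<bullet> v \<le> 0" if v: "norm v = 1" for v
  proof (rule ccontr)
    assume "\<not> L x v \<bullet> v \<le> 0"
    then have pos: "L x v \<bullet> v > 0" by simp
    have inN: "x + s *\<^sub>R v \<in> N" if "\<bar>s\<bar> < r" for s
      using r that v by (auto simp: subset_iff dist_norm)
    let ?k = "\<lambda>s. g (x + s *\<^sub>R v) \<bullet> v"
    have "(?k has_real_derivative (L x v \<bullet> v)) (at 0)"
      using twice_diff_along_line(2)[OF td, of x 0 v v] x by simp
    from DERIV_pos_inc_right[OF this pos] obtain d where d: "d > 0"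
      "\<And>h. h > 0 \<Longrightarrow> h < d \<Longrightarrow> ?k 0 < ?k (0 + h)" by auto
    define s where "s = min d r / 2"
    have s: "s > 0" "s < d" "s < r" using d r by (auto simp: s_def min_def)
    have "\<exists>z>0. z < s \<and> f (x + s *\<^sub>R v) - f (x + 0 *\<^sub>R v) = (s - 0) * ?k z"
      by (rule MVT2) (use s in \<open>auto intro!: twice_diff_along_line(1)[OF td] inN\<close>)
    then obtain z where z: "z > 0" "z < s" "f (x + s *\<^sub>R v) - f x = s * ?k z" by auto
    have "?k z > 0" using d(2)[of z] z s g0 by auto
    then have "f (x + s *\<^sub>R v) > f x" using z s by (metis mult_pos_pos diff_gt_0_iff_gt)
    with max[OF inN[of s]] s show False by auto
  qed
  show "tr (L x) \<le> 0"
    unfolding tr_def using key[of "axis 1 1"] key[of "axis 2 1"] by (simp add: norm_axis_1)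
qed

text \<open>If \<open>u\<close> had three derivatives, this would be the second derivative test for \<open>|\<nabla>u|\<^sup>2 - T\<close>, because
\<open>\<Delta>|\<nabla>u|\<^sup>2 = 2 |D\<^sup>2u|\<^sup>2 + 2 \<nabla>u \<bullet> \<nabla>f\<close>. The third derivatives enter only through the linear function
\<open>G x0 \<bullet> G x\<close>, and this is a uniform limit of difference quotients of \<open>u\<close>, which are twice
differentiable. The remaining part \<open>|G x - G x0|\<^sup>2\<close> is of second order at \<open>x0\<close> and can be replaced
by a quadratic polynomial from below. So the test is applied to a nearby function at a nearby maximum.\<close>
lemma gradient_touching:
  fixes u f T :: "real^2 \<Rightarrow> real"
  assumes td: "twice_diff u G L \<Omega>" and lap: "\<And>x. x \<in> \<Omega> \<Longrightarrow> tr (L x) = f x"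
    and df: "\<And>x. x \<in> \<Omega> \<Longrightarrow> GDERIV f x :> Df x" and cDf: "continuous_on \<Omega> Df"
    and tdT: "twice_diff T g M N" and N: "N \<subseteq> \<Omega>" and cM: "continuous_on N (\<lambda>x. tr (M x))"
    and x0: "x0 \<in> N" and max: "\<And>x. x \<in> N \<Longrightarrow> (norm (G x))\<^sup>2 - T x \<le> (norm (G x0))\<^sup>2 - T x0"
  shows "2 * ((norm (L x0 (axis 1 1)))\<^sup>2 + (norm (L x0 (axis 2 1)))\<^sup>2) + 2 * (Df x0 \<bullet> G x0) \<le> tr (M x0)"
    and "g x0 = 2 *\<^sub>R L x0 (G x0)"
proof -
  define G0 where "G0 = G x0"
  define L0 where "L0 = L x0"
  have opN: "open N" and op: "open \<Omega>" using td tdT by (auto simp: twice_diff_def)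
  have x0': "x0 \<in> \<Omega>" using x0 N by auto
  have der: "(G has_derivative L0) (at x0)" using td x0' by (auto simp: twice_diff_def L0_def)
  have lin: "linear L0" and blin: "bounded_linear L0" using der has_derivative_linear has_derivative_bounded_linear by blast+
  have sym: "L0 h \<bullet> k = L0 k \<bullet> h" for h k unfolding L0_def using hessian_symmetric[OF td x0'] .
  have contG: "continuous_on \<Omega> G"
    using td op by (auto simp: twice_diff_def continuous_on_eq_continuous_at intro: has_derivative_continuous)
  have contu: "continuous_on \<Omega> u"
    using td op by (auto simp: twice_diff_def gderiv_def continuous_on_eq_continuous_at intro: has_derivative_continuous)
  have contT: "continuous_on N T"
    using tdT opN by (auto simp: twice_diff_def gderiv_def continuous_on_eq_continuous_at intro: has_derivative_continuous)
  show "g x0 = 2 *\<^sub>R L x0 (G x0)"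
  proof -
    have "((\<lambda>x. G x \<bullet> G x - T x) has_derivative (\<lambda>h. (G x0 \<bullet> L0 h + L0 h \<bullet> G x0) - h \<bullet> g x0)) (at x0)"
      using tdT x0 by (intro has_derivative_diff has_derivative_inner der) (auto simp: twice_diff_def gderiv_def)
    moreover have "\<forall>x\<in>N. G x \<bullet> G x - T x \<le> G x0 \<bullet> G x0 - T x0"
      using max by (simp add: power2_norm_eq_inner)
    ultimately have "(\<lambda>h. (G x0 \<bullet> L0 h + L0 h \<bullet> G x0) - h \<bullet> g x0) = (\<lambda>h. 0)"
      using differential_zero_maxmin[OF x0 opN] by blast
    then have z: "(G x0 \<bullet> L0 h + L0 h \<bullet> G x0) - h \<bullet> g x0 = 0" for h by meson
    have "h \<bullet> (2 *\<^sub>R L0 (G x0) - g x0) = 0" for h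
    proof -
      have "h \<bullet> (2 *\<^sub>R L0 (G x0) - g x0) = 2 * (L0 (G x0) \<bullet> h) - h \<bullet> g x0"
        by (simp add: inner_diff_right inner_commute[of h "L0 (G x0)"])
      then show ?thesis using z[of h] sym[of "G x0" h] inner_commute[of "G x0" "L0 h"] by linarith
    qed
    then have "2 *\<^sub>R L0 (G x0) - g x0 = 0" using inner_eq_zero_iff by blast
    then show ?thesis by (simp add: L0_def)
  qed
  define S2 where "S2 = (norm (L0 (axis 1 1)))\<^sup>2 + (norm (L0 (axis 2 1)))\<^sup>2"
  have "2 * S2 + 2 * (Df x0 \<bullet> G0) \<le> tr (M x0)"
  proof (rule ccontr)
    assume contra: "\<not> ?thesis"
    define e where "e = (2 * S2 + 2 * (Df x0 \<bullet> G0) - tr (M x0)) / 12"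
    have e: "e > 0" using contra by (simp add: e_def)
    obtain K where K: "K > 0" "\<And>y. norm (L0 y) \<le> norm y * K"
      using bounded_linear.pos_bounded[OF blin] by auto
    define e' where "e' = e / (2 * K)"
    have e': "e' > 0" using e K by (simp add: e'_def)
    obtain r1 where r1: "r1 > 0" "\<And>x. norm (x - x0) < r1 \<Longrightarrow> norm (G x - G x0 - L0 (x - x0)) \<le> e' * norm (x - x0)"
      using der e' unfolding has_derivative_at_alt by meson
    have "isCont (\<lambda>x. tr (M x)) x0" using cM x0 opN continuous_on_eq_continuous_at by blast
    then obtain r2 where r2: "r2 > 0" "\<And>x. norm (x - x0) < r2 \<Longrightarrow> \<bar>tr (M x) - tr (M x0)\<bar> < e"
      using e unfolding continuous_at_eps_delta by (metis dist_norm real_norm_def)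
    have "continuous_on \<Omega> (\<lambda>x. Df x \<bullet> G0)" by (intro continuous_intros cDf)
    then have "isCont (\<lambda>x. Df x \<bullet> G0) x0" using x0' op continuous_on_eq_continuous_at by blast
    then obtain r3 where r3: "r3 > 0" "\<And>x. norm (x - x0) < r3 \<Longrightarrow> \<bar>Df x \<bullet> G0 - Df x0 \<bullet> G0\<bar> < e"
      using e unfolding continuous_at_eps_delta by (metis dist_norm real_norm_def)
    obtain r4 where r4: "r4 > 0" "ball x0 r4 \<subseteq> N" using opN x0 open_contains_ball by blast
    define \<rho> where "\<rho> = min (min r1 r2) (min r3 r4) / 3"
    have \<rho>: "\<rho> > 0" "2 * \<rho> < r1" "2 * \<rho> < r2" "2 * \<rho> < r3" "2 * \<rho> < r4"
      using r1 r2 r3 r4 by (auto simp: \<rho>_def min_def)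
    have cN: "cball x0 (2 * \<rho>) \<subseteq> N" using r4 \<rho> by auto
    have c\<Omega>: "cball x0 (2 * \<rho>) \<subseteq> \<Omega>" using cN N by auto
    have nx: "norm (x - x0) \<le> 2 * \<rho>" if "x \<in> cball x0 (2 * \<rho>)" for x
      using that by (simp add: dist_norm norm_minus_commute)
    have "uniformly_continuous_on (cball x0 (2 * \<rho>)) G"
      by (intro compact_uniformly_continuous continuous_on_subset[OF contG] c\<Omega>) auto
    moreover have "0 < e * \<rho>\<^sup>2 / (8 * (norm G0 + 1))" using e \<rho> by (simp add: add_nonneg_pos)
    ultimately obtain \<delta> where \<delta>: "\<delta> > 0"
       "\<And>x y. x \<in> cball x0 (2 * \<rho>) \<Longrightarrow> y \<in> cball x0 (2 * \<rho>) \<Longrightarrow> dist x y < \<delta> \<Longrightarrow> dist (G x) (G y) < e * \<rho>\<^sup>2 / (8 * (norm G0 + 1))"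
      unfolding uniformly_continuous_on_def by metis
    \<comment> \<open>The step is so small that the difference quotient \<open>w\<close> cannot spoil the gap of size \<open>e \<rho>\<^sup>2\<close> on the sphere.\<close>
    define t where "t = min \<rho> \<delta> / (2 * (norm G0 + 1))"
    have nG: "norm G0 + 1 > 0" by (simp add: add_nonneg_pos)
    have t: "t > 0" using \<rho> \<delta> nG by (simp add: t_def)
    have tG: "z * norm G0 < \<rho>" "z * norm G0 < \<delta>" if "0 \<le> z" "z \<le> t" for z
    proof -
      have "z * norm G0 \<le> t * (norm G0 + 1)" using that by (intro mult_mono) auto
      also have "\<dots> = min \<rho> \<delta> / 2" using nG by (simp add: t_def field_simps)
      also have "\<dots> < min \<rho> \<delta>" using \<rho>(1) \<delta>(1) by (auto simp: min_def)
      finally show "z * norm G0 < \<rho>" "z * norm G0 < \<delta>" by auto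
    qed
    have shift: "x + z *\<^sub>R G0 \<in> cball x0 (2 * \<rho>)" if "x \<in> cball x0 \<rho>" "0 \<le> z" "z \<le> t" for x z
    proof -
      have "dist x0 (x + z *\<^sub>R G0) \<le> dist x0 x + dist x (x + z *\<^sub>R G0)" by (rule dist_triangle)
      also have "dist x (x + z *\<^sub>R G0) = z * norm G0" using that by (simp add: dist_norm)
      finally show ?thesis using that tG(1)[of z] by auto
    qed
    define w where "w = (\<lambda>x. (1 / t) * (u (x + t *\<^sub>R G0) - u x))"
    have wG: "\<bar>w x - G0 \<bullet> G x\<bar> \<le> e * \<rho>\<^sup>2 / 8" if x: "x \<in> cball x0 \<rho>" for x
    proof -
      have "\<exists>z>0. z < t \<and> u (x + t *\<^sub>R G0) - u (x + 0 *\<^sub>R G0) = (t - 0) * (G (x + z *\<^sub>R G0) \<bullet> G0)"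
        by (rule MVT2) (use t shift[OF x] c\<Omega> in \<open>auto intro!: twice_diff_along_line(1)[OF td]\<close>)
      then obtain z where z: "z > 0" "z < t" "w x = G (x + z *\<^sub>R G0) \<bullet> G0"
        using t by (auto simp: w_def)
      have "\<bar>w x - G0 \<bullet> G x\<bar> = \<bar>(G (x + z *\<^sub>R G0) - G x) \<bullet> G0\<bar>" using z by (simp add: inner_simps inner_commute)
      also have "\<dots> \<le> norm (G (x + z *\<^sub>R G0) - G x) * norm G0" by (rule Cauchy_Schwarz_ineq2)
      also have "\<dots> \<le> e * \<rho>\<^sup>2 / (8 * (norm G0 + 1)) * (norm G0 + 1)"
      proof (intro mult_mono)
        have "dist (x + z *\<^sub>R G0) x < \<delta>" using tG(2)[of z] z by (simp add: dist_norm)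
        then show "norm (G (x + z *\<^sub>R G0) - G x) \<le> e * \<rho>\<^sup>2 / (8 * (norm G0 + 1))"
          using \<delta>(2)[of "x + z *\<^sub>R G0" x] shift[OF x, of z] shift[OF x, of 0] z t by (auto simp: dist_norm)
      qed (use e in auto)
      also have "\<dots> = e * \<rho>\<^sup>2 / 8" using nG by (simp add: field_simps)
      finally show ?thesis .
    qed
    \<comment> \<open>A lower bound for \<open>|G x - G x0|\<^sup>2\<close>, with the margin \<open>e |x - x0|\<^sup>2\<close>.\<close>
    define Q where "Q = (\<lambda>x. L0 (x - x0) \<bullet> L0 (x - x0) - 2 * e * ((x - x0) \<bullet> (x - x0)))"
    have dL0: "(L0 has_derivative L0) (at x)" for x by (rule bounded_linear_imp_has_derivative[OF blin])
    have dL: "((\<lambda>x. L0 (x - x0)) has_derivative L0) (at x)" for x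
    proof -
      have "((\<lambda>x. x - x0) has_derivative (\<lambda>h. h)) (at x)" by (auto intro!: derivative_eq_intros)
      from has_derivative_compose[OF this dL0] show ?thesis .
    qed
    have dLL: "((\<lambda>x. L0 (L0 (x - x0))) has_derivative (\<lambda>h. L0 (L0 h))) (at x)" for x
      using has_derivative_compose[OF dL dL0] .
    have "((\<lambda>x. L0 (x - x0) \<bullet> L0 (x - x0)) has_derivative (\<lambda>h. h \<bullet> (2 *\<^sub>R L0 (L0 (x - x0))))) (at x)" for x
    proof -
      have "((\<lambda>x. L0 (x - x0) \<bullet> L0 (x - x0)) has_derivative (\<lambda>h. L0 (x - x0) \<bullet> L0 h + L0 h \<bullet> L0 (x - x0))) (at x)"
        by (intro has_derivative_inner dL)
      moreover have "L0 (x - x0) \<bullet> L0 h + L0 h \<bullet> L0 (x - x0) = h \<bullet> (2 *\<^sub>R L0 (L0 (x - x0)))" for h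
        using sym[of "L0 (x - x0)" h] by (simp add: inner_commute)
      ultimately show ?thesis by simp
    qed
    then have "twice_diff (\<lambda>x. L0 (x - x0) \<bullet> L0 (x - x0)) (\<lambda>x. 2 *\<^sub>R L0 (L0 (x - x0))) (\<lambda>x h. 2 *\<^sub>R L0 (L0 h)) UNIV"
      unfolding twice_diff_def gderiv_def using dLL by (auto intro!: has_derivative_scaleR_right)
    from twice_diff_diff[OF this twice_diff_cmult[OF twice_diff_dist_sq[of UNIV x0], of "2 * e"]]
    have tdQ: "twice_diff Q (\<lambda>x. 2 *\<^sub>R L0 (L0 (x - x0)) - (2 * e) *\<^sub>R (2 *\<^sub>R (x - x0)))
        (\<lambda>x h. 2 *\<^sub>R L0 (L0 h) - (2 * e) *\<^sub>R (2 *\<^sub>R h)) UNIV" unfolding Q_def by simp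
    have trLL: "tr (\<lambda>h. L0 (L0 h)) = S2"
      unfolding S2_def tr_def using sym[of "L0 (axis 1 1)" "axis 1 1"] sym[of "L0 (axis 2 1)" "axis 2 1"]
      by (simp add: dot_square_norm)
    have "ball x0 \<rho> \<subseteq> (\<lambda>x. x - t *\<^sub>R G0) ` \<Omega>"
    proof
      fix x assume "x \<in> ball x0 \<rho>"
      then have "x + t *\<^sub>R G0 \<in> \<Omega>" using shift[of x t] c\<Omega> t by auto
      then show "x \<in> (\<lambda>x. x - t *\<^sub>R G0) ` \<Omega>" by (intro image_eqI[of _ _ "x + t *\<^sub>R G0"]) auto
    qed
    moreover have "ball x0 \<rho> \<subseteq> \<Omega>" "ball x0 \<rho> \<subseteq> N" using c\<Omega> cN \<rho> by (auto simp: subset_iff)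
    ultimately have tdF: "twice_diff (\<lambda>x. 2 * w x + Q x - T x)
       (\<lambda>x. 2 *\<^sub>R ((1 / t) *\<^sub>R (G (x + t *\<^sub>R G0) - G x)) + (2 *\<^sub>R L0 (L0 (x - x0)) - (2 * e) *\<^sub>R (2 *\<^sub>R (x - x0))) - g x)
       (\<lambda>x h. 2 *\<^sub>R ((1 / t) *\<^sub>R (L (x + t *\<^sub>R G0) h - L x h)) + (2 *\<^sub>R L0 (L0 h) - (2 * e) *\<^sub>R (2 *\<^sub>R h)) - M x h) (ball x0 \<rho>)"
      unfolding w_def
      by (intro twice_diff_diff twice_diff_add twice_diff_cmult twice_diff_subset[OF twice_diff_translate[OF td]]
           twice_diff_subset[OF td] twice_diff_subset[OF tdQ] twice_diff_subset[OF tdT]) auto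
    have contF: "continuous_on (cball x0 \<rho>) (\<lambda>x. 2 * w x + Q x - T x)"
    proof -
      have a: "continuous_on (cball x0 \<rho>) (\<lambda>x. u (x + t *\<^sub>R G0))"
        by (rule continuous_on_compose2[OF contu]) (use shift[of _ t] t c\<Omega> in \<open>auto intro!: continuous_intros\<close>)
      have b: "continuous_on (cball x0 \<rho>) u"
        by (rule continuous_on_subset[OF contu]) (use shift[of _ 0] t c\<Omega> in auto)
      have c: "continuous_on (cball x0 \<rho>) T"
        by (rule continuous_on_subset[OF contT]) (use cN \<rho> in auto)
      have "continuous_on UNIV Q"
        using tdQ by (auto simp: twice_diff_def gderiv_def continuous_on_eq_continuous_at intro: has_derivative_continuous)
      then have d: "continuous_on (cball x0 \<rho>) Q" by (rule continuous_on_subset) auto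
      show ?thesis unfolding w_def by (intro continuous_intros a b c d)
    qed
    then obtain x1 where x1: "x1 \<in> cball x0 \<rho>" "\<And>x. x \<in> cball x0 \<rho> \<Longrightarrow> 2 * w x + Q x - T x \<le> 2 * w x1 + Q x1 - T x1"
      using continuous_attains_sup[of "cball x0 \<rho>" "\<lambda>x. 2 * w x + Q x - T x"] \<rho> by auto
    have small: "2 * (G0 \<bullet> G x) + Q x - T x + e * (norm (x - x0))\<^sup>2 \<le> 2 * (G0 \<bullet> G0) - T x0" if x: "x \<in> cball x0 \<rho>" for x
    proof -
      have xx: "norm (x - x0) \<le> \<rho>" using x by (simp add: dist_norm norm_minus_commute)
      have xN: "x \<in> N" using x \<rho>(1) by (intro subsetD[OF cN]) simp
      define y where "y = x - x0"
      define a where "a = L0 y"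
      define r where "r = G x - G0 - a"
      have r: "norm r \<le> e' * norm y" unfolding r_def a_def y_def G0_def using r1(2)[of x] xx \<rho> by auto
      have "\<bar>a \<bullet> r\<bar> \<le> norm a * norm r" by (rule Cauchy_Schwarz_ineq2)
      also have "\<dots> \<le> (norm y * K) * (e' * norm y)" using K(2)[of y] r e' K(1) by (intro mult_mono) (auto simp: a_def)
      also have "\<dots> = e / 2 * (norm y)\<^sup>2" using K by (simp add: e'_def power2_eq_square field_simps)
      finally have ar: "\<bar>a \<bullet> r\<bar> \<le> e / 2 * (norm y)\<^sup>2" .
      have "G x = G0 + a + r" by (simp add: r_def)
      then have "(norm (G x))\<^sup>2 = 2 * (G0 \<bullet> G x) - G0 \<bullet> G0 + (a + r) \<bullet> (a + r)"
        by (simp add: power2_norm_eq_inner inner_simps inner_commute)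
      moreover have "(a + r) \<bullet> (a + r) \<ge> a \<bullet> a + 2 * (a \<bullet> r)" by (simp add: inner_simps inner_commute)
      moreover have "(norm (G x))\<^sup>2 - T x \<le> G0 \<bullet> G0 - T x0"
        using max[OF xN] by (simp add: power2_norm_eq_inner G0_def)
      ultimately show ?thesis using ar
        by (simp add: Q_def a_def y_def power2_norm_eq_inner)
    qed
    have x1b: "x1 \<in> ball x0 \<rho>"
    proof (rule ccontr)
      assume "x1 \<notin> ball x0 \<rho>"
      with x1(1) have "norm (x1 - x0) = \<rho>" by (simp add: dist_norm norm_minus_commute)
      then have "2 * (G0 \<bullet> G x1) + Q x1 - T x1 + e * \<rho>\<^sup>2 \<le> 2 * (G0 \<bullet> G0) - T x0" using small[OF x1(1)] by simp
      moreover have "Q x0 = 0" using linear_0[OF lin] by (simp add: Q_def)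
      moreover have "x0 \<in> cball x0 \<rho>" using \<rho> by simp
      moreover have "e * \<rho>\<^sup>2 > 0" using e \<rho> by simp
      ultimately show False using wG[OF x1(1)] wG[of x0] x1(2)[of x0] unfolding G0_def by argo
    qed
    have "tr (\<lambda>h. 2 *\<^sub>R ((1 / t) *\<^sub>R (L (x1 + t *\<^sub>R G0) h - L x1 h)) + (2 *\<^sub>R L0 (L0 h) - (2 * e) *\<^sub>R (2 *\<^sub>R h)) - M x1 h) \<le> 0"
      using local_max_test(2)[OF tdF x1b] x1(2) by auto
    then have le: "2 * ((1 / t) * (f (x1 + t *\<^sub>R G0) - f x1)) + (2 * S2 - 8 * e) - tr (M x1) \<le> 0"
      using lap[of "x1 + t *\<^sub>R G0"] lap[of x1] shift[OF x1(1), of t] shift[OF x1(1), of 0] c\<Omega> t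
      by (simp add: tr_diff tr_add tr_scaleR trLL tr_id subset_iff)
    have fl: "((\<lambda>s. f (x1 + s *\<^sub>R G0)) has_real_derivative (Df (x1 + s *\<^sub>R G0) \<bullet> G0)) (at s)" if "0 \<le> s" "s \<le> t" for s
    proof -
      have l: "((\<lambda>s. x1 + s *\<^sub>R G0) has_derivative (\<lambda>h. h *\<^sub>R G0)) (at s)"
        by (auto intro!: derivative_eq_intros)
      have "(f has_derivative (\<lambda>h. h \<bullet> Df (x1 + s *\<^sub>R G0))) (at (x1 + s *\<^sub>R G0))"
        using df[of "x1 + s *\<^sub>R G0"] shift[OF x1(1) that] c\<Omega> by (auto simp: gderiv_def)
      from has_derivative_compose[OF l this] show ?thesis
        by (auto simp: has_field_derivative_def inner_commute mult.commute elim!: has_derivative_eq_rhs)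
    qed
    have "\<exists>z>0. z < t \<and> f (x1 + t *\<^sub>R G0) - f (x1 + 0 *\<^sub>R G0) = (t - 0) * (Df (x1 + z *\<^sub>R G0) \<bullet> G0)"
      by (rule MVT2) (use t fl in auto)
    then obtain z where z: "z > 0" "z < t" "(1 / t) * (f (x1 + t *\<^sub>R G0) - f x1) = Df (x1 + z *\<^sub>R G0) \<bullet> G0"
      using t by auto
    have "\<bar>Df (x1 + z *\<^sub>R G0) \<bullet> G0 - Df x0 \<bullet> G0\<bar> < e"
      using r3(2)[of "x1 + z *\<^sub>R G0"] nx[OF shift[OF x1(1), of z]] z \<rho> by auto
    moreover have "\<bar>tr (M x1) - tr (M x0)\<bar> < e"
      using r2(2)[of x1] nx[of x1] x1(1) \<rho> by auto
    moreover have "12 * e = 2 * S2 + 2 * (Df x0 \<bullet> G0) - tr (M x0)" by (simp add: e_def)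
    ultimately show False using le z e by argo
  qed
  then show "2 * ((norm (L x0 (axis 1 1)))\<^sup>2 + (norm (L x0 (axis 2 1)))\<^sup>2) + 2 * (Df x0 \<bullet> G x0) \<le> tr (M x0)"
    by (simp add: S2_def L0_def G0_def)
qed

text \<open>Hopf's lemma: compare \<open>w\<close> with a multiple of \<open>exp (- \<alpha> |x - z0|\<^sup>2) - exp (- \<alpha> \<rho>\<^sup>2)\<close> in an annulus. This
function vanishes on the outer circle and has a positive inner normal derivative there.\<close>
lemma hopf_boundary_point:
  assumes rad: "\<rho> > 0" and td: "twice_diff w g L (ball z0 \<rho>)" and cw: "continuous_on (cball z0 \<rho>) w"
    and pos: "\<And>x. x \<in> ball z0 \<rho> \<Longrightarrow> w x > 0"
    and super: "\<And>x. x \<in> ball z0 \<rho> \<Longrightarrow> tr (L x) \<le> M * norm (g x)" and M: "M \<ge> 0"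
    and p: "dist z0 p = \<rho>" "w p = 0" and nonneg: "\<And>x. x \<in> cball z0 \<rho> \<Longrightarrow> w x \<ge> 0"
  shows "\<exists>c>0. \<forall>t. 0 < t \<longrightarrow> t \<le> 1 / 2 \<longrightarrow> c * t \<le> w (p + t *\<^sub>R (z0 - p))"
proof -
  \<comment> \<open>Large enough for \<open>\<Delta>v > M |\<nabla>v|\<close> in the annulus, where \<open>|x - z0| \<ge> \<rho> / 2\<close>.\<close>
  define \<alpha> where "\<alpha> = (5 + 2 * M * \<rho>) / \<rho>\<^sup>2"
  have \<alpha>: "\<alpha> > 0" "\<alpha> * \<rho>\<^sup>2 = 5 + 2 * M * \<rho>" using rad M by (auto simp: \<alpha>_def intro!: divide_pos_pos add_pos_nonneg)
  define q where "q = (\<lambda>x. (x - z0) \<bullet> (x - z0))"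
  define v where "v = (\<lambda>x. exp (- \<alpha> * q x) - exp (- \<alpha> * \<rho>\<^sup>2))"
  have qn: "q x = (dist z0 x)\<^sup>2" for x by (simp add: q_def dist_norm norm_minus_commute power2_norm_eq_inner)
  have cv: "continuous_on S v" for S unfolding v_def q_def by (intro continuous_intros)
  have "continuous_on (cball z0 (\<rho> / 2)) w" by (rule continuous_on_subset[OF cw]) (use rad in auto)
  then obtain x1 where x1: "x1 \<in> cball z0 (\<rho> / 2)" "\<And>x. x \<in> cball z0 (\<rho> / 2) \<Longrightarrow> w x1 \<le> w x"
    using continuous_attains_inf[of "cball z0 (\<rho> / 2)" w] rad by auto
  define m where "m = w x1"
  have m: "m > 0" unfolding m_def using x1(1) rad by (intro pos) auto
  have v1: "v x \<le> 1" for x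
  proof -
    have "exp (- \<alpha> * q x) \<le> 1" using \<alpha> by (simp add: qn)
    then show ?thesis unfolding v_def by (smt (verit) exp_gt_zero)
  qed
  have comparison: "w x \<ge> m * v x" if x: "x \<in> cball z0 \<rho>" "\<rho> / 2 \<le> dist z0 x" for x
  proof (rule ccontr)
    define S where "S = cball z0 \<rho> - ball z0 (\<rho> / 2)"
    define F where "F = (\<lambda>x. m * v x - w x)"
    assume "\<not> w x \<ge> m * v x"
    then have Fx: "F x > 0" "x \<in> S" using x by (auto simp: F_def S_def)
    have "compact S" unfolding S_def by (intro compact_diff) auto
    moreover have "continuous_on S F"
      unfolding F_def by (intro continuous_intros cv continuous_on_subset[OF cw]) (auto simp: S_def)
    ultimately obtain y where y: "y \<in> S" "\<And>z. z \<in> S \<Longrightarrow> F z \<le> F y"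
      using continuous_attains_sup[of S F] Fx by blast
    have Fy: "F y > 0" using y(2)[OF Fx(2)] Fx by simp
    have "dist z0 y \<noteq> \<rho>"
    proof
      assume "dist z0 y = \<rho>"
      then have "v y = 0" by (simp add: v_def qn)
      then show False using Fy nonneg[of y] y by (auto simp: F_def S_def)
    qed
    moreover have "dist z0 y \<noteq> \<rho> / 2"
    proof
      assume "dist z0 y = \<rho> / 2"
      then have "m \<le> w y" unfolding m_def by (intro x1) simp
      moreover have "m * v y \<le> m * 1" using m v1 by (intro mult_left_mono) auto
      ultimately show False using Fy by (simp add: F_def)
    qed
    ultimately have dy: "\<rho> / 2 < dist z0 y" "dist z0 y < \<rho>" using y(1) by (auto simp: S_def)
    define N where "N = ball z0 \<rho> - cball z0 (\<rho> / 2)"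
    have opN: "open N" unfolding N_def by (intro open_Diff) auto
    have yN: "y \<in> N" using dy by (auto simp: N_def)
    have NS: "N \<subseteq> S" "N \<subseteq> ball z0 \<rho>" by (auto simp: N_def S_def)
    have ed: "((\<lambda>r. exp (- \<alpha> * r)) has_real_derivative (- \<alpha>) * exp (- \<alpha> * r)) (at r)"
      "((\<lambda>r. (- \<alpha>) * exp (- \<alpha> * r)) has_real_derivative \<alpha>\<^sup>2 * exp (- \<alpha> * r)) (at r)" for r
      by (auto intro!: derivative_eq_intros simp: power2_eq_square)
    have tdv: "twice_diff v (\<lambda>x. ((- \<alpha>) * exp (- \<alpha> * q x)) *\<^sub>R (2 *\<^sub>R (x - z0)) - 0)
      (\<lambda>x h. ((\<alpha>\<^sup>2 * exp (- \<alpha> * q x)) * (h \<bullet> (2 *\<^sub>R (x - z0)))) *\<^sub>R (2 *\<^sub>R (x - z0)) + ((- \<alpha>) * exp (- \<alpha> * q x)) *\<^sub>R (2 *\<^sub>R h) - 0) N"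
      unfolding v_def q_def
      by (intro twice_diff_diff twice_diff_const opN twice_diff_compose[OF twice_diff_dist_sq[OF opN], where \<phi>="\<lambda>r. exp (- \<alpha> * r)"] ed)
    note tdF = twice_diff_diff[OF twice_diff_cmult[OF tdv, of m] twice_diff_subset[OF td opN NS(2)]]
    define E where "E = exp (- \<alpha> * q y)"
    have E: "E > 0" by (simp add: E_def)
    have max: "m * v z - w z \<le> m * v y - w y" if "z \<in> N" for z
      using y(2)[of z] that NS by (auto simp: F_def)
    have g: "g y = m *\<^sub>R (((- \<alpha>) * E) *\<^sub>R (2 *\<^sub>R (y - z0)))"
      using local_max_test(1)[OF tdF yN max] by (simp add: E_def)
    have "norm (g y) = \<bar>m * ((- \<alpha> * E) * 2)\<bar> * norm (y - z0)" unfolding g scaleR_scaleR norm_scaleR ..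
    then have ng: "norm (g y) = m * E * (2 * \<alpha> * dist z0 y)"
      using m \<alpha> E by (simp add: abs_mult dist_norm norm_minus_commute)
    have t: "m * (\<alpha>\<^sup>2 * E * (4 * q y) + (- \<alpha> * E) * 4) - tr (L y) \<le> 0"
      using local_max_test(2)[OF tdF yN max]
      by (simp only: tr_diff tr_scaleR tr_add tr_outer_mult tr_id diff_zero E_def[symmetric])
         (simp add: q_def algebra_simps)
    have "tr (L y) \<le> M * (m * E * (2 * \<alpha> * dist z0 y))" using super[of y] yN NS ng by auto
    also have "\<dots> \<le> M * (m * E * (2 * \<alpha> * \<rho>))"
      using M m E \<alpha> dy by (intro mult_left_mono) auto
    finally have "(m * E * \<alpha>) * (\<alpha> * (4 * q y) - 4) \<le> (m * E * \<alpha>) * (2 * M * \<rho>)"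
      using t by (simp add: power2_eq_square algebra_simps)
    then have le: "\<alpha> * (4 * q y) - 4 \<le> 2 * M * \<rho>" using m E \<alpha> by simp
    have "(\<rho> / 2)\<^sup>2 \<le> q y" unfolding qn using dy rad by (intro power_mono) auto
    then have "\<alpha> * \<rho>\<^sup>2 \<le> \<alpha> * (4 * q y)" using \<alpha> by (intro mult_left_mono) (auto simp: power_divide)
    then show False using le \<alpha>(2) by linarith
  qed
  define c where "c = m * (exp (- \<alpha> * \<rho>\<^sup>2) * (\<alpha> * \<rho>\<^sup>2))"
  show ?thesis
  proof (intro exI[of _ c] conjI allI impI)
    show "c > 0" unfolding c_def using m \<alpha>(1) rad by (intro mult_pos_pos) auto
    fix t :: real assume t: "0 < t" "t \<le> 1 / 2"
    define x where "x = p + t *\<^sub>R (z0 - p)"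
    have "z0 - x = (1 - t) *\<^sub>R (z0 - p)" by (simp add: x_def algebra_simps)
    then have dx: "dist z0 x = (1 - t) * \<rho>" using t p(1) by (simp add: dist_norm)
    have "(1 - t) * \<rho> \<le> 1 * \<rho>" "1 / 2 * \<rho> \<le> (1 - t) * \<rho>" using t rad by (intro mult_right_mono; simp)+
    then have w: "w x \<ge> m * v x" using dx by (intro comparison) auto
    have qx: "q x = \<rho>\<^sup>2 - (2 * t - t\<^sup>2) * \<rho>\<^sup>2" unfolding qn dx by (simp add: power2_eq_square algebra_simps)
    have "- \<alpha> * q x = - \<alpha> * \<rho>\<^sup>2 + \<alpha> * \<rho>\<^sup>2 * (2 * t - t\<^sup>2)" unfolding qx by (simp add: algebra_simps)
    then have "exp (- \<alpha> * q x) = exp (- \<alpha> * \<rho>\<^sup>2) * exp (\<alpha> * \<rho>\<^sup>2 * (2 * t - t\<^sup>2))" by (simp only: exp_add)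
    also have "\<dots> \<ge> exp (- \<alpha> * \<rho>\<^sup>2) * (1 + \<alpha> * \<rho>\<^sup>2 * t)"
    proof (intro mult_left_mono)
      have "t * t \<le> 1 * t" using t by (intro mult_right_mono) auto
      then have "\<alpha> * \<rho>\<^sup>2 * t \<le> \<alpha> * \<rho>\<^sup>2 * (2 * t - t\<^sup>2)" using \<alpha>(1) by (intro mult_left_mono) (auto simp: power2_eq_square)
      then show "1 + \<alpha> * \<rho>\<^sup>2 * t \<le> exp (\<alpha> * \<rho>\<^sup>2 * (2 * t - t\<^sup>2))"
        using exp_ge_add_one_self[of "\<alpha> * \<rho>\<^sup>2 * (2 * t - t\<^sup>2)"] by linarith
    qed simp
    finally have "v x \<ge> exp (- \<alpha> * \<rho>\<^sup>2) * (\<alpha> * \<rho>\<^sup>2 * t)" by (simp add: v_def algebra_simps)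
    then have "m * v x \<ge> m * (exp (- \<alpha> * \<rho>\<^sup>2) * (\<alpha> * \<rho>\<^sup>2 * t))" using m by (intro mult_left_mono) auto
    then show "w (p + t *\<^sub>R (z0 - p)) \<ge> c * t" using w by (simp add: c_def x_def algebra_simps)
  qed
qed

section \<open>Closed planar sets without tips\<close>

text \<open>No strictly concave function has a local minimum over such a set. This is the weak form in which local convexity of
the complement is used.\<close>
definition tip_free :: "(real^2) set \<Rightarrow> bool" where
  "tip_free F \<longleftrightarrow> (\<forall>p\<in>F. \<forall>r>0. \<exists>v. v \<noteq> 0 \<and> norm v < r \<and> p + v \<in> F \<and> p - v \<in> F)"

text \<open>Moving an affine function upwards over a compact piece of \<open>F\<close> that is cut off by the line \<open>\<phi> = c\<close>
would detect a lowest point of that piece. A small multiple of \<open>|p|\<^sup>2\<close> is subtracted from \<open>\<phi>\<close> to make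
it strictly concave; then the lowest point is a tip.\<close>
lemma tip_free_no_cap:
  fixes \<phi> :: "real^2 \<Rightarrow> real"
  assumes tf: "tip_free F" and E: "compact E" "E \<subseteq> F" and b: "b \<in> E" "\<phi> b < c"
    and cont: "continuous_on E \<phi>" and aff: "\<And>p v. \<phi> (p + v) + \<phi> (p - v) = 2 * \<phi> p"
    and nbhd: "\<And>p. p \<in> E \<Longrightarrow> \<phi> p < c \<Longrightarrow> \<exists>r>0. F \<inter> ball p r \<subseteq> E"
  shows False
proof -
  obtain R where R: "\<And>p. p \<in> E \<Longrightarrow> norm p \<le> R" "R > 0"
    using compact_imp_bounded[OF E(1)] bounded_pos by metis
  define \<mu> where "\<mu> = (c - \<phi> b) / (2 * R\<^sup>2)"
  have \<mu>: "\<mu> > 0" "\<mu> * R\<^sup>2 < c - \<phi> b" using b R by (auto simp: \<mu>_def)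
  have "continuous_on E (\<lambda>p. \<phi> p - \<mu> * (norm p)\<^sup>2)" by (intro continuous_intros cont)
  then obtain p where p: "p \<in> E" "\<And>q. q \<in> E \<Longrightarrow> \<phi> p - \<mu> * (norm p)\<^sup>2 \<le> \<phi> q - \<mu> * (norm q)\<^sup>2"
    using continuous_attains_inf[OF E(1)] b by blast
  have "\<mu> * (norm p)\<^sup>2 \<le> \<mu> * R\<^sup>2" using \<mu> R p by (intro mult_left_mono power_mono) auto
  moreover have "\<mu> * (norm b)\<^sup>2 \<ge> 0" using \<mu> by simp
  ultimately have "\<phi> p < c" using p(2)[OF b(1)] \<mu> by linarith
  then obtain r where r: "r > 0" "F \<inter> ball p r \<subseteq> E" using nbhd p by blast
  obtain v where v: "v \<noteq> 0" "norm v < r" "p + v \<in> F" "p - v \<in> F"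
    using tf p E r unfolding tip_free_def by (meson subsetD)
  then have in_E: "p + v \<in> E" "p - v \<in> E" using r by (auto simp: dist_norm)
  have par: "(norm (p + v))\<^sup>2 + (norm (p - v))\<^sup>2 = 2 * (norm p)\<^sup>2 + 2 * (norm v)\<^sup>2"
    by (simp add: power2_norm_eq_inner inner_simps inner_commute)
  have "\<mu> * (norm (p + v))\<^sup>2 + \<mu> * (norm (p - v))\<^sup>2 = 2 * (\<mu> * (norm p)\<^sup>2) + 2 * (\<mu> * (norm v)\<^sup>2)"
    using arg_cong[OF par, of "\<lambda>t. \<mu> * t"] by (simp only: distrib_left mult.left_commute[of \<mu> 2])
  moreover have "\<mu> * (norm v)\<^sup>2 > 0" using v \<mu> by simp
  ultimately show False using p(2)[OF in_E(1)] p(2)[OF in_E(2)] aff[of p v] by linarith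
qed

lemma segment_prolongation:
  fixes x y :: "'a::euclidean_space"
  assumes "closed F" "closed_segment y x \<inter> F = {}"
  shows "\<exists>d>0. \<forall>s. 0 \<le> s \<and> s \<le> 1 + d \<longrightarrow> y + s *\<^sub>R (x - y) \<notin> F"
proof -
  have "x \<in> - F" "open (- F)" using assms by (auto simp: open_Compl)
  then obtain r where r: "r > 0" "ball x r \<subseteq> - F" using open_contains_ball by blast
  define d where "d = r / (2 * (norm (x - y) + 1))"
  have n: "norm (x - y) + 1 > 0" by (simp add: add_nonneg_pos)
  have d: "d > 0" using r n by (simp add: d_def)
  have "y + s *\<^sub>R (x - y) \<notin> F" if s: "0 \<le> s" "s \<le> 1 + d" for s
  proof (cases "s \<le> 1")
    case True
    then have "y + s *\<^sub>R (x - y) \<in> closed_segment y x"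
      using s by (auto simp: in_segment algebra_simps intro!: exI[of _ s])
    then show ?thesis using assms by auto
  next
    case False
    have "dist x (y + s *\<^sub>R (x - y)) = norm ((1 - s) *\<^sub>R (x - y))" by (simp add: dist_norm algebra_simps)
    also have "\<dots> = (s - 1) * norm (x - y)" using False by simp
    also have "\<dots> \<le> d * (norm (x - y) + 1)" using False s by (intro mult_mono) auto
    also have "\<dots> = r / 2" using n by (simp add: d_def field_simps)
    also have "\<dots> < r" using r by simp
    finally show ?thesis using r by auto
  qed
  then show ?thesis using d by blast
qed

definition det2 :: "real^2 \<Rightarrow> real^2 \<Rightarrow> real" where
  "det2 a b = a $ 1 * b $ 2 - a $ 2 * b $ 1"

lemma det2_zero_imp_collinear:
  assumes "det2 (x - y) (z - y) = 0" shows "collinear {x, y, z}"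
proof -
  have "collinear {0, x - y, z - y}"
  proof (cases "x - y = 0")
    case False
    then consider "(x - y) $ 1 \<noteq> 0" | "(x - y) $ 2 \<noteq> 0" by (auto simp: vec_eq_iff forall_2)
    then show ?thesis
    proof cases
      case 1
      define X where "X = x - y"
      define Z where "Z = z - y"
      have "X $ 1 \<noteq> 0" "X $ 1 * Z $ 2 = X $ 2 * Z $ 1" using 1 assms by (auto simp: X_def Z_def det2_def)
      then have "Z = (Z $ 1 / X $ 1) *\<^sub>R X"
        by (auto simp: vec_eq_iff forall_2 field_simps)
      then have "z - y = (Z $ 1 / X $ 1) *\<^sub>R (x - y)" by (simp add: X_def Z_def)
      then show ?thesis unfolding collinear_lemma by blast
    next
      case 2
      define X where "X = x - y"
      define Z where "Z = z - y"
      have "X $ 2 \<noteq> 0" "X $ 1 * Z $ 2 = X $ 2 * Z $ 1" using 2 assms by (auto simp: X_def Z_def det2_def)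
      then have "Z = (Z $ 2 / X $ 2) *\<^sub>R X"
        by (auto simp: vec_eq_iff forall_2 field_simps)
      then have "z - y = (Z $ 2 / X $ 2) *\<^sub>R (x - y)" by (simp add: X_def Z_def)
      then show ?thesis unfolding collinear_lemma by blast
    qed
  qed (simp add: collinear_lemma)
  then show ?thesis using collinear_3[of x y z] by simp
qed

text \<open>The planar Tietze--Nakajima theorem: \<open>F\<close> cannot enter a triangle only through its third side, since
the part inside would have a tip pointing towards the opposite vertex \<open>y\<close>.\<close>
lemma visibility_transitive:
  assumes F: "closed F" "tip_free F"
    and xy: "closed_segment y x \<inter> F = {}" and yz: "closed_segment y z \<inter> F = {}"
  shows "closed_segment x z \<inter> F = {}"
proof (cases "det2 (x - y) (z - y) = 0")
  case True
  have "closed_segment x z \<subseteq> closed_segment y x \<union> closed_segment y z"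
    using det2_zero_imp_collinear[OF True] unfolding collinear_between_cases between_mem_segment
  proof (elim disjE)
    assume "x \<in> closed_segment y z"
    then show ?thesis by (meson ends_in_segment(2) le_supI2 subset_closed_segment)
  next
    assume "y \<in> closed_segment z x"
    then show ?thesis using Un_closed_segment[of y z x] by (auto simp: closed_segment_commute)
  next
    assume "z \<in> closed_segment x y"
    then have "closed_segment x z \<subseteq> closed_segment x y" by (meson ends_in_segment(1) subset_closed_segment)
    then show ?thesis by (auto simp: closed_segment_commute)
  qed
  then show ?thesis using xy yz by blast
next
  case False
  obtain d1 where d1: "d1 > 0" "\<And>s. 0 \<le> s \<Longrightarrow> s \<le> 1 + d1 \<Longrightarrow> y + s *\<^sub>R (x - y) \<notin> F"
    using segment_prolongation[OF F(1) xy] by blast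
  obtain d2 where d2: "d2 > 0" "\<And>s. 0 \<le> s \<Longrightarrow> s \<le> 1 + d2 \<Longrightarrow> y + s *\<^sub>R (z - y) \<notin> F"
    using segment_prolongation[OF F(1) yz] by blast
  define d where "d = min d1 d2"
  have d: "d > 0" "d \<le> d1" "d \<le> d2" using d1 d2 by (auto simp: d_def)
  define D where "D = det2 (x - y) (z - y)"
  have D: "D \<noteq> 0" using False by (simp add: D_def)
  define \<sigma> where "\<sigma> = (\<lambda>p. det2 (p - y) (z - y) / D)"
  define \<tau> where "\<tau> = (\<lambda>p. det2 (x - y) (p - y) / D)"
  have coords: "p = y + \<sigma> p *\<^sub>R (x - y) + \<tau> p *\<^sub>R (z - y)" for p
    using D unfolding \<sigma>_def \<tau>_def D_def det2_def
    by (simp add: vec_eq_iff forall_2 divide_simps) (simp add: algebra_simps)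
  have c\<sigma>: "continuous_on A \<sigma>" and c\<tau>: "continuous_on A \<tau>" for A
    unfolding \<sigma>_def \<tau>_def det2_def using D by (auto intro!: continuous_intros)
  show ?thesis
  proof (rule ccontr)
    assume "closed_segment x z \<inter> F \<noteq> {}"
    then obtain q where "q \<in> F" "q \<in> closed_segment x z" by blast
    then obtain s where q: "q \<in> F" "0 \<le> s" "s \<le> 1" "q = (1 - s) *\<^sub>R x + s *\<^sub>R z"
      unfolding in_segment by blast
    have qs: "\<sigma> q = 1 - s" "\<tau> q = s"
      using D unfolding q(4) \<sigma>_def \<tau>_def D_def det2_def by (simp_all add: divide_simps) (simp_all add: algebra_simps)
    \<comment> \<open>The triangle is enlarged beyond its third side, so that \<open>q\<close> lies strictly below the line \<open>\<sigma> + \<tau> = 1 + d\<close>.\<close>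
    define E where "E = F \<inter> {p. 0 \<le> \<sigma> p \<and> 0 \<le> \<tau> p \<and> \<sigma> p + \<tau> p \<le> 1 + d}"
    have "closed E" unfolding E_def
      by (intro closed_Int F closed_Collect_conj closed_Collect_le continuous_intros c\<sigma> c\<tau>)
    moreover have "bounded E"
    proof (rule boundedI)
      fix p assume "p \<in> E"
      then have st: "0 \<le> \<sigma> p" "\<sigma> p \<le> 1 + d" "0 \<le> \<tau> p" "\<tau> p \<le> 1 + d" by (auto simp: E_def)
      have "norm p \<le> norm y + norm (\<sigma> p *\<^sub>R (x - y)) + norm (\<tau> p *\<^sub>R (z - y))"
        using arg_cong[OF coords[of p], of norm] norm_triangle_ineq[of y "\<sigma> p *\<^sub>R (x - y)"]
          norm_triangle_ineq[of "y + \<sigma> p *\<^sub>R (x - y)" "\<tau> p *\<^sub>R (z - y)"] by linarith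
      also have "\<dots> \<le> norm y + (1 + d) * norm (x - y) + (1 + d) * norm (z - y)"
        using st by (auto intro!: add_mono mult_right_mono)
      finally show "norm p \<le> norm y + (1 + d) * norm (x - y) + (1 + d) * norm (z - y)" .
    qed
    ultimately have "compact E" using compact_eq_bounded_closed by blast
    then show False
    proof (rule tip_free_no_cap[OF F(2), where b=q and \<phi>="\<lambda>p. \<sigma> p + \<tau> p" and c="1 + d"])
      show "E \<subseteq> F" "q \<in> E" "\<sigma> q + \<tau> q < 1 + d" using q qs d by (auto simp: E_def)
      show "continuous_on E (\<lambda>p. \<sigma> p + \<tau> p)" by (intro continuous_intros c\<sigma> c\<tau>)
      show "\<sigma> (p + v) + \<tau> (p + v) + (\<sigma> (p - v) + \<tau> (p - v)) = 2 * (\<sigma> p + \<tau> p)" for p v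
        unfolding \<sigma>_def \<tau>_def det2_def using D by (simp add: divide_simps) (simp add: algebra_simps)
      fix p assume p: "p \<in> E" "\<sigma> p + \<tau> p < 1 + d"
      have "\<sigma> p \<noteq> 0"
      proof
        assume "\<sigma> p = 0"
        then have "p = y + \<tau> p *\<^sub>R (z - y)" using coords[of p] by simp
        then show False using d2(2)[of "\<tau> p"] p d by (auto simp: E_def)
      qed
      moreover have "\<tau> p \<noteq> 0"
      proof
        assume "\<tau> p = 0"
        then have "p = y + \<sigma> p *\<^sub>R (x - y)" using coords[of p] by simp
        then show False using d1(2)[of "\<sigma> p"] p d by (auto simp: E_def)
      qed
      ultimately have "p \<in> {p. 0 < \<sigma> p \<and> 0 < \<tau> p \<and> \<sigma> p + \<tau> p < 1 + d}" using p by (auto simp: E_def)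
      moreover have "open {p. 0 < \<sigma> p \<and> 0 < \<tau> p \<and> \<sigma> p + \<tau> p < 1 + d}"
        by (intro open_Collect_conj open_Collect_less continuous_intros c\<sigma> c\<tau>)
      ultimately obtain r where "r > 0" "ball p r \<subseteq> {p. 0 < \<sigma> p \<and> 0 < \<tau> p \<and> \<sigma> p + \<tau> p < 1 + d}"
        using open_contains_ball by blast
      then show "\<exists>r>0. F \<inter> ball p r \<subseteq> E" by (intro exI[of _ r]) (auto simp: E_def subset_iff less_imp_le)
    qed
  qed
qed

text \<open>The set \<open>C\<close> of points that see \<open>b \<in> F2\<close> in the complement of \<open>F1\<close> is open and convex, and its boundary lies in
\<open>F1\<close>. If \<open>C\<close> missed a point of the line through \<open>b\<close> parallel to a supporting line of \<open>C\<close>, two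
nonparallel supporting lines would enclose \<open>C\<close> in a wedge. Then the part of \<open>F2\<close> in \<open>C\<close> would
have a cap at the vertex of the wedge. So \<open>C\<close> contains that line and, by convexity, the strip up to
the supporting line, which is therefore part of the boundary of \<open>C\<close>. The point \<open>b\<close> in the conclusion tells on which
side of the line the complement of \<open>F1\<close> lies.\<close>
lemma disjoint_tip_free_boundary_line:
  fixes F1 F2 :: "(real^2) set"
  assumes F1: "closed F1" "tip_free F1" "F1 \<noteq> {}" and F2: "closed F2" "tip_free F2" "F2 \<noteq> {}"
    and disj: "F1 \<inter> F2 = {}"
  obtains n c p0 b where "norm n = 1" "p0 \<bullet> n = c" "b \<bullet> n < c"
    "\<And>z. z \<bullet> n = c \<Longrightarrow> z \<in> F1 \<and> z \<in> closure (- F1)" "open_segment p0 b \<inter> F1 = {}"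
proof -
  obtain b where b: "b \<in> F2" using F2 by auto
  define C where "C = {y. closed_segment b y \<inter> F1 = {}}"
  have bC: "b \<in> C" using b disj by (auto simp: C_def)
  have CF: "C \<inter> F1 = {}" by (auto simp: C_def)
  have opC: "closed_segment y y' \<inter> F1 = {} \<Longrightarrow> y \<in> C \<Longrightarrow> y' \<in> C" for y y'
    using visibility_transitive[OF F1(1,2), of y b y'] by (auto simp: C_def closed_segment_commute)
  have nb: "\<exists>r>0. \<forall>y'\<in>ball y r. closed_segment y y' \<inter> F1 = {}" if yF: "y \<notin> F1" for y
  proof -
    obtain r where "r > 0" "ball y r \<subseteq> - F1" 
      using yF open_contains_ball_eq[OF open_Compl[OF F1(1)], of y] by auto
    moreover have "closed_segment y y' \<subseteq> ball y r" if "y' \<in> ball y r" for y'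
      using that \<open>r > 0\<close> by (intro closed_segment_subset) auto
    ultimately show ?thesis by blast
  qed
  have "open C"
    unfolding open_contains_ball
  proof
    fix y assume y: "y \<in> C"
    then obtain r where "r > 0" "\<forall>y'\<in>ball y r. closed_segment y y' \<inter> F1 = {}" using nb CF by blast
    then show "\<exists>e>0. ball y e \<subseteq> C" using opC y by blast
  qed
  have clC: "y \<in> closure C \<Longrightarrow> y \<notin> C \<Longrightarrow> y \<in> F1" for y
  proof (rule ccontr)
    assume y: "y \<in> closure C" "y \<notin> C" "y \<notin> F1"
    obtain r where r: "r > 0" "\<forall>y'\<in>ball y r. closed_segment y y' \<inter> F1 = {}" using nb y by blast
    obtain y' where "y' \<in> C" "dist y' y < r" using y r closure_approachable by blast
    then show False using r opC[of y' y] y by (auto simp: closed_segment_commute dist_commute)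
  qed
  have "convex C"
    unfolding convex_contains_segment
  proof (intro ballI subsetI)
    fix y1 y2 q assume y: "y1 \<in> C" "y2 \<in> C" and q: "q \<in> closed_segment y1 y2"
    have "closed_segment y1 y2 \<inter> F1 = {}"
      using visibility_transitive[OF F1(1,2), of b y1 y2] y by (auto simp: C_def)
    moreover have "closed_segment y1 q \<subseteq> closed_segment y1 y2" using q by (meson ends_in_segment(1) subset_closed_segment)
    ultimately show "q \<in> C" using opC[of y1 q] y by blast
  qed
  have "frontier C \<noteq> {}" using bC CF F1(3) by (intro frontier_not_empty) auto
  then obtain p0 where p0: "p0 \<in> closure C" "p0 \<notin> C" using \<open>open C\<close> by (auto simp: frontier_def interior_open)
  obtain n' where n': "n' \<noteq> 0" "\<And>z. z \<in> C \<Longrightarrow> z \<bullet> n' \<le> p0 \<bullet> n'"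
    using separating_hyperplane_sets[OF \<open>convex C\<close> convex_singleton[of p0]] bC p0 by (force simp: inner_commute)
  define n where "n = sgn n'"
  have n: "norm n = 1" using n' by (simp add: n_def norm_sgn)
  define c where "c = p0 \<bullet> n"
  have le: "z \<bullet> n \<le> c" if "z \<in> C" for z
    using n'(2)[OF that] n' by (simp add: n_def c_def sgn_div_norm divide_right_mono)
  have strict: "z \<bullet> a < k" if z: "z \<in> C" and a: "a \<noteq> 0" "\<And>z. z \<in> C \<Longrightarrow> z \<bullet> a \<le> k" for z a k
  proof -
    obtain r where r: "r > 0" "ball z r \<subseteq> C" using \<open>open C\<close> z open_contains_ball by blast
    define z' where "z' = z + (r / (2 * norm a)) *\<^sub>R a"
    have "dist z z' = r / 2" using a r by (simp add: z'_def dist_norm)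
    then have "z' \<in> C" using r by auto
    then have "z' \<bullet> a \<le> k" by (rule a)
    moreover have "z' \<bullet> a = z \<bullet> a + (r / (2 * norm a)) * (a \<bullet> a)" by (simp add: z'_def inner_simps)
    moreover have "(r / (2 * norm a)) * (a \<bullet> a) > 0" using a r by simp
    ultimately show ?thesis by linarith
  qed
  have lt: "z \<bullet> n < c" if "z \<in> C" for z using strict[OF that _ le] n by fastforce
  obtain e where e: "norm e = 1" "e \<bullet> n = 0" using exists_orthogonal_unit[OF n] .
  have decomp: "z = (z \<bullet> n) *\<^sub>R n + (z \<bullet> e) *\<^sub>R e" for z
    using e(2) by (intro orthonormal_expansion n e(1)) (simp add: inner_commute)
  have line: "b + s *\<^sub>R e \<in> C" for s
  proof (rule ccontr)
    define q where "q = b + s *\<^sub>R e"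
    assume "b + s *\<^sub>R e \<notin> C"
    then obtain a where a: "a \<noteq> 0" "\<And>z. z \<in> C \<Longrightarrow> z \<bullet> a \<le> q \<bullet> a"
      using separating_hyperplane_sets[OF \<open>convex C\<close> convex_singleton[of q]] bC by (force simp: inner_commute q_def)
    have "b \<bullet> a < q \<bullet> a" using strict[OF bC a] .
    then have ae: "a \<bullet> e \<noteq> 0" by (auto simp: q_def inner_simps inner_commute)
    define \<phi> where "\<phi> = (\<lambda>z. (c - z \<bullet> n) + (q \<bullet> a - z \<bullet> a))"
    define L where "L = \<phi> b + 1"
    have leC: "z \<bullet> n \<le> c" "z \<bullet> a \<le> q \<bullet> a" if "z \<in> closure C" for z
    proof -
      have "closure C \<subseteq> {z. z \<bullet> n \<le> c} \<inter> {z. z \<bullet> a \<le> q \<bullet> a}"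
        by (rule closure_minimal) (auto simp: le a intro!: closed_Int closed_Collect_le continuous_intros)
      then show "z \<bullet> n \<le> c" "z \<bullet> a \<le> q \<bullet> a" using that by auto
    qed
    \<comment> \<open>The cap of the wedge below the level of \<open>b\<close>, raised a little.\<close>
    define E where "E = F2 \<inter> closure C \<inter> {z. \<phi> z \<le> L}"
    have cphi: "continuous_on A \<phi>" for A unfolding \<phi>_def by (intro continuous_intros)
    have "closed E" unfolding E_def by (intro closed_Int F2 closed_closure closed_Collect_le cphi continuous_intros)
    moreover have "bounded E"
    proof (rule boundedI)
      fix z assume "z \<in> E"
      then have zz: "z \<bullet> n \<le> c" "z \<bullet> a \<le> q \<bullet> a" "\<phi> z \<le> L" using leC by (auto simp: E_def)
      then have zn: "\<bar>z \<bullet> n\<bar> \<le> \<bar>c\<bar> + \<bar>L\<bar>" and za: "\<bar>z \<bullet> a\<bar> \<le> \<bar>q \<bullet> a\<bar> + \<bar>L\<bar>" unfolding \<phi>_def by linarith+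
      have "z \<bullet> a = (z \<bullet> n) * (n \<bullet> a) + (z \<bullet> e) * (e \<bullet> a)"
        by (subst decomp) (simp only: inner_simps inner_scaleR_left)
      then have "(z \<bullet> e) * (a \<bullet> e) = z \<bullet> a - (z \<bullet> n) * (n \<bullet> a)" by (simp add: inner_commute)
      then have "\<bar>z \<bullet> e\<bar> * \<bar>a \<bullet> e\<bar> = \<bar>z \<bullet> a - (z \<bullet> n) * (n \<bullet> a)\<bar>" by (metis abs_mult)
      also have "\<dots> \<le> \<bar>z \<bullet> a\<bar> + \<bar>z \<bullet> n\<bar> * \<bar>n \<bullet> a\<bar>" by (metis abs_mult abs_triangle_ineq4)
      also have "\<dots> \<le> (\<bar>q \<bullet> a\<bar> + \<bar>L\<bar>) + (\<bar>c\<bar> + \<bar>L\<bar>) * \<bar>n \<bullet> a\<bar>"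
        using zn za by (intro add_mono mult_right_mono) auto
      finally have ze: "\<bar>z \<bullet> e\<bar> \<le> ((\<bar>q \<bullet> a\<bar> + \<bar>L\<bar>) + (\<bar>c\<bar> + \<bar>L\<bar>) * \<bar>n \<bullet> a\<bar>) / \<bar>a \<bullet> e\<bar>"
        using ae by (simp add: field_simps)
      have "norm z \<le> \<bar>z \<bullet> n\<bar> + \<bar>z \<bullet> e\<bar>"
        using norm_triangle_ineq[of "(z \<bullet> n) *\<^sub>R n" "(z \<bullet> e) *\<^sub>R e"] decomp[of z] n e(1) by simp
      then show "norm z \<le> (\<bar>c\<bar> + \<bar>L\<bar>) + ((\<bar>q \<bullet> a\<bar> + \<bar>L\<bar>) + (\<bar>c\<bar> + \<bar>L\<bar>) * \<bar>n \<bullet> a\<bar>) / \<bar>a \<bullet> e\<bar>"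
        using zn ze by linarith
    qed
    ultimately have "compact E" using compact_eq_bounded_closed by blast
    then show False
    proof (rule tip_free_no_cap[OF F2(2), where b=b and \<phi>=\<phi> and c=L])
      show "E \<subseteq> F2" "b \<in> E" "\<phi> b < L" using b bC closure_subset[of C] by (auto simp: E_def L_def)
      show "continuous_on E \<phi>" by (rule cphi)
      show "\<phi> (p + v) + \<phi> (p - v) = 2 * \<phi> p" for p v by (simp add: \<phi>_def inner_simps)
      fix p assume p: "p \<in> E" "\<phi> p < L"
      then have "p \<in> C" using clC disj by (auto simp: E_def)
      moreover have "open {p. \<phi> p < L}" by (intro open_Collect_less cphi continuous_intros)
      ultimately obtain r where "r > 0" "ball p r \<subseteq> C \<inter> {p. \<phi> p < L}"
        using p \<open>open C\<close> open_contains_ball[of "C \<inter> {p. \<phi> p < L}"] by blast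
      then show "\<exists>r>0. F2 \<inter> ball p r \<subseteq> E"
        using closure_subset[of C] by (intro exI[of _ r]) (auto simp: E_def subset_iff less_imp_le)
    qed
  qed
  have cl: "z \<in> closure C" if z: "z \<bullet> n = c" for z
  proof -
    define s where "s = (z - p0) \<bullet> e"
    have "z - p0 = ((z - p0) \<bullet> n) *\<^sub>R n + s *\<^sub>R e" unfolding s_def by (rule decomp)
    then have zs: "z = p0 + s *\<^sub>R e" using z by (simp add: inner_simps c_def algebra_simps)
    have "z + inverse (real (Suc k)) *\<^sub>R (b - p0) \<in> closure C" for k
    proof -
      define t where "t = inverse (real (Suc k))"
      have t: "0 < t" "t \<le> 1" by (auto simp: t_def inverse_le_1_iff)
      have "(1 - t) *\<^sub>R p0 + t *\<^sub>R (b + (s / t) *\<^sub>R e) \<in> closure C"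
        using t p0 line[of "s / t"] closure_subset[of C] \<open>convex C\<close>
        by (intro convexD[OF convex_closure]) auto
      also have "(1 - t) *\<^sub>R p0 + t *\<^sub>R (b + (s / t) *\<^sub>R e) = z + t *\<^sub>R (b - p0)"
        using t by (simp add: zs algebra_simps)
      finally show ?thesis by (simp add: t_def)
    qed
    moreover have "(\<lambda>k. z + inverse (real (Suc k)) *\<^sub>R (b - p0)) \<longlonglongrightarrow> z + 0 *\<^sub>R (b - p0)"
      by (intro tendsto_intros LIMSEQ_inverse_real_of_nat)
    ultimately show ?thesis using closed_sequentially[OF closed_closure] by force
  qed
  show ?thesis
  proof (rule that[of n p0 c b])
    show "norm n = 1" "p0 \<bullet> n = c" "b \<bullet> n < c" using n lt[OF bC] by (auto simp: c_def)
    show "z \<in> F1 \<and> z \<in> closure (- F1)" if "z \<bullet> n = c" for z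
    proof
      show "z \<in> F1" using clC[OF cl[OF that]] lt[of z] that by fastforce
      have "C \<subseteq> - F1" using CF by auto
      then show "z \<in> closure (- F1)" using cl[OF that] closure_mono by blast
    qed
    have "open_segment b p0 \<subseteq> interior C"
      using \<open>open C\<close> bC p0 \<open>convex C\<close> by (intro in_interior_closure_convex_segment) (auto simp: interior_open)
    then show "open_segment p0 b \<inter> F1 = {}" using CF interior_subset by (auto simp: open_segment_commute)
  qed
qed

text \<open>Unless \<open>n + m = 0\<close>, both half planes contain the points \<open>t (n + m)\<close> with large \<open>t\<close>.\<close>
lemma disjoint_half_planes_opposite:
  fixes n m :: "'a::real_inner"
  assumes "norm n = 1" "norm m = 1" and disj: "\<And>z. z \<bullet> n > c \<Longrightarrow> z \<bullet> m > d \<Longrightarrow> False"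
  shows "m = - n"
proof -
  have nn: "n \<bullet> n = 1" "m \<bullet> m = 1" using assms by (simp_all add: norm_eq_1)
  have "1 + n \<bullet> m \<le> 0"
  proof (rule ccontr)
    assume "\<not> 1 + n \<bullet> m \<le> 0"
    then have pos: "1 + n \<bullet> m > 0" by simp
    define t where "t = (\<bar>c\<bar> + \<bar>d\<bar> + 1) / (1 + n \<bullet> m)"
    have "t * (1 + n \<bullet> m) = \<bar>c\<bar> + \<bar>d\<bar> + 1" using pos by (simp add: t_def)
    then have "(t *\<^sub>R (n + m)) \<bullet> n > c" "(t *\<^sub>R (n + m)) \<bullet> m > d"
      using nn by (simp_all add: inner_simps inner_commute algebra_simps)
    then show False by (rule disj)
  qed
  moreover have "(n + m) \<bullet> (n + m) = 2 * (1 + n \<bullet> m)" using nn by (simp add: inner_simps inner_commute)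
  ultimately have "(n + m) \<bullet> (n + m) \<le> 0" by simp
  then have "n + m = 0" using inner_eq_zero_iff inner_ge_zero by (metis order_antisym)
  then show ?thesis by (simp add: eq_neg_iff_add_eq_0 add.commute)
qed

section \<open>Smooth boundaries as graphs\<close>

text \<open>In contrast to the description by a ball in \<open>smooth_boundary\<close>, the chart is a curvilinear rectangle over an interval
of parameters. So curves parallel to the boundary can be followed inside the set.\<close>
definition graph_chart :: "(real^2) set \<Rightarrow> real^2 \<Rightarrow> real^2 \<Rightarrow> real^2 \<Rightarrow> (real \<Rightarrow> real) \<Rightarrow> real \<Rightarrow> bool" where
  "graph_chart A p \<tau> \<nu> g h \<longleftrightarrow>
     h > 0 \<and> norm \<tau> = 1 \<and> norm \<nu> = 1 \<and> \<tau> \<bullet> \<nu> = 0 \<and> smooth_real g \<and> p \<bullet> \<nu> = g (p \<bullet> \<tau>) \<and>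
     (\<forall>t s. \<bar>t - p \<bullet> \<tau>\<bar> \<le> h \<longrightarrow> \<bar>s\<bar> \<le> h \<longrightarrow> (t *\<^sub>R \<tau> + (g t + s) *\<^sub>R \<nu> \<in> A \<longleftrightarrow> s > 0))"

lemma smooth_real_derivs:
  assumes "smooth_real g"
  shows "(g has_real_derivative deriv g t) (at t)"
    "(deriv g has_real_derivative deriv (deriv g) t) (at t)"
    "continuous_on A g" "continuous_on A (deriv g)" "continuous_on A (deriv (deriv g))"
proof -
  have d: "(deriv ^^ n) g differentiable_on UNIV" for n
    using assms unfolding smooth_real_def by blast
  have 0: "g differentiable_on UNIV" and 1: "deriv g differentiable_on UNIV"
    and 2: "deriv (deriv g) differentiable_on UNIV"
    using d[of 0] d[of 1] d[of 2] by (simp_all add: numeral_2_eq_2)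
  show "(g has_real_derivative deriv g t) (at t)"
    using 0 by (simp add: differentiable_on_def DERIV_deriv_iff_real_differentiable)
  show "(deriv g has_real_derivative deriv (deriv g) t) (at t)"
    using 1 by (simp add: differentiable_on_def DERIV_deriv_iff_real_differentiable)
  show "continuous_on A g" "continuous_on A (deriv g)" "continuous_on A (deriv (deriv g))"
    using 0 1 2 by (auto intro: continuous_on_subset differentiable_imp_continuous_on)
qed

lemma graph_chart_ball:
  assumes gc: "graph_chart A p \<tau> \<nu> g h"
  obtains r where "r > 0"
    "\<And>x. x \<in> ball p r \<Longrightarrow> (x \<in> A \<longleftrightarrow> g (x \<bullet> \<tau>) < x \<bullet> \<nu>) \<and> \<bar>x \<bullet> \<tau> - p \<bullet> \<tau>\<bar> < h \<and> \<bar>x \<bullet> \<nu> - g (x \<bullet> \<tau>)\<bar> < h"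
proof -
  have ch: "h > 0" "norm \<tau> = 1" "norm \<nu> = 1" "\<tau> \<bullet> \<nu> = 0" "smooth_real g" "p \<bullet> \<nu> = g (p \<bullet> \<tau>)"
    "\<And>t s. \<bar>t - p \<bullet> \<tau>\<bar> \<le> h \<Longrightarrow> \<bar>s\<bar> \<le> h \<Longrightarrow> (t *\<^sub>R \<tau> + (g t + s) *\<^sub>R \<nu> \<in> A \<longleftrightarrow> s > 0)"
    using gc unfolding graph_chart_def by blast+
  define U where "U = {x. \<bar>x \<bullet> \<tau> - p \<bullet> \<tau>\<bar> < h \<and> \<bar>x \<bullet> \<nu> - g (x \<bullet> \<tau>)\<bar> < h}"
  have cg: "continuous_on UNIV (\<lambda>x. g (x \<bullet> \<tau>))"
    by (rule continuous_on_compose2[OF smooth_real_derivs(3)[OF ch(5), of UNIV]]) (auto intro!: continuous_intros)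
  have "open U" unfolding U_def
    by (intro open_Collect_conj open_Collect_less continuous_intros cg)
  moreover have "p \<in> U" using ch by (simp add: U_def)
  ultimately obtain r where r: "r > 0" "ball p r \<subseteq> U" using open_contains_ball by blast
  show ?thesis
  proof (rule that[OF r(1)])
    fix x assume "x \<in> ball p r"
    then have x: "\<bar>x \<bullet> \<tau> - p \<bullet> \<tau>\<bar> < h" "\<bar>x \<bullet> \<nu> - g (x \<bullet> \<tau>)\<bar> < h" using r by (auto simp: U_def)
    have "x = (x \<bullet> \<tau>) *\<^sub>R \<tau> + (g (x \<bullet> \<tau>) + (x \<bullet> \<nu> - g (x \<bullet> \<tau>))) *\<^sub>R \<nu>"
      using orthonormal_expansion[OF ch(2-4), of x] by simp
    then have "x \<in> A \<longleftrightarrow> x \<bullet> \<nu> - g (x \<bullet> \<tau>) > 0"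
      using ch(7)[of "x \<bullet> \<tau>" "x \<bullet> \<nu> - g (x \<bullet> \<tau>)"] x by simp
    then show "(x \<in> A \<longleftrightarrow> g (x \<bullet> \<tau>) < x \<bullet> \<nu>) \<and> \<bar>x \<bullet> \<tau> - p \<bullet> \<tau>\<bar> < h \<and> \<bar>x \<bullet> \<nu> - g (x \<bullet> \<tau>)\<bar> < h"
      using x by simp
  qed
qed

lemma graph_chart_closure:
  assumes gc: "graph_chart A p \<tau> \<nu> g h" and t: "\<bar>t - p \<bullet> \<tau>\<bar> \<le> h" and s: "0 \<le> s" "s \<le> h"
  shows "t *\<^sub>R \<tau> + (g t + s) *\<^sub>R \<nu> \<in> closure A"
proof (cases "s = 0")
  case False
  then have "t *\<^sub>R \<tau> + (g t + s) *\<^sub>R \<nu> \<in> A" using gc t s unfolding graph_chart_def by auto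
  then show ?thesis using closure_subset by blast
next
  case True
  have h: "h > 0" and n: "norm \<nu> = 1" using gc by (auto simp: graph_chart_def)
  show ?thesis unfolding closure_approachable
  proof (intro allI impI)
    fix e :: real assume e: "e > 0"
    define s' where "s' = min h (e / 2)"
    have s': "0 < s'" "s' \<le> h" "s' < e" using h e by (auto simp: s'_def)
    have "t *\<^sub>R \<tau> + (g t + s') *\<^sub>R \<nu> \<in> A" using gc t s' unfolding graph_chart_def by auto
    moreover have "dist (t *\<^sub>R \<tau> + (g t + s') *\<^sub>R \<nu>) (t *\<^sub>R \<tau> + (g t + s) *\<^sub>R \<nu>) < e"
      using True s' n by (simp add: dist_norm algebra_simps)
    ultimately show "\<exists>y\<in>A. dist y (t *\<^sub>R \<tau> + (g t + s) *\<^sub>R \<nu>) < e" by blast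
  qed
qed

lemma graph_chart_closure_ball:
  assumes gc: "graph_chart A p \<tau> \<nu> g h"
  obtains r where "r > 0"
    "\<And>x. x \<in> ball p r \<Longrightarrow> (x \<in> A \<longleftrightarrow> g (x \<bullet> \<tau>) < x \<bullet> \<nu>)"
    "\<And>x. x \<in> ball p r \<Longrightarrow> (x \<in> closure A \<longleftrightarrow> g (x \<bullet> \<tau>) \<le> x \<bullet> \<nu>)"
    "\<And>x. x \<in> ball p r \<Longrightarrow> \<bar>x \<bullet> \<tau> - p \<bullet> \<tau>\<bar> < h"
proof -
  obtain r where r: "r > 0" "\<And>x. x \<in> ball p r \<Longrightarrow> (x \<in> A \<longleftrightarrow> g (x \<bullet> \<tau>) < x \<bullet> \<nu>) \<and> \<bar>x \<bullet> \<tau> - p \<bullet> \<tau>\<bar> < h \<and> \<bar>x \<bullet> \<nu> - g (x \<bullet> \<tau>)\<bar> < h"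
    using graph_chart_ball[OF gc] by blast
  have ch: "norm \<tau> = 1" "norm \<nu> = 1" "\<tau> \<bullet> \<nu> = 0" "smooth_real g"
    using gc unfolding graph_chart_def by blast+
  have cg: "continuous_on UNIV (\<lambda>x. g (x \<bullet> \<tau>))"
    by (rule continuous_on_compose2[OF smooth_real_derivs(3)[OF ch(4), of UNIV]]) (auto intro!: continuous_intros)
  have "x \<in> closure A \<longleftrightarrow> g (x \<bullet> \<tau>) \<le> x \<bullet> \<nu>" if x: "x \<in> ball p r" for x
  proof
    assume cl: "x \<in> closure A"
    show "g (x \<bullet> \<tau>) \<le> x \<bullet> \<nu>"
    proof (rule ccontr)
      define U where "U = ball p r \<inter> {x. x \<bullet> \<nu> < g (x \<bullet> \<tau>)}"
      assume "\<not> g (x \<bullet> \<tau>) \<le> x \<bullet> \<nu>"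
      then have "x \<in> U" using x by (simp add: U_def)
      moreover have "open U" unfolding U_def
        by (intro open_Int open_ball open_Collect_less continuous_intros cg)
      ultimately have "U \<inter> A \<noteq> {}" using cl closure_iff_nhds_not_empty by (metis Int_commute subset_refl)
      then show False using r(2) by (auto simp: U_def)
    qed
  next
    assume le: "g (x \<bullet> \<tau>) \<le> x \<bullet> \<nu>"
    have "x = (x \<bullet> \<tau>) *\<^sub>R \<tau> + (g (x \<bullet> \<tau>) + (x \<bullet> \<nu> - g (x \<bullet> \<tau>))) *\<^sub>R \<nu>"
      using orthonormal_expansion[OF ch(1-3), of x] by simp
    then show "x \<in> closure A"
      using graph_chart_closure[OF gc, of "x \<bullet> \<tau>" "x \<bullet> \<nu> - g (x \<bullet> \<tau>)"] le r(2)[OF x] by simp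
  qed
  then show ?thesis using that[OF r(1)] r(2) by blast
qed

lemma frontier_graph_chart:
  assumes sm: "smooth_boundary A" and op: "open A" and p: "p \<in> frontier A"
  obtains \<tau> \<nu> g h where "graph_chart A p \<tau> \<nu> g h"
proof -
  obtain r \<tau> \<nu> g where ch: "r > 0" "norm \<tau> = 1" "norm \<nu> = 1" "\<tau> \<bullet> \<nu> = 0" "smooth_real g"
    and chart: "\<And>x. x \<in> ball p r \<Longrightarrow> x \<in> A \<longleftrightarrow> g (x \<bullet> \<tau>) < x \<bullet> \<nu>"
    using sm p unfolding smooth_boundary_def by metis
  have cg: "continuous_on UNIV (\<lambda>x. g (x \<bullet> \<tau>))"
    by (rule continuous_on_compose2[OF smooth_real_derivs(3)[OF ch(5), of UNIV]]) (auto intro!: continuous_intros)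
  have pA: "p \<in> closure A" "p \<notin> A" using p op by (auto simp: frontier_def interior_open)
  have val: "p \<bullet> \<nu> = g (p \<bullet> \<tau>)"
  proof (rule ccontr)
    define U where "U = ball p r \<inter> {x. x \<bullet> \<nu> < g (x \<bullet> \<tau>)}"
    assume "p \<bullet> \<nu> \<noteq> g (p \<bullet> \<tau>)"
    then have "p \<in> U" using chart[of p] ch pA by (auto simp: U_def)
    moreover have "open U" unfolding U_def
      by (intro open_Int open_ball open_Collect_less continuous_intros cg)
    ultimately have "U \<inter> A \<noteq> {}" using pA closure_iff_nhds_not_empty by (metis Int_commute subset_refl)
    then show False using chart by (auto simp: U_def)
  qed
  define t0 where "t0 = p \<bullet> \<tau>"
  have "isCont g t0" using smooth_real_derivs(1)[OF ch(5)] DERIV_isCont by blast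
  then obtain d where d: "d > 0" "\<And>t. \<bar>t - t0\<bar> < d \<Longrightarrow> \<bar>g t - g t0\<bar> < r / 3"
    using ch(1) unfolding continuous_at_eps_delta by (metis divide_pos_pos real_norm_def zero_less_numeral dist_norm)
  define h where "h = min (d / 2) (r / 4)"
  have h: "h > 0" "h < d" "h \<le> r / 4" using d ch by (auto simp: h_def)
  have p_eq: "p = t0 *\<^sub>R \<tau> + g t0 *\<^sub>R \<nu>" using orthonormal_expansion[OF ch(2-4), of p] val by (simp add: t0_def)
  have tt: "\<tau> \<bullet> \<tau> = 1" "\<nu> \<bullet> \<nu> = 1" using ch by (auto simp: norm_eq_1)
  have "t *\<^sub>R \<tau> + (g t + s) *\<^sub>R \<nu> \<in> A \<longleftrightarrow> s > 0" if ts: "\<bar>t - t0\<bar> \<le> h" "\<bar>s\<bar> \<le> h" for t s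
  proof -
    have "t *\<^sub>R \<tau> + (g t + s) *\<^sub>R \<nu> - p = (t - t0) *\<^sub>R \<tau> + ((g t - g t0) + s) *\<^sub>R \<nu>"
      unfolding p_eq by (simp add: algebra_simps)
    then have "dist p (t *\<^sub>R \<tau> + (g t + s) *\<^sub>R \<nu>) \<le> \<bar>t - t0\<bar> + \<bar>(g t - g t0) + s\<bar>"
      using dist_norm[of "t *\<^sub>R \<tau> + (g t + s) *\<^sub>R \<nu>" p] dist_commute[of p]
        norm_triangle_ineq[of "(t - t0) *\<^sub>R \<tau>" "((g t - g t0) + s) *\<^sub>R \<nu>"] ch by simp
    also have "\<dots> < r" using d(2)[of t] ts h ch(1) by linarith
    finally have "t *\<^sub>R \<tau> + (g t + s) *\<^sub>R \<nu> \<in> ball p r" by simp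
    from chart[OF this] show ?thesis using tt ch(4) by (simp add: inner_simps inner_commute)
  qed
  then have "graph_chart A p \<tau> \<nu> g h" unfolding graph_chart_def using h ch val by (simp add: t0_def)
  then show ?thesis by (rule that)
qed

text \<open>The part of \<open>\<Omega>\<close> in a chart is connected, so it lies in one of the pieces. Hence each piece inherits the
charts of \<open>\<Omega>\<close> at its boundary points.\<close>
lemma graph_chart_piece:
  assumes gc: "graph_chart \<Omega> p \<tau> \<nu> g h" and AB: "open A" "open B" "A \<union> B = \<Omega>" "A \<inter> B = {}"
    and p: "p \<in> closure A"
  shows "graph_chart A p \<tau> \<nu> g h"
proof -
  have ch: "h > 0" "norm \<tau> = 1" "norm \<nu> = 1" "\<tau> \<bullet> \<nu> = 0" "smooth_real g" "p \<bullet> \<nu> = g (p \<bullet> \<tau>)"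
    "\<And>t s. \<bar>t - p \<bullet> \<tau>\<bar> \<le> h \<Longrightarrow> \<bar>s\<bar> \<le> h \<Longrightarrow> (t *\<^sub>R \<tau> + (g t + s) *\<^sub>R \<nu> \<in> \<Omega> \<longleftrightarrow> s > 0)"
    using gc unfolding graph_chart_def by blast+
  define f where "f = (\<lambda>(t, s). t *\<^sub>R \<tau> + (g t + s) *\<^sub>R \<nu>)"
  define E where "E = f ` ({p \<bullet> \<tau> - h..p \<bullet> \<tau> + h} \<times> {0<..h})"
  have "continuous_on UNIV f"
    unfolding f_def case_prod_unfold
    by (intro continuous_intros continuous_on_compose2[OF smooth_real_derivs(3)[OF ch(5), of UNIV]]) auto
  then have "connected E" unfolding E_def
    by (intro connected_continuous_image connected_Times) (auto intro: continuous_on_subset)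
  have E\<Omega>: "E \<subseteq> A \<union> B"
  proof
    fix x assume "x \<in> E"
    then obtain t s where "t \<in> {p \<bullet> \<tau> - h..p \<bullet> \<tau> + h}" "s \<in> {0<..h}" "x = t *\<^sub>R \<tau> + (g t + s) *\<^sub>R \<nu>"
      by (auto simp: E_def f_def)
    then show "x \<in> A \<union> B" using ch(7)[of t s] AB(3) by (simp add: abs_le_iff)
  qed
  obtain r where r: "r > 0"
    "\<And>x. x \<in> ball p r \<Longrightarrow> (x \<in> \<Omega> \<longleftrightarrow> g (x \<bullet> \<tau>) < x \<bullet> \<nu>) \<and> \<bar>x \<bullet> \<tau> - p \<bullet> \<tau>\<bar> < h \<and> \<bar>x \<bullet> \<nu> - g (x \<bullet> \<tau>)\<bar> < h"
    using graph_chart_ball[OF gc] by blast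
  obtain x where x: "x \<in> A" "x \<in> ball p r" using p r(1) unfolding closure_approachable
    by (metis dist_commute mem_ball)
  have "x = f (x \<bullet> \<tau>, x \<bullet> \<nu> - g (x \<bullet> \<tau>))"
    using orthonormal_expansion[OF ch(2-4), of x] by (simp add: f_def)
  moreover have "(x \<bullet> \<tau>, x \<bullet> \<nu> - g (x \<bullet> \<tau>)) \<in> {p \<bullet> \<tau> - h..p \<bullet> \<tau> + h} \<times> {0<..h}"
    using r(2)[OF x(2)] x AB by (auto simp: abs_less_iff)
  ultimately have "x \<in> E" unfolding E_def by blast
  then have "B \<inter> E = {}" using connectedD[OF \<open>connected E\<close> AB(1,2)] E\<Omega> AB(4) x by blast
  then have EA: "E \<subseteq> A" using E\<Omega> by blast
  have "t *\<^sub>R \<tau> + (g t + s) *\<^sub>R \<nu> \<in> A \<longleftrightarrow> s > 0" if ts: "\<bar>t - p \<bullet> \<tau>\<bar> \<le> h" "\<bar>s\<bar> \<le> h" for t s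
  proof
    assume "t *\<^sub>R \<tau> + (g t + s) *\<^sub>R \<nu> \<in> A"
    then show "s > 0" using ch(7)[OF ts] AB by auto
  next
    assume "s > 0"
    then have "f (t, s) \<in> E" unfolding E_def using ts by (intro imageI) (auto simp: abs_le_iff)
    then show "t *\<^sub>R \<tau> + (g t + s) *\<^sub>R \<nu> \<in> A" using EA by (auto simp: f_def)
  qed
  then show ?thesis unfolding graph_chart_def using ch by blast
qed

text \<open>A common boundary point would have one chart in which both pieces are the whole upper side.\<close>
lemma pieces_closure_disjoint:
  assumes sm: "smooth_boundary \<Omega>" and AB: "open A" "open B" "A \<union> B = \<Omega>" "A \<inter> B = {}"
  shows "closure A \<inter> closure B = {}"
proof (rule ccontr)
  assume "closure A \<inter> closure B \<noteq> {}"
  then obtain p where p: "p \<in> closure A" "p \<in> closure B" by blast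
  have "p \<notin> A" "p \<notin> B" using p AB(1,2,4) open_Int_closure_eq_empty by blast+
  moreover have "interior \<Omega> = A \<union> B" using AB interior_open open_Un by metis
  ultimately have "p \<in> frontier \<Omega>" using p AB closure_mono[of A \<Omega>] by (auto simp: frontier_def)
  then obtain \<tau> \<nu> g h where gc: "graph_chart \<Omega> p \<tau> \<nu> g h"
    using frontier_graph_chart[OF sm] AB by blast
  have gA: "graph_chart A p \<tau> \<nu> g h" by (rule graph_chart_piece[OF gc AB p(1)])
  have gB: "graph_chart B p \<tau> \<nu> g h"
    by (rule graph_chart_piece[OF gc AB(2,1) _ _ p(2)]) (use AB in auto)
  have h: "h > 0" using gc by (simp add: graph_chart_def)
  have "(p \<bullet> \<tau>) *\<^sub>R \<tau> + (g (p \<bullet> \<tau>) + h) *\<^sub>R \<nu> \<in> A" using gA h unfolding graph_chart_def by auto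
  moreover have "(p \<bullet> \<tau>) *\<^sub>R \<tau> + (g (p \<bullet> \<tau>) + h) *\<^sub>R \<nu> \<in> B" using gB h unfolding graph_chart_def by auto
  ultimately show False using AB by blast
qed

text \<open>A boundary identity \<open>F t 0 = 0\<close> may be differentiated along the boundary although \<open>F\<close> is differentiable
only off it: the tangential derivatives at height \<open>s\<close> converge. It is used for \<open>u\<close>, for its tangential
derivative, and for the Modica function.\<close>
lemma boundary_derivative_vanishes:
  fixes F Fd :: "real \<Rightarrow> real \<Rightarrow> real"
  assumes h: "h > 0"
    and deriv: "\<And>t s. \<bar>t - t0\<bar> \<le> h \<Longrightarrow> 0 < s \<Longrightarrow> s \<le> h \<Longrightarrow> ((\<lambda>t. F t s) has_real_derivative Fd t s) (at t)"
    and cF: "continuous_on ({t0 - h..t0 + h} \<times> {0..h}) (\<lambda>(t, s). F t s)"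
    and cFd: "continuous_on ({t0 - h..t0 + h} \<times> {0..h}) (\<lambda>(t, s). Fd t s)"
    and zero: "\<And>t. \<bar>t - t0\<bar> \<le> h \<Longrightarrow> F t 0 = 0"
    and t: "\<bar>t - t0\<bar> \<le> h"
  shows "Fd t 0 = 0"
proof (rule ccontr)
  define \<eta> where "\<eta> = \<bar>Fd t 0\<bar>"
  assume "Fd t 0 \<noteq> 0"
  then have \<eta>: "\<eta> > 0" by (simp add: \<eta>_def)
  have tI: "(t, 0) \<in> {t0 - h..t0 + h} \<times> {0..h}" using t h by (auto simp: abs_le_iff)
  obtain d where d: "d > 0" "\<And>y. y \<in> {t0 - h..t0 + h} \<times> {0..h} \<Longrightarrow> dist y (t, 0) < d \<Longrightarrow> dist ((\<lambda>(t, s). Fd t s) y) (Fd t 0) < \<eta> / 2"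
    using cFd[unfolded continuous_on_iff, rule_format, OF tI, of "\<eta> / 2"] \<eta> by auto
  define k where "k = min (d / 3) h"
  have k: "k > 0" "k \<le> h" "3 * k \<le> d" using d h by (auto simp: k_def)
  define t1 where "t1 = (if t \<le> t0 then t + k else t - k)"
  have t1: "\<bar>t1 - t0\<bar> \<le> h" "\<bar>t1 - t\<bar> = k" using k t by (auto simp: t1_def abs_le_iff)
  \<comment> \<open>If the limit derivative were not zero, \<open>F\<close> would vary between \<open>t\<close> and \<open>t1\<close> by a fixed amount at every small height.\<close>
  have big: "\<bar>F t1 s - F t s\<bar> \<ge> \<eta> / 2 * k" if s: "0 < s" "s \<le> k" for s
  proof -
    have bd: "\<bar>Fd z s\<bar> \<ge> \<eta> / 2" if z: "min t t1 \<le> z" "z \<le> max t t1" for z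
    proof -
      have zz: "\<bar>z - t0\<bar> \<le> h" "\<bar>z - t\<bar> \<le> k" using z t t1 by (auto simp: min_def max_def abs_le_iff abs_if split: if_splits)
      have "dist (z, s) (t, 0) \<le> \<bar>z - t\<bar> + \<bar>s\<bar>"
        using sqrt_sum_squares_le_sum_abs[of "z - t" s] by (simp add: dist_Pair_Pair dist_real_def)
      also have "\<dots> < d" using zz s k by linarith
      finally have "\<bar>Fd z s - Fd t 0\<bar> < \<eta> / 2"
        using d(2)[of "(z, s)"] zz s k by (auto simp: dist_real_def abs_le_iff)
      then show ?thesis unfolding \<eta>_def by linarith
    qed
    have der: "((\<lambda>t. F t s) has_real_derivative Fd z s) (at z)" if "min t t1 \<le> z" "z \<le> max t t1" for z
      using that t t1 s k by (intro deriv) (auto simp: min_def max_def abs_le_iff split: if_splits)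
    have "min t t1 < max t t1" using t1 k by auto
    then obtain z where z: "min t t1 < z" "z < max t t1"
      "F (max t t1) s - F (min t t1) s = (max t t1 - min t t1) * Fd z s"
      using MVT2[of "min t t1" "max t t1" "\<lambda>t. F t s" "\<lambda>z. Fd z s"] der by blast
    have "max t t1 - min t t1 = k" using t1 by (auto simp: max_def min_def abs_if split: if_splits)
    then have "\<bar>F (max t t1) s - F (min t t1) s\<bar> = k * \<bar>Fd z s\<bar>"
      using z(3) k by (simp add: abs_mult)
    then have "\<bar>F t1 s - F t s\<bar> = k * \<bar>Fd z s\<bar>"
      by (auto simp: max_def min_def abs_minus_commute split: if_splits)
    also have "\<dots> \<ge> k * (\<eta> / 2)" using bd[of z] z k by (intro mult_left_mono) auto
    finally show ?thesis by (simp add: mult.commute)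
  qed
  have lim: "((\<lambda>s. F y s) \<longlongrightarrow> 0) (at_right 0)" if y: "\<bar>y - t0\<bar> \<le> h" for y
  proof -
    have "continuous_on {0..h} (\<lambda>s. (\<lambda>(t, s). F t s) (y, s))"
      by (rule continuous_on_compose2[OF cF]) (use y in \<open>auto intro!: continuous_intros simp: abs_le_iff\<close>)
    then have "((\<lambda>s. F y s) \<longlongrightarrow> F y 0) (at 0 within {0..h})" using h by (auto simp: continuous_on_def)
    then show ?thesis using zero[OF y] h by (simp add: at_within_Icc_at_right)
  qed
  have "((\<lambda>s. \<bar>F t1 s - F t s\<bar>) \<longlongrightarrow> \<bar>0 - 0\<bar>) (at_right 0)"
    by (intro tendsto_intros lim t t1)
  moreover have "eventually (\<lambda>s. \<bar>F t1 s - F t s\<bar> \<ge> \<eta> / 2 * k) (at_right 0)"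
    using big k by (auto simp: eventually_at_right_field intro!: exI[of _ k])
  ultimately have "\<eta> / 2 * k \<le> \<bar>0 - 0\<bar>" by (rule tendsto_lowerbound) simp
  then show False using \<eta> k by (simp add: mult_le_0_iff)
qed

lemma one_sided_derivative_nonpos:
  fixes f d :: "real \<Rightarrow> real"
  assumes h: "h > 0" and deriv: "\<And>s. 0 < s \<Longrightarrow> s \<le> h \<Longrightarrow> (f has_real_derivative d s) (at s)"
    and cf: "continuous_on {0..h} f" and cd: "continuous_on {0..h} d"
    and f: "f 0 = 0" "\<And>s. 0 < s \<Longrightarrow> s \<le> h \<Longrightarrow> f s \<le> 0"
  shows "d 0 \<le> 0"
proof (rule ccontr)
  assume "\<not> d 0 \<le> 0"
  then have pos: "d 0 > 0" by simp
  have "0 \<in> {0..h}" using h by simp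
  then obtain k where k: "k > 0" "\<And>s. s \<in> {0..h} \<Longrightarrow> dist s 0 < k \<Longrightarrow> dist (d s) (d 0) < d 0"
    using cd[unfolded continuous_on_iff] pos by meson
  define s where "s = min (k / 2) h"
  have s: "s > 0" "s \<le> h" "s < k" using k h by (auto simp: s_def)
  have "f 0 < f s"
  proof (rule DERIV_pos_imp_increasing_open[OF s(1)])
    fix x assume x: "0 < x" "x < s"
    have "d x > 0" using k(2)[of x] x s by (auto simp: dist_real_def)
    then show "\<exists>y. (f has_real_derivative y) (at x) \<and> 0 < y" using deriv[of x] x s by auto
  next
    show "continuous_on {0..s} f" by (rule continuous_on_subset[OF cf]) (use s in auto)
  qed
  then show False using f(1) f(2)[of s] s by simp
qed

section \<open>Solutions of the free boundary problem\<close>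

text \<open>The locale names the gradient \<open>G\<close> and the Hessian \<open>H\<close>, whose existence is part of the notion of a
classical solution.\<close>
locale free_boundary_solution =
  fixes W W' W'' :: "real \<Rightarrow> real" and u :: "real^2 \<Rightarrow> real"
    and G :: "real^2 \<Rightarrow> real^2" and H :: "real^2 \<Rightarrow> real^2^2" and \<Omega> :: "(real^2) set"
  assumes potential: "admissible_potential W W' W''"
    and Omega_eq: "\<Omega> = {x. u x > 0}"
    and open_Omega: "open \<Omega>" and smooth_Omega: "smooth_boundary \<Omega>"
    and cont_u: "continuous_on UNIV u"
    and C2: "C2_closure \<Omega> u G H"
    and pde: "\<And>x. x \<in> \<Omega> \<Longrightarrow> trace (H x) = W' (u x)"
    and u_outside: "\<And>x. x \<notin> \<Omega> \<Longrightarrow> u x = 0"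
    and free_boundary: "\<And>x. x \<in> frontier \<Omega> \<Longrightarrow> norm (G x) = sqrt (2 * W 0)"

begin


lemma u_pos_iff: "x \<in> \<Omega> \<longleftrightarrow> u x > 0"
  by (simp add: Omega_eq)

lemma u_nonneg: "u x \<ge> 0"
  using u_outside[of x] u_pos_iff[of x] by (cases "x \<in> \<Omega>") auto

lemma W_within: "t \<ge> 0 \<Longrightarrow> (W has_real_derivative W' t) (at t within {0..})"
  and W'_within: "t \<ge> 0 \<Longrightarrow> (W' has_real_derivative W'' t) (at t within {0..})"
  and W''_cont: "continuous_on {0..} W''"
  using potential by (auto simp: admissible_potential_def C2_half_line_def)

lemma W_deriv: "t > 0 \<Longrightarrow> (W has_real_derivative W' t) (at t)"
  and W'_deriv: "t > 0 \<Longrightarrow> (W' has_real_derivative W'' t) (at t)"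
proof -
  have "at t within {0..} = at t" if "t > 0" for t :: real
    using that by (intro at_within_open_subset[of t "{0<..}"]) auto
  then show "t > 0 \<Longrightarrow> (W has_real_derivative W' t) (at t)"
    "t > 0 \<Longrightarrow> (W' has_real_derivative W'' t) (at t)"
    using W_within[of t] W'_within[of t] by simp_all
qed

lemma W_cont: "continuous_on {0..} W" and W'_cont: "continuous_on {0..} W'"
  using W_within W'_within by (auto intro!: DERIV_continuous_on)

lemma W_nonneg: "t \<ge> 0 \<Longrightarrow> W t \<ge> 0" and W_one: "W 1 = 0"
  and W_pos: "0 \<le> t \<Longrightarrow> t < 1 \<Longrightarrow> W t > 0"
  and W'_nonpos: "0 \<le> t \<Longrightarrow> t \<le> 1 \<Longrightarrow> W' t \<le> 0"
  using potential by (auto simp: admissible_potential_def)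

lemma twice_diff_u: "twice_diff u G (\<lambda>x h. H x *v h) \<Omega>"
  using C2 open_Omega by (simp add: twice_diff_def C2_closure_def)

lemma tr_H: "x \<in> \<Omega> \<Longrightarrow> tr (\<lambda>h. H x *v h) = W' (u x)"
  using pde by (simp add: tr_matrix)

lemma cont_G: "continuous_on (closure \<Omega>) G" and cont_H: "continuous_on (closure \<Omega>) H"
  using C2 by (auto simp: C2_closure_def)

lemma frontier_Omega: "x \<in> frontier \<Omega> \<longleftrightarrow> x \<in> closure \<Omega> \<and> x \<notin> \<Omega>"
  using open_Omega by (simp add: frontier_def interior_open)

lemma twice_diff_compose_u:
  assumes "\<And>t. t > 0 \<Longrightarrow> (\<phi> has_real_derivative \<phi>1 t) (at t)"
    and "\<And>t. t > 0 \<Longrightarrow> (\<phi>1 has_real_derivative \<phi>2 t) (at t)"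
  shows "twice_diff (\<lambda>x. \<phi> (u x)) (\<lambda>x. \<phi>1 (u x) *\<^sub>R G x)
     (\<lambda>x h. (\<phi>2 (u x) * (h \<bullet> G x)) *\<^sub>R G x + \<phi>1 (u x) *\<^sub>R (H x *v h)) \<Omega>"
  using assms u_pos_iff by (intro twice_diff_compose[OF twice_diff_u]) auto

section \<open>The bound by one\<close>

text \<open>The Keller--Osserman estimate on a ball of radius \<open>R\<close>. At a maximum of \<open>(u - 1) s\<^sup>q\<close>, where
\<open>s = R\<^sup>2 - |x - a|\<^sup>2\<close>, the function \<open>u\<close> is touched from above by \<open>1 + C1 s\<^sup>-\<^sup>q\<close>. Comparing Laplacians bounds
\<open>R\<^sup>2 (u a - 1)\<^bsup>p - 1\<^esup>\<close> independently of \<open>R\<close>.\<close>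
lemma u_le_1: "u a \<le> 1"
proof (rule ccontr)
  assume "\<not> u a \<le> 1"
  then have ua: "u a - 1 > 0" by simp
  obtain p c where pc: "p > 1" "c > 0" "\<And>t. t > 1 \<Longrightarrow> W' t \<ge> c * (t - 1) powr p"
    using potential by (auto simp: admissible_potential_def)
  \<comment> \<open>This exponent makes \<open>\<Delta> s\<^sup>-\<^sup>q\<close> and \<open>(s\<^sup>-\<^sup>q)\<^sup>p\<close> of the same order \<open>s\<^bsup>- q - 2\<^esup>\<close>.\<close>
  define q where "q = 2 / (p - 1)"
  have q: "q > 0" "q * p = q + 2" "q * (p - 1) = 2" using pc by (auto simp: q_def field_simps)
  define K where "K = 4 * q * (q + 2)"
  define X where "X = K / (c * (u a - 1) powr (p - 1))"
  define R where "R = X + 1"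
  have K: "K > 0" using q by (simp add: K_def)
  have X: "X > 0" using K pc ua by (simp add: X_def)
  have R: "R > 1" using X by (simp add: R_def)
  have RX: "R\<^sup>2 > X" using X by (simp add: R_def power2_eq_square algebra_simps add_pos_pos)
  define s where "s = (\<lambda>x. R\<^sup>2 - (x - a) \<bullet> (x - a))"
  have s0: "s x \<ge> 0" if "x \<in> cball a R" for x
  proof -
    have "norm (x - a) \<le> R" using that by (simp add: dist_norm norm_minus_commute)
    then have "(norm (x - a))\<^sup>2 \<le> R\<^sup>2" by (intro power_mono) auto
    then show ?thesis by (simp add: s_def power2_norm_eq_inner)
  qed
  have cs: "continuous_on A s" for A unfolding s_def by (intro continuous_intros)
  have cu: "continuous_on A u" for A using cont_u continuous_on_subset by blast
  have "continuous_on (cball a R) (\<lambda>x. (u x - 1) * s x powr q)"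
    using q s0 by (intro continuous_intros cs cu continuous_on_powr') auto
  then obtain x0 where x0: "x0 \<in> cball a R" "\<And>x. x \<in> cball a R \<Longrightarrow> (u x - 1) * s x powr q \<le> (u x0 - 1) * s x0 powr q"
    using continuous_attains_sup[of "cball a R" "\<lambda>x. (u x - 1) * s x powr q"] R by auto
  define C1 where "C1 = (u x0 - 1) * s x0 powr q"
  have C1: "C1 \<ge> (u a - 1) * (R\<^sup>2) powr q" using x0(2)[of a] R by (simp add: C1_def s_def)
  have "(u a - 1) * (R\<^sup>2) powr q > 0" using ua R by simp
  then have C1pos: "C1 > 0" using C1 by linarith
  have sx0: "s x0 > 0" using s0[OF x0(1)] C1pos by (cases "s x0 = 0") (auto simp: C1_def)
  have ux0: "u x0 > 1" using C1pos sx0 by (auto simp: C1_def zero_less_mult_iff)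
  define \<phi> where "\<phi> = (\<lambda>r. (R\<^sup>2 - r) powr (- q))"
  define \<phi>1 where "\<phi>1 = (\<lambda>r. q * (R\<^sup>2 - r) powr (- q - 1))"
  define \<phi>2 where "\<phi>2 = (\<lambda>r. q * (q + 1) * (R\<^sup>2 - r) powr (- q - 2))"
  have d\<phi>: "(\<phi> has_real_derivative \<phi>1 r) (at r)" "(\<phi>1 has_real_derivative \<phi>2 r) (at r)" if "r < R\<^sup>2" for r
  proof -
    have p: "((\<lambda>r. (R\<^sup>2 - r) powr e) has_real_derivative - (e * (R\<^sup>2 - r) powr (e - 1))) (at r)" for e
    proof -
      have 1: "((\<lambda>r. R\<^sup>2 - r) has_real_derivative - 1) (at r)" by (auto intro!: derivative_eq_intros)
      have 2: "((\<lambda>z. z powr e) has_real_derivative e * (R\<^sup>2 - r) powr (e - 1)) (at (R\<^sup>2 - r))"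
        using that by (intro has_real_derivative_powr) simp
      show ?thesis using DERIV_chain2[OF 2 1] by simp
    qed
    show "(\<phi> has_real_derivative \<phi>1 r) (at r)"
      using p[of "- q"] by (simp add: \<phi>_def \<phi>1_def)
    show "(\<phi>1 has_real_derivative \<phi>2 r) (at r)"
      using DERIV_cmult[OF p[of "- q - 1"], of q]
      by (simp add: \<phi>1_def \<phi>2_def algebra_simps)
  qed
  define N where "N = \<Omega> \<inter> {x. s x > 0}"
  have opN: "open N" unfolding N_def
    by (intro open_Int open_Omega open_Collect_less cs continuous_intros)
  have x0N: "x0 \<in> N" using ux0 sx0 by (auto simp: N_def u_pos_iff)
  have td\<phi>: "twice_diff (\<lambda>x. \<phi> ((x - a) \<bullet> (x - a))) (\<lambda>x. \<phi>1 ((x - a) \<bullet> (x - a)) *\<^sub>R (2 *\<^sub>R (x - a)))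
     (\<lambda>x h. (\<phi>2 ((x - a) \<bullet> (x - a)) * (h \<bullet> (2 *\<^sub>R (x - a)))) *\<^sub>R (2 *\<^sub>R (x - a)) + \<phi>1 ((x - a) \<bullet> (x - a)) *\<^sub>R (2 *\<^sub>R h)) N"
    by (rule twice_diff_compose[OF twice_diff_dist_sq[OF opN]]) (auto simp: N_def s_def intro: d\<phi>)
  note tdF = twice_diff_diff[OF twice_diff_subset[OF twice_diff_u opN] twice_diff_cmult[OF td\<phi>, of C1]]
  have NO: "N \<subseteq> \<Omega>" by (auto simp: N_def)
  have \<phi>s: "\<phi> ((x - a) \<bullet> (x - a)) = s x powr (- q)" for x by (simp add: \<phi>_def s_def)
  have max: "u x - C1 * \<phi> ((x - a) \<bullet> (x - a)) \<le> u x0 - C1 * \<phi> ((x0 - a) \<bullet> (x0 - a))" if x: "x \<in> N" for x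
  proof -
    have sx: "s x > 0" using x by (simp add: N_def)
    have "(norm (x - a))\<^sup>2 \<le> R\<^sup>2" using sx by (simp add: s_def power2_norm_eq_inner)
    then have "x \<in> cball a R" using R by (simp add: power2_le_iff_abs_le dist_norm norm_minus_commute)
    then have "(u x - 1) * s x powr q \<le> C1" using x0(2) by (simp add: C1_def)
    then have "(u x - 1) \<le> C1 * s x powr (- q)" using sx by (simp add: powr_minus field_simps)
    moreover have "C1 * s x0 powr (- q) = u x0 - 1" using sx0 by (simp add: C1_def powr_minus)
    ultimately show ?thesis by (simp add: \<phi>s)
  qed
  define r where "r = (x0 - a) \<bullet> (x0 - a)"
  have r: "0 \<le> r" "s x0 = R\<^sup>2 - r" "r < R\<^sup>2" using sx0 by (auto simp: r_def s_def)
  have "W' (u x0) - C1 * (\<phi>2 r * (4 * r) + \<phi>1 r * 4) \<le> 0"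
  proof -
    have "tr (\<lambda>h. H x0 *v h - C1 *\<^sub>R ((\<phi>2 r * (h \<bullet> (2 *\<^sub>R (x0 - a)))) *\<^sub>R (2 *\<^sub>R (x0 - a)) + \<phi>1 r *\<^sub>R (2 *\<^sub>R h))) \<le> 0"
      using local_max_test(2)[OF tdF[OF NO] x0N max] unfolding r_def .
    then show ?thesis
      using tr_H[of x0] x0N NO
      by (simp only: tr_diff tr_scaleR tr_add tr_outer_mult tr_id subset_iff) (simp add: r_def mult.commute)
  qed
  moreover have "\<phi>2 r * (4 * r) + \<phi>1 r * 4 \<le> K * R\<^sup>2 * s x0 powr (- q - 2)"
  proof -
    have "s x0 powr (- q - 1) = s x0 powr (- q - 2) * s x0"
      using sx0 powr_mult_base[of "s x0" "- q - 2"] by (simp add: mult.commute minus_diff_commute)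
    then have "\<phi>2 r * (4 * r) + \<phi>1 r * 4 = (4 * q * s x0 powr (- q - 2)) * ((q + 1) * r + s x0)"
      by (simp add: \<phi>1_def \<phi>2_def flip: r(2)) (simp add: algebra_simps)
    also have "\<dots> \<le> (4 * q * s x0 powr (- q - 2)) * ((q + 1) * R\<^sup>2 + R\<^sup>2)"
      using q r by (intro mult_left_mono add_mono) auto
    finally show ?thesis by (simp add: K_def algebra_simps)
  qed
  ultimately have "W' (u x0) \<le> C1 * (K * R\<^sup>2 * s x0 powr (- q - 2))"
    using C1pos by (smt (verit) mult_left_mono)
  moreover have "W' (u x0) \<ge> c * (C1 powr p * s x0 powr (- q - 2))"
  proof -
    have "u x0 - 1 = C1 * s x0 powr (- q)" using sx0 by (simp add: C1_def powr_minus)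
    then have "(u x0 - 1) powr p = C1 powr p * s x0 powr (- q * p)"
      using C1pos by (simp add: powr_mult powr_powr)
    moreover have "- q * p = - q - 2" using q by simp
    ultimately show ?thesis using pc(3)[OF ux0] by simp
  qed
  ultimately have "(c * C1 powr p) * s x0 powr (- q - 2) \<le> (C1 * K * R\<^sup>2) * s x0 powr (- q - 2)"
    by (simp add: algebra_simps)
  then have "c * C1 powr p \<le> C1 * K * R\<^sup>2" using sx0 by simp
  moreover have "C1 powr p = C1 * C1 powr (p - 1)" using C1pos powr_mult_base[of C1 "p - 1"] by simp
  ultimately have "C1 * (c * C1 powr (p - 1)) \<le> C1 * (K * R\<^sup>2)" by (simp add: algebra_simps)
  then have 1: "c * C1 powr (p - 1) \<le> K * R\<^sup>2" using C1pos by simp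
  have "((u a - 1) * (R\<^sup>2) powr q) powr (p - 1) \<le> C1 powr (p - 1)"
    using C1 ua pc R by (intro powr_mono2) auto
  moreover have "((u a - 1) * (R\<^sup>2) powr q) powr (p - 1) = (u a - 1) powr (p - 1) * (R\<^sup>2) powr 2"
    using ua R q by (simp add: powr_mult powr_powr)
  moreover have "(R\<^sup>2) powr 2 = R\<^sup>2 * R\<^sup>2" using R by (simp add: powr_numeral power2_eq_square)
  ultimately have "c * ((u a - 1) powr (p - 1) * (R\<^sup>2 * R\<^sup>2)) \<le> K * R\<^sup>2"
    using 1 pc by (smt (verit) mult_left_mono)
  then have "(c * (u a - 1) powr (p - 1) * R\<^sup>2) * R\<^sup>2 \<le> K * R\<^sup>2" by (simp add: algebra_simps)
  then have "c * (u a - 1) powr (p - 1) * R\<^sup>2 \<le> K" using R by simp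
  then have "R\<^sup>2 \<le> X" using pc ua by (simp add: X_def field_simps)
  with RX show False by simp
qed

end


section \<open>The Modica inequality\<close>

text \<open>The calculation behind \<open>modica\<close>: there \<open>\<sigma> = |\<nabla>u|\<close>, \<open>e\<^sup>2\<close> is the weight at the touching point and \<open>C\<close> the touching
constant. The first two terms on the right of the last premise are at most half of the left side
as soon as \<open>\<sigma> \<ge> 32 e\<close>; the third one then bounds \<open>(\<sigma> / e)\<^sup>3\<close>.\<close>
lemma bernstein_numeric:
  fixes e \<sigma> C L R :: real
  assumes "e > 0" "\<sigma> > 0" "L \<ge> 0" "R > 0" "C \<ge> 1024" "C * e\<^sup>2 \<le> \<sigma>\<^sup>2" "1 \<le> e\<^sup>2 * R\<^sup>2"
    and main: "e\<^sup>2 * \<sigma>^4 \<le> 64 * \<sigma>\<^sup>2 * e^4 + 8 * \<sigma>^3 * e^3 + 16 * L * \<sigma> * e^3"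
  shows "C^3 \<le> (32 * L)\<^sup>2 * R^4"
proof -
  define d where "d = \<sigma> / e"
  have \<sigma>: "\<sigma> = d * e" and d0: "d > 0" using assms by (auto simp: d_def)
  have "C * e\<^sup>2 \<le> d\<^sup>2 * e\<^sup>2" using assms(6) by (simp add: \<sigma> power_mult_distrib)
  then have Cd: "C \<le> d\<^sup>2" using assms(1) by simp
  then have "32\<^sup>2 \<le> d\<^sup>2" using assms(5) by simp
  then have d: "32 \<le> d" using power2_le_imp_le[of 32 d] d0 by simp
  have "(d * e^4) * (d^3 * e\<^sup>2) \<le> (d * e^4) * ((64 * d + 8 * d\<^sup>2) * e\<^sup>2 + 16 * L)"
    using main unfolding \<sigma> by (simp add: power_mult_distrib power2_eq_square power3_eq_cube power4_eq_xxxx algebra_simps)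
  then have m: "d^3 * e\<^sup>2 \<le> (64 * d + 8 * d\<^sup>2) * e\<^sup>2 + 16 * L" using assms(1) d0 by simp
  have "64 * d + 8 * d\<^sup>2 \<le> d^3 / 2"
  proof -
    have "32 * 32 \<le> d * d" using d by (intro mult_mono) auto
    then have "(32 * 32) * d \<le> (d * d) * d" using d0 by simp
    then have 1: "1024 * d \<le> d^3" by (simp add: power3_eq_cube)
    have "32 * d\<^sup>2 \<le> d * d\<^sup>2" using d by (intro mult_right_mono) auto
    then have "32 * d\<^sup>2 \<le> d^3" by (simp add: power2_eq_square power3_eq_cube)
    with 1 d0 show ?thesis by linarith
  qed
  then have "(64 * d + 8 * d\<^sup>2) * e\<^sup>2 \<le> d^3 / 2 * e\<^sup>2" by (intro mult_right_mono) auto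
  with m have "d^3 * e\<^sup>2 \<le> 32 * L" by simp
  then have "d^3 * e\<^sup>2 * R\<^sup>2 \<le> 32 * L * R\<^sup>2" by (intro mult_right_mono) auto
  moreover have "d^3 * 1 \<le> d^3 * (e\<^sup>2 * R\<^sup>2)" using assms(7) d0 by (intro mult_left_mono) auto
  ultimately have "d^3 \<le> 32 * L * R\<^sup>2" by (simp add: algebra_simps)
  then have "(d^3)\<^sup>2 \<le> (32 * L * R\<^sup>2)\<^sup>2" using d0 by (intro power_mono) auto
  moreover have "C^3 \<le> (d\<^sup>2)^3" using Cd assms(5) by (intro power_mono) auto
  ultimately show ?thesis by (simp add: power_mult_distrib flip: power_mult)
qed

context free_boundary_solution
begin


text \<open>Suppose \<open>P a > 0\<close>. On the ball of radius \<open>R\<close> around \<open>a\<close>, touch \<open>P\<close> from above by \<open>\<theta> = C \<eta> k(u)\<close> with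
\<open>\<eta> = R\<^sup>2 / s\<^sup>2\<close>, \<open>s = R\<^sup>2 - |x - a|\<^sup>2\<close> and \<open>k(t) = 2 - t\<^sup>2 / 2\<close>. As \<open>P = 0\<close> on \<open>\<partial>\<Omega>\<close> and \<open>\<eta>\<close> blows up on the circle, the
touching point is interior. There \<open>gradient_touching\<close> and \<open>symmetric_matrix_identity\<close> give
\<open>|\<nabla>u|\<^sup>2 \<Delta>\<theta> \<ge> 2 W'(u) \<nabla>u \<bullet> \<nabla>\<theta>\<close>.

The weight \<open>\<eta>\<close> satisfies \<open>|\<nabla>\<eta>| \<le> 4 \<eta>\<^bsup>3/2\<^esup>\<close> and \<open>\<Delta>\<eta> \<le> 32 \<eta>\<^sup>2\<close> uniformly in \<open>R\<close>. The concavity of \<open>k\<close> contributes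
the good term \<open>- \<eta> |\<nabla>u|\<^sup>4\<close>, and the terms with \<open>k'(u) W'(u) \<ge> 0\<close> have a favourable sign. It follows that \<open>C\<close> is
at most of order \<open>R\<^bsup>4/3\<^esup>\<close> for large \<open>R\<close>, whereas \<open>P a > 0\<close> requires \<open>C\<close> to be at least of order \<open>R\<^sup>2\<close>.\<close>
lemma modica: 
  assumes a: "a \<in> \<Omega>"
  shows "(norm (G a))\<^sup>2 \<le> 2 * W (u a)"
proof (rule ccontr)
  define P where "P = (\<lambda>x. (norm (G x))\<^sup>2 - 2 * W (u x))"
  define \<delta> where "\<delta> = P a"
  assume "\<not> ?thesis"
  then have \<delta>: "\<delta> > 0" by (simp add: \<delta>_def P_def)
  obtain L where L: "L \<ge> 0" "\<And>t. 0 \<le> t \<Longrightarrow> t \<le> 1 \<Longrightarrow> \<bar>W' t\<bar> \<le> L"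
  proof -
    have "compact (W' ` {0..1})" by (intro compact_continuous_image continuous_on_subset[OF W'_cont]) auto
    then obtain B where "B > 0" "\<And>y. y \<in> W' ` {0..1} \<Longrightarrow> norm y \<le> B"
      using compact_imp_bounded bounded_pos by metis
    then show ?thesis using that[of B] by auto
  qed
  \<comment> \<open>The radius is so large that \<open>C \<ge> \<delta> R\<^sup>2 / 2\<close> contradicts the bound of \<open>bernstein_numeric\<close>.\<close>
  define Y where "Y = 2048 / \<delta> + (32 * L)\<^sup>2 * 8 / \<delta>^3"
  define R where "R = Y + 1"
  have Y: "Y > 0" using \<delta> L by (auto simp: Y_def intro!: add_pos_nonneg)
  have R: "R > 1" using Y by (simp add: R_def)
  have RY: "R\<^sup>2 > Y" using Y by (simp add: R_def power2_eq_square algebra_simps add_pos_pos)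
  have R1: "\<delta> * R\<^sup>2 / 2 \<ge> 1024"
  proof -
    have "2048 / \<delta> \<le> R\<^sup>2" using RY \<delta> unfolding Y_def
      by (smt (verit) divide_nonneg_pos zero_le_power2 zero_less_power mult_nonneg_nonneg)
    then show ?thesis using \<delta> by (simp add: field_simps)
  qed
  have R2: "(\<delta> * R\<^sup>2 / 2)^3 > (32 * L)\<^sup>2 * R^4"
  proof -
    have "(32 * L)\<^sup>2 * 8 / \<delta>^3 < R\<^sup>2" using RY \<delta> unfolding Y_def by (smt (verit) divide_pos_pos)
    then have "(32 * L)\<^sup>2 < \<delta>^3 * R\<^sup>2 / 8" using \<delta> by (simp add: field_simps)
    then have "(32 * L)\<^sup>2 * R^4 < \<delta>^3 * R\<^sup>2 / 8 * R^4" using R by simp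
    also have "\<dots> = (\<delta> * R\<^sup>2 / 2)^3" by (simp add: power_mult_distrib power_divide flip: power_mult power_add)
    finally show ?thesis .
  qed
  define s where "s = (\<lambda>x. R\<^sup>2 - (x - a) \<bullet> (x - a))"
  define k where "k = (\<lambda>t::real. 2 - t\<^sup>2 / 2)"
  have k: "1 \<le> k (u x)" "k (u x) \<le> 2" for x
    using u_nonneg[of x] u_le_1[of x] power_le_one[of "u x" 2] by (auto simp: k_def)
  have cs: "continuous_on A s" for A unfolding s_def by (intro continuous_intros)
  have cu: "continuous_on A u" for A using cont_u continuous_on_subset by blast
  define S where "S = closure \<Omega> \<inter> cball a R"
  have compS: "compact S" unfolding S_def by (simp add: closed_Int_compact)
  have aS: "a \<in> S" using a R closure_subset by (auto simp: S_def)
  have cP: "continuous_on (closure \<Omega>) P"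
    unfolding P_def using u_nonneg
    by (intro continuous_intros cont_G continuous_on_compose2[OF W_cont cu]) auto
  \<comment> \<open>The quotient of \<open>P\<close> and the weight \<open>\<eta> k(u)\<close>; its maximum is the touching constant.\<close>
  define F where "F = (\<lambda>x. P x * (s x)\<^sup>2 / (R\<^sup>2 * k (u x)))"
  have "continuous_on S F"
  proof -
    have "R\<^sup>2 * k (u x) \<noteq> 0" for x using k(1)[of x] R by auto
    moreover have "continuous_on S (\<lambda>x. k (u x))" unfolding k_def by (intro continuous_intros cu) auto
    moreover have "continuous_on S P" using cP by (rule continuous_on_subset) (auto simp: S_def)
    ultimately show ?thesis unfolding F_def by (intro continuous_intros cs) auto
  qed
  then obtain x0 where x0: "x0 \<in> S" "\<And>x. x \<in> S \<Longrightarrow> F x \<le> F x0"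
    using continuous_attains_sup[OF compS] aS by blast
  define C where "C = F x0"
  have Fa: "F a \<ge> \<delta> * R\<^sup>2 / 2"
  proof -
    have "F a = \<delta> * R\<^sup>2 / k (u a)" using R by (simp add: F_def \<delta>_def s_def power2_eq_square)
    also have "\<dots> \<ge> \<delta> * R\<^sup>2 / 2" using k[of a] \<delta> by (intro divide_left_mono) auto
    finally show ?thesis .
  qed
  then have C: "C \<ge> \<delta> * R\<^sup>2 / 2" using x0(2)[OF aS] by (simp add: C_def)
  then have C1024: "C \<ge> 1024" using R1 by linarith
  have k0: "R\<^sup>2 * k (u x) > 0" for x using k(1)[of x] R by (intro mult_pos_pos) auto
  have "P x0 * (s x0)\<^sup>2 > 0" using C1024 k0[of x0] unfolding C_def F_def
    by (smt (verit) divide_nonpos_pos)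
  then have Px0: "P x0 > 0" and sne: "s x0 \<noteq> 0" by (auto simp: zero_less_mult_iff)
  have sball: "s x > 0 \<longleftrightarrow> x \<in> ball a R" for x
    using R abs_square_le_1 by (auto simp: s_def dist_norm norm_minus_commute power2_norm_eq_inner[symmetric] abs_le_square_iff[symmetric] power_strict_mono dest: power_less_imp_less_base)
  have "s x0 \<ge> 0"
  proof -
    have "norm (x0 - a) \<le> R" using x0(1) by (simp add: S_def dist_norm norm_minus_commute)
    then have "(norm (x0 - a))\<^sup>2 \<le> R\<^sup>2" by (intro power_mono) auto
    then show ?thesis by (simp add: s_def power2_norm_eq_inner)
  qed
  with sne have sx0: "s x0 > 0" by simp
  have x0O: "x0 \<in> \<Omega>"
  proof (rule ccontr)
    assume "x0 \<notin> \<Omega>"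
    then have "norm (G x0) = sqrt (2 * W 0)" "u x0 = 0"
      using x0(1) free_boundary[of x0] u_outside by (auto simp: frontier_Omega S_def)
    then have "P x0 = 0" using W_nonneg[of 0] by (simp add: P_def)
    with Px0 show False by simp
  qed
  define N where "N = \<Omega> \<inter> ball a R"
  have opN: "open N" and NO: "N \<subseteq> \<Omega>" and x0N: "x0 \<in> N"
    using open_Omega x0O sx0 sball by (auto simp: N_def)
  define \<phi> where "\<phi> = (\<lambda>r. R\<^sup>2 * inverse ((R\<^sup>2 - r)^2))"
  define \<phi>1 where "\<phi>1 = (\<lambda>r. 2 * R\<^sup>2 * inverse ((R\<^sup>2 - r)^3))"
  define \<phi>2 where "\<phi>2 = (\<lambda>r. 6 * R\<^sup>2 * inverse ((R\<^sup>2 - r)^4))"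
  have d\<phi>: "(\<phi> has_real_derivative \<phi>1 r) (at r)" "(\<phi>1 has_real_derivative \<phi>2 r) (at r)" if "r < R\<^sup>2" for r
  proof -
    have ne: "R\<^sup>2 - r \<noteq> 0" using that by simp
    show "(\<phi> has_real_derivative \<phi>1 r) (at r)" "(\<phi>1 has_real_derivative \<phi>2 r) (at r)"
      unfolding \<phi>_def \<phi>1_def \<phi>2_def using ne
      by (auto intro!: derivative_eq_intros simp: power2_eq_square power3_eq_cube power4_eq_xxxx)
  qed
  define q where "q = (\<lambda>x. (x - a) \<bullet> (x - a))"
  have sq: "s x = R\<^sup>2 - q x" for x by (simp add: s_def q_def)
  have td\<phi>: "twice_diff (\<lambda>x. \<phi> (q x)) (\<lambda>x. \<phi>1 (q x) *\<^sub>R (2 *\<^sub>R (x - a)))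
     (\<lambda>x h. (\<phi>2 (q x) * (h \<bullet> (2 *\<^sub>R (x - a)))) *\<^sub>R (2 *\<^sub>R (x - a)) + \<phi>1 (q x) *\<^sub>R (2 *\<^sub>R h)) N"
    unfolding q_def
    by (rule twice_diff_compose[OF twice_diff_dist_sq[OF opN]]) (use sball in \<open>auto simp: N_def s_def intro: d\<phi>\<close>)
  have tdk: "twice_diff (\<lambda>x. k (u x)) (\<lambda>x. (- u x) *\<^sub>R G x)
     (\<lambda>x h. (- 1 * (h \<bullet> G x)) *\<^sub>R G x + (- u x) *\<^sub>R (H x *v h)) N"
    unfolding k_def
    by (rule twice_diff_subset[OF twice_diff_compose_u opN NO]) (auto intro!: derivative_eq_intros)
  have tdW: "twice_diff (\<lambda>x. W (u x)) (\<lambda>x. W' (u x) *\<^sub>R G x)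
     (\<lambda>x h. (W'' (u x) * (h \<bullet> G x)) *\<^sub>R G x + W' (u x) *\<^sub>R (H x *v h)) N"
    by (rule twice_diff_subset[OF twice_diff_compose_u opN NO]) (auto intro: W_deriv W'_deriv)
  \<comment> \<open>Gradient and Laplacian of the weight \<open>\<phi> (q x) * k (u x)\<close>.\<close>
  define \<theta>' where "\<theta>' = (\<lambda>x. \<phi> (q x) *\<^sub>R ((- u x) *\<^sub>R G x) + k (u x) *\<^sub>R (\<phi>1 (q x) *\<^sub>R (2 *\<^sub>R (x - a))))"
  define \<Lambda> where "\<Lambda> = (\<lambda>x. 2 * (2 * \<phi>1 (q x) * (- u x) * (G x \<bullet> (x - a)))
      + \<phi> (q x) * (- (G x \<bullet> G x) + (- u x) * W' (u x)) + k (u x) * (4 * \<phi>2 (q x) * q x + 4 * \<phi>1 (q x)))"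
  define M where "M = (\<lambda>x h. 2 *\<^sub>R ((W'' (u x) * (h \<bullet> G x)) *\<^sub>R G x + W' (u x) *\<^sub>R (H x *v h)) + C *\<^sub>R
     ((h \<bullet> (\<phi>1 (q x) *\<^sub>R (2 *\<^sub>R (x - a)))) *\<^sub>R ((- u x) *\<^sub>R G x) + \<phi> (q x) *\<^sub>R ((- 1 * (h \<bullet> G x)) *\<^sub>R G x + (- u x) *\<^sub>R (H x *v h)) +
      ((h \<bullet> ((- u x) *\<^sub>R G x)) *\<^sub>R (\<phi>1 (q x) *\<^sub>R (2 *\<^sub>R (x - a))) +
      k (u x) *\<^sub>R ((\<phi>2 (q x) * (h \<bullet> (2 *\<^sub>R (x - a)))) *\<^sub>R (2 *\<^sub>R (x - a)) + \<phi>1 (q x) *\<^sub>R (2 *\<^sub>R h)))))"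
  have tdT: "twice_diff (\<lambda>x. 2 * W (u x) + C * (\<phi> (q x) * k (u x)))
     (\<lambda>x. 2 *\<^sub>R (W' (u x) *\<^sub>R G x) + C *\<^sub>R \<theta>' x) M N"
    unfolding M_def \<theta>'_def
    by (rule twice_diff_add[OF twice_diff_cmult[OF tdW] twice_diff_cmult[OF twice_diff_mult[OF td\<phi> tdk]]])
  have trM: "tr (M x) = 2 * (W'' (u x) * (G x \<bullet> G x)) + 2 * (W' (u x))\<^sup>2 + C * \<Lambda> x" if "x \<in> N" for x
  proof -
    have "tr (\<lambda>h. H x *v h) = W' (u x)" using tr_H that NO by auto
    then show ?thesis unfolding M_def
      by (simp only: tr_add tr_scaleR tr_outer_mult tr_outer tr_id)
         (simp add: \<Lambda>_def q_def power2_eq_square inner_commute[of x "G x"] inner_commute[of a "G x"] algebra_simps inner_diff_right)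
  qed
  have cont_GN: "continuous_on N G" using cont_G by (rule continuous_on_subset) (use NO closure_subset in auto)
  have cW': "continuous_on N (\<lambda>x. W' (u x))" and cW'': "continuous_on A (\<lambda>x. W'' (u x))" for A
    by (rule continuous_on_compose2[OF W'_cont cu] continuous_on_compose2[OF W''_cont cu]; use u_nonneg in auto)+
  have sN: "R\<^sup>2 - (x - a) \<bullet> (x - a) \<noteq> 0" if "x \<in> N" for x
  proof -
    have "s x > 0" using that sball[of x] by (simp add: N_def)
    then show ?thesis by (simp add: s_def)
  qed
  have cM: "continuous_on N (\<lambda>x. tr (M x))"
  proof -
    have cq: "continuous_on N q" unfolding q_def by (intro continuous_intros)
    have c\<phi>: "continuous_on N (\<lambda>x. \<phi> (q x))" "continuous_on N (\<lambda>x. \<phi>1 (q x))" "continuous_on N (\<lambda>x. \<phi>2 (q x))"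
      unfolding \<phi>_def \<phi>1_def \<phi>2_def by (intro continuous_intros cq; use sN in \<open>simp add: q_def\<close>)+
    have ck: "continuous_on N (\<lambda>x. k (u x))" unfolding k_def by (intro continuous_intros cu) auto
    have "continuous_on N \<Lambda>" unfolding \<Lambda>_def
      by (intro continuous_on_add continuous_on_mult continuous_on_minus continuous_on_const continuous_on_inner
          continuous_on_diff continuous_on_id c\<phi> ck cq cW' cont_GN cu)
    then have "continuous_on N (\<lambda>x. 2 * (W'' (u x) * (G x \<bullet> G x)) + 2 * (W' (u x))\<^sup>2 + C * \<Lambda> x)"
      by (intro continuous_on_add continuous_on_mult continuous_on_power continuous_on_const continuous_on_inner cW' cW''[of N] cont_GN)
    then show ?thesis by (rule continuous_on_eq) (simp add: trM)
  qed
  have Ck: "C * (\<phi> (q x0) * k (u x0)) = P x0"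
    using sx0 k(1)[of x0] R by (simp add: C_def F_def \<phi>_def sq field_simps)
  have max: "(norm (G x))\<^sup>2 - (2 * W (u x) + C * (\<phi> (q x) * k (u x))) \<le> (norm (G x0))\<^sup>2 - (2 * W (u x0) + C * (\<phi> (q x0) * k (u x0)))"
    if x: "x \<in> N" for x
  proof -
    have "x \<in> S" using x NO closure_subset by (auto simp: N_def S_def)
    then have "P x * (s x)\<^sup>2 / (R\<^sup>2 * k (u x)) \<le> C" using x0(2)[of x] by (simp add: C_def F_def)
    then have "P x * (s x)\<^sup>2 \<le> C * (R\<^sup>2 * k (u x))" using k0[of x] by (simp add: divide_le_eq)
    moreover have "s x > 0" using x sball by (simp add: N_def)
    ultimately have "P x \<le> C * (\<phi> (q x) * k (u x))" by (simp add: \<phi>_def sq field_simps)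
    then show ?thesis using Ck by (simp add: P_def)
  qed
  have df: "GDERIV (\<lambda>x. W' (u x)) x :> W'' (u x) *\<^sub>R G x" if "x \<in> \<Omega>" for x
    using twice_diff_u that u_pos_iff by (intro GDERIV_DERIV_compose W'_deriv) (auto simp: twice_diff_def)
  have cDf: "continuous_on \<Omega> (\<lambda>x. W'' (u x) *\<^sub>R G x)"
    by (intro continuous_intros cW'' continuous_on_subset[OF cont_G] closure_subset)
  note touch = gradient_touching[OF twice_diff_u tr_H df cDf tdT NO cM x0N max]
  define A where "A = H x0"
  define v where "v = G x0"
  define t where "t = W' (u x0)"
  define g where "g = C *\<^sub>R \<theta>' x0"
  have tA: "trace A = t" using pde[OF x0O] by (simp add: A_def t_def)
  have "g = 2 *\<^sub>R (A *v v) - (2 * trace A) *\<^sub>R v"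
    using touch(2) by (simp add: g_def A_def v_def tA[unfolded A_def] t_def algebra_simps)
  moreover have "(A *v h) \<bullet> k = (A *v k) \<bullet> h" for h k
    using hessian_symmetric[OF twice_diff_u x0O] by (simp add: A_def)
  ultimately have id: "(v \<bullet> v) * (2 * ((norm (A *v axis 1 1))\<^sup>2 + (norm (A *v axis 2 1))\<^sup>2) - 2 * t\<^sup>2) = 2 * t * (v \<bullet> g) + g \<bullet> g"
    using symmetric_matrix_identity[of A v] tA by simp
  have "2 * ((norm (A *v axis 1 1))\<^sup>2 + (norm (A *v axis 2 1))\<^sup>2) - 2 * t\<^sup>2 \<le> C * \<Lambda> x0"
    using touch(1) trM[OF x0N] by (simp add: A_def t_def v_def)
  then have "2 * t * (v \<bullet> g) + g \<bullet> g \<le> (v \<bullet> v) * (C * \<Lambda> x0)"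
    unfolding id[symmetric] by (intro mult_left_mono) auto
  moreover have "g \<bullet> g \<ge> 0" by simp
  ultimately have "2 * t * (v \<bullet> g) \<le> (v \<bullet> v) * (C * \<Lambda> x0)" by linarith
  then have "C * (2 * t * (v \<bullet> \<theta>' x0)) \<le> C * ((v \<bullet> v) * \<Lambda> x0)" by (simp add: g_def algebra_simps)
  then have main: "2 * t * (v \<bullet> \<theta>' x0) \<le> (v \<bullet> v) * \<Lambda> x0" using C1024 by simp
  define \<sigma> where "\<sigma> = norm v"
  define e where "e = R / s x0"
  define y where "y = v \<bullet> (x0 - a)"
  define U where "U = u x0"
  define K where "K = k U"
  have e: "e > 0" using sx0 R by (simp add: e_def)
  have q0: "0 \<le> q x0" "q x0 < R\<^sup>2" using sx0 by (auto simp: sq) (simp add: q_def)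
  have \<phi>e: "\<phi> (q x0) = e\<^sup>2" by (simp add: \<phi>_def e_def power_divide flip: sq) (simp add: divide_inverse)
  have \<phi>1e: "\<phi>1 (q x0) = 2 * e^3 / R"
    using R sx0 by (simp add: \<phi>1_def e_def power_divide flip: sq) (simp add: field_simps power2_eq_square power3_eq_cube)
  have \<phi>2e: "\<phi>2 (q x0) = 6 * e^4 / R\<^sup>2"
    using R sx0 by (simp add: \<phi>2_def e_def power_divide flip: sq) (simp add: field_simps power2_eq_square power4_eq_xxxx)
  have \<Delta>: "4 * \<phi>2 (q x0) * q x0 + 4 * \<phi>1 (q x0) \<le> 32 * e^4"
  proof -
    have "4 * (6 * e^4 / R\<^sup>2) * q x0 \<le> 4 * (6 * e^4 / R\<^sup>2) * R\<^sup>2" using q0 e by (intro mult_left_mono) auto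
    then have 1: "4 * \<phi>2 (q x0) * q x0 \<le> 24 * e^4" using R by (simp add: \<phi>2e)
    have "s x0 \<le> R\<^sup>2" using q0 by (simp add: sq)
    then have "1 / R \<le> e" using R sx0 by (simp add: e_def field_simps power2_eq_square)
    then have "8 * e^3 * (1 / R) \<le> 8 * e^3 * e" using e by (intro mult_left_mono) auto
    then have "4 * \<phi>1 (q x0) \<le> 8 * e^4" by (simp add: \<phi>1e power_eq_if)
    with 1 show ?thesis by linarith
  qed
  have yb: "\<bar>2 * \<phi>1 (q x0) * y\<bar> \<le> 4 * e^3 * \<sigma>"
  proof -
    have "norm (x0 - a) < R" using x0N by (simp add: N_def dist_norm norm_minus_commute)
    then have "norm v * norm (x0 - a) \<le> \<sigma> * R" unfolding \<sigma>_def by (intro mult_left_mono) auto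
    then have "\<bar>y\<bar> \<le> \<sigma> * R" unfolding y_def using Cauchy_Schwarz_ineq2 order_trans by blast
    then have "4 * e^3 / R * \<bar>y\<bar> \<le> 4 * e^3 / R * (\<sigma> * R)" using e R by (intro mult_left_mono) auto
    then show ?thesis using R e by (simp add: \<phi>1e abs_mult)
  qed
  have K: "1 \<le> K" "K \<le> 2" using k[of x0] by (auto simp: K_def U_def)
  have U: "0 \<le> U" "U \<le> 1" using u_nonneg u_le_1 by (auto simp: U_def)
  have t: "t \<le> 0" "\<bar>t\<bar> \<le> L" using W'_nonpos[OF U] L(2)[OF U] by (auto simp: t_def U_def)
  have vv: "v \<bullet> v = \<sigma>\<^sup>2" by (simp add: \<sigma>_def power2_norm_eq_inner)
  define Z where "Z = 2 * \<phi>1 (q x0) * y"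
  have th: "v \<bullet> \<theta>' x0 = e\<^sup>2 * (- U) * \<sigma>\<^sup>2 + K * Z"
    by (simp add: \<theta>'_def inner_add_right \<phi>e Z_def y_def flip: v_def U_def K_def) (simp add: vv inner_diff_right algebra_simps)
  have La: "\<Lambda> x0 = 2 * (- U * Z) + e\<^sup>2 * (- \<sigma>\<^sup>2 - U * t) + K * (4 * \<phi>2 (q x0) * q x0 + 4 * \<phi>1 (q x0))"
    by (simp add: \<Lambda>_def \<phi>e vv Z_def y_def t_def flip: v_def U_def K_def)
  have ineq: "e\<^sup>2 * \<sigma>^4 \<le> \<sigma>\<^sup>2 * (2 * (- U * Z)) + \<sigma>\<^sup>2 * (K * (4 * \<phi>2 (q x0) * q x0 + 4 * \<phi>1 (q x0))) - 2 * t * (K * Z) + e\<^sup>2 * \<sigma>\<^sup>2 * (U * t)"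
    using main unfolding th La vv by (simp add: algebra_simps power2_eq_square power4_eq_xxxx)
  have "e\<^sup>2 * \<sigma>\<^sup>2 * (U * t) \<le> 0" using U t by (intro mult_nonneg_nonpos) (auto intro: mult_nonneg_nonpos)
  moreover have "\<sigma>\<^sup>2 * (K * (4 * \<phi>2 (q x0) * q x0 + 4 * \<phi>1 (q x0))) \<le> 64 * \<sigma>\<^sup>2 * e^4"
  proof -
    have "K * (4 * \<phi>2 (q x0) * q x0 + 4 * \<phi>1 (q x0)) \<le> K * (32 * e^4)" using K \<Delta> by (intro mult_left_mono) auto
    also have "\<dots> \<le> 2 * (32 * e^4)" using K e by (intro mult_right_mono) auto
    finally have "\<sigma>\<^sup>2 * (K * (4 * \<phi>2 (q x0) * q x0 + 4 * \<phi>1 (q x0))) \<le> \<sigma>\<^sup>2 * (2 * (32 * e^4))" by (intro mult_left_mono) auto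
    then show ?thesis by simp
  qed
  moreover have "\<sigma>\<^sup>2 * (2 * (- U * Z)) \<le> 8 * \<sigma>^3 * e^3"
  proof -
    have "- U * Z \<le> \<bar>U\<bar> * \<bar>Z\<bar>" using abs_ge_self[of "- U * Z"] by (simp add: abs_mult)
    also have "\<dots> \<le> 1 * (4 * e^3 * \<sigma>)" using U yb unfolding Z_def by (intro mult_mono) auto
    finally have "\<sigma>\<^sup>2 * (2 * (- U * Z)) \<le> \<sigma>\<^sup>2 * (2 * (4 * e^3 * \<sigma>))" by (intro mult_left_mono) auto
    then show ?thesis by (simp add: power2_eq_square power3_eq_cube algebra_simps)
  qed
  moreover have "- 2 * t * (K * Z) \<le> 16 * L * \<sigma> * e^3"
  proof -
    have "- 2 * t * (K * Z) \<le> 2 * (\<bar>t\<bar> * (\<bar>K\<bar> * \<bar>Z\<bar>))" using abs_ge_self[of "- 2 * t * (K * Z)"] by (simp add: abs_mult)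
    also have "\<dots> \<le> 2 * (L * (2 * (4 * e^3 * \<sigma>)))"
      using t K yb L unfolding Z_def by (intro mult_left_mono mult_mono) auto
    finally show ?thesis by (simp add: algebra_simps)
  qed
  ultimately have fin: "e\<^sup>2 * \<sigma>^4 \<le> 64 * \<sigma>\<^sup>2 * e^4 + 8 * \<sigma>^3 * e^3 + 16 * L * \<sigma> * e^3"
    using ineq by linarith
  have Ce: "C * e\<^sup>2 \<le> \<sigma>\<^sup>2"
  proof -
    have "C * e\<^sup>2 * 1 \<le> C * e\<^sup>2 * K" using K C1024 by (intro mult_left_mono) auto
    also have "\<dots> = P x0" using Ck by (simp add: \<phi>e K_def U_def)
    also have "\<dots> \<le> \<sigma>\<^sup>2" using W_nonneg[OF u_nonneg[of x0]] by (simp add: P_def \<sigma>_def v_def)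
    finally show ?thesis by simp
  qed
  have "0 < C * e\<^sup>2" using C1024 e by simp
  then have "\<sigma> > 0" using Ce by (smt (verit) \<sigma>_def norm_ge_zero power_zero_numeral zero_less_norm_iff)
  moreover have "1 \<le> e\<^sup>2 * R\<^sup>2"
  proof -
    have "s x0 \<le> R\<^sup>2" using q0 by (simp add: sq)
    then have "1 \<le> e * R" using R sx0 by (simp add: e_def field_simps power2_eq_square)
    then have "1\<^sup>2 \<le> (e * R)\<^sup>2" by (intro power_mono) auto
    then show ?thesis by (simp add: power_mult_distrib)
  qed
  ultimately have "C^3 \<le> (32 * L)\<^sup>2 * R^4" using bernstein_numeric[OF e _ L(1) _ C1024 Ce _ fin] R by simp
  moreover have "(\<delta> * R\<^sup>2 / 2)^3 \<le> C^3" using C \<delta> by (intro power_mono) auto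
  ultimately show False using R2 by linarith
qed

section \<open>The one dimensional profile\<close>

text \<open>\<open>W\<close> vanishes to second order at its minimum \<open>1\<close>. So the slope \<open>sqrt (2 W (u))\<close> allowed by Modica is at
most \<open>M (1 - u)\<close>, and \<open>u\<close> cannot reach \<open>1\<close> at a finite distance from the free boundary.\<close>
lemma W_quadratic_bound:
  obtains M where "M > 0" "\<And>t. 0 \<le> t \<Longrightarrow> t \<le> 1 \<Longrightarrow> 2 * W t \<le> (M * (1 - t))\<^sup>2"
proof -
  have "compact (W'' ` {0..1})" by (intro compact_continuous_image continuous_on_subset[OF W''_cont]) auto
  then obtain B where B: "B > 0" "\<And>y. y \<in> W'' ` {0..1} \<Longrightarrow> norm y \<le> B"
    using compact_imp_bounded bounded_pos by metis
  have W'1: "W' 1 = 0"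
    by (rule DERIV_local_min[OF W_deriv[of 1], of 1]) (auto simp: W_one W_nonneg)
  have step1: "\<bar>W' t\<bar> \<le> B * (1 - t)" if t: "0 \<le> t" "t < 1" for t
  proof -
    obtain z where z: "t < z" "z < 1" "W' 1 - W' t = (1 - t) * W'' z"
      by (rule MVT_open[of t 1 W' W'']) (use t in \<open>auto intro: W'_deriv continuous_on_subset[OF W'_cont]\<close>)
    have "\<bar>W' t\<bar> = (1 - t) * \<bar>W'' z\<bar>" using z t W'1 by (metis abs_minus_commute abs_mult abs_of_pos diff_0_right diff_gt_0_iff_gt)
    also have "\<dots> \<le> (1 - t) * B" using B(2)[of "W'' z"] z t by (intro mult_left_mono) auto
    finally show ?thesis by (simp add: mult.commute)
  qed
  have step2: "W t \<le> B * (1 - t)\<^sup>2" if t: "0 \<le> t" "t < 1" for t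
  proof -
    obtain z where z: "t < z" "z < 1" "W 1 - W t = (1 - t) * W' z"
      by (rule MVT_open[of t 1 W W']) (use t in \<open>auto intro: W_deriv continuous_on_subset[OF W_cont]\<close>)
    have "W t = (1 - t) * (- W' z)" using z W_one by simp
    also have "\<dots> \<le> (1 - t) * (B * (1 - z))" using step1[of z] z t by (intro mult_left_mono) auto
    also have "\<dots> \<le> (1 - t) * (B * (1 - t))" using z t B by (intro mult_left_mono) auto
    finally show ?thesis by (simp add: power2_eq_square algebra_simps)
  qed
  show ?thesis
  proof (rule that[of "sqrt (2 * B)"])
    show "sqrt (2 * B) > 0" using B by simp
    show "2 * W t \<le> (sqrt (2 * B) * (1 - t))\<^sup>2" if "0 \<le> t" "t \<le> 1" for t
      using step2[of t] that W_one B by (cases "t = 1") (auto simp: power_mult_distrib)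
  qed
qed

lemma exit_segment:
  assumes z: "z \<in> \<Omega>" and q: "q \<notin> \<Omega>"
  obtains t1 where "0 < t1" "t1 \<le> 1" "z + t1 *\<^sub>R (q - z) \<notin> \<Omega>"
    "\<And>t. 0 \<le> t \<Longrightarrow> t < t1 \<Longrightarrow> z + t *\<^sub>R (q - z) \<in> \<Omega>"
proof -
  define S where "S = {t. 0 \<le> t \<and> t \<le> 1 \<and> z + t *\<^sub>R (q - z) \<in> - \<Omega>}"
  have "closed ((\<lambda>t. z + t *\<^sub>R (q - z)) -` (- \<Omega>))"
    using open_Omega by (intro continuous_closed_vimage) (auto intro!: continuous_intros)
  moreover have "S = {0..1} \<inter> ((\<lambda>t. z + t *\<^sub>R (q - z)) -` (- \<Omega>))" by (auto simp: S_def)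
  ultimately have "closed S" by auto
  moreover have ne: "S \<noteq> {}" using q by (auto simp: S_def intro!: exI[of _ 1])
  moreover have bd: "bdd_below S" by (auto simp: S_def intro!: bdd_belowI[of _ 0])
  ultimately have inS: "Inf S \<in> S" by (simp add: closed_contains_Inf)
  show ?thesis
  proof (rule that[of "Inf S"])
    show "Inf S \<le> 1" "z + Inf S *\<^sub>R (q - z) \<notin> \<Omega>" using inS by (auto simp: S_def)
    have "Inf S \<noteq> 0" using inS z by (auto simp: S_def)
    then show "0 < Inf S" using inS by (auto simp: S_def)
    show "z + t *\<^sub>R (q - z) \<in> \<Omega>" if "0 \<le> t" "t < Inf S" for t
    proof (rule ccontr)
      assume "z + t *\<^sub>R (q - z) \<notin> \<Omega>"
      then have "t \<in> S" using that inS by (auto simp: S_def)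
      then show False using cInf_lower[OF _ bd] that by fastforce
    qed
  qed
qed

lemma u_along_segment:
  assumes "z + t *\<^sub>R v \<in> \<Omega>"
  obtains d where "((\<lambda>t. u (z + t *\<^sub>R v)) has_real_derivative d) (at t)"
    "\<bar>d\<bar> \<le> sqrt (2 * W (u (z + t *\<^sub>R v))) * norm v"
proof (rule that)
  show "((\<lambda>t. u (z + t *\<^sub>R v)) has_real_derivative G (z + t *\<^sub>R v) \<bullet> v) (at t)"
    by (rule twice_diff_along_line(1)[OF twice_diff_u assms])
  have "norm (G (z + t *\<^sub>R v)) \<le> sqrt (2 * W (u (z + t *\<^sub>R v)))"
    using modica[OF assms] by (simp add: real_le_rsqrt)
  then show "\<bar>G (z + t *\<^sub>R v) \<bullet> v\<bar> \<le> sqrt (2 * W (u (z + t *\<^sub>R v))) * norm v"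
    using Cauchy_Schwarz_ineq2[of "G (z + t *\<^sub>R v)" v] by (meson mult_right_mono norm_ge_zero order_trans)
qed

lemma cont_u_segment: "continuous_on A (\<lambda>t. u (z + t *\<^sub>R v))"
  by (intro continuous_on_compose2[OF cont_u] continuous_intros) auto

text \<open>Gronwall's argument for \<open>1 - u\<close> along a segment that ends at the first point outside \<open>\<Omega>\<close>.\<close>
lemma u_less_1:
  assumes q: "q \<notin> \<Omega>"
  shows "u z < 1"
proof (cases "z \<in> \<Omega>")
  case False
  then show ?thesis using u_outside by simp
next
  case True
  obtain M where M: "M > 0" "\<And>t. 0 \<le> t \<Longrightarrow> t \<le> 1 \<Longrightarrow> 2 * W t \<le> (M * (1 - t))\<^sup>2"
    by (rule W_quadratic_bound) blast
  obtain t1 where t1: "0 < t1" "t1 \<le> 1" "z + t1 *\<^sub>R (q - z) \<notin> \<Omega>"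
    "\<And>t. 0 \<le> t \<Longrightarrow> t < t1 \<Longrightarrow> z + t *\<^sub>R (q - z) \<in> \<Omega>" by (rule exit_segment[OF True q]) blast
  define v where "v = (\<lambda>t. u (z + t *\<^sub>R (q - z)))"
  define E where "E = M * norm (q - z)"
  have "(1 - v t1) * exp (- E * t1) \<le> (1 - v 0) * exp (- E * 0)"
  proof (rule DERIV_nonpos_imp_decreasing_open[OF less_imp_le[OF t1(1)]])
    fix t assume t: "0 < t" "t < t1"
    then obtain d where d: "(v has_real_derivative d) (at t)" "\<bar>d\<bar> \<le> sqrt (2 * W (v t)) * norm (q - z)"
      using u_along_segment[of z t "q - z"] t1(4)[of t] unfolding v_def by auto
    have v: "0 \<le> v t" "v t \<le> 1" using u_nonneg u_le_1 by (auto simp: v_def)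
    have "sqrt (2 * W (v t)) \<le> M * (1 - v t)" using M(2)[OF v] M(1) v by (intro real_le_lsqrt) auto
    then have "\<bar>d\<bar> \<le> M * (1 - v t) * norm (q - z)" using d(2) by (meson mult_right_mono norm_ge_zero order_trans)
    then have dE: "- d - E * (1 - v t) \<le> 0" by (simp add: E_def algebra_simps abs_le_iff)
    have "((\<lambda>t. (1 - v t) * exp (- E * t)) has_real_derivative (- d - E * (1 - v t)) * exp (- E * t)) (at t)"
      by (auto intro!: derivative_eq_intros d(1) simp: algebra_simps)
    moreover have "(- d - E * (1 - v t)) * exp (- E * t) \<le> 0" using dE by (simp add: mult_le_0_iff)
    ultimately show "\<exists>y. ((\<lambda>t. (1 - v t) * exp (- E * t)) has_real_derivative y) (at t) \<and> y \<le> 0" by blast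
  next
    show "continuous_on {0..t1} (\<lambda>t. (1 - v t) * exp (- E * t))"
      unfolding v_def by (intro continuous_intros cont_u_segment)
  qed
  moreover have "v t1 = 0" using t1(3) u_outside by (simp add: v_def)
  ultimately have "exp (- E * t1) \<le> 1 - v 0" by simp
  then have "v 0 < 1" using exp_gt_zero[of "- E * t1"] by linarith
  then show ?thesis by (simp add: v_def)
qed

definition rho :: "real \<Rightarrow> real" where "rho s = 1 / sqrt (2 * W s)"

text \<open>The inverse of the one dimensional solution \<open>U\<close> with \<open>U 0 = 0\<close> and \<open>U' = sqrt (2 W (U))\<close>.\<close>
definition Psi :: "real \<Rightarrow> real" where "Psi s = integral {0..s} rho"

lemma rho_pos: "0 \<le> s \<Longrightarrow> s < 1 \<Longrightarrow> rho s > 0"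
  using W_pos by (simp add: rho_def)

lemma cont_rho: "continuous_on {0..<1} rho"
  unfolding rho_def using W_pos
  by (intro continuous_intros continuous_on_subset[OF W_cont]) force+

lemma Psi_within:
  assumes "0 \<le> s" "s < 1"
  shows "(Psi has_real_derivative rho s) (at s within {0..<1})"
proof -
  define b where "b = (s + 1) / 2"
  have b: "s < b" "b < 1" "0 < b" using assms by (auto simp: b_def)
  have "(Psi has_real_derivative rho s) (at s within {0..b})"
    unfolding Psi_def using assms b by (intro integral_has_real_derivative continuous_on_subset[OF cont_rho]) auto
  moreover have "at s within {0..<1} = at s within {0..b}"
    using b by (intro at_within_nhd[of s "{..<b}"]) auto
  ultimately show ?thesis by simp
qed

lemma Psi_deriv:
  assumes "0 < s" "s < 1"
  shows "(Psi has_real_derivative rho s) (at s)"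
proof -
  have "at s within {0..<1} = at s" using assms by (intro at_within_open_subset[of s "{0<..<1}"]) auto
  then show ?thesis using Psi_within[of s] assms by simp
qed

lemma cont_Psi: "continuous_on {0..<1} Psi"
  by (rule DERIV_continuous_on) (use Psi_within in auto)

lemma Psi_0 [simp]: "Psi 0 = 0"
  by (simp add: Psi_def)

lemma Psi_strict_mono:
  assumes "0 \<le> s" "s < t" "t < 1"
  shows "Psi s < Psi t"
proof (rule DERIV_pos_imp_increasing_open[OF assms(2)])
  show "\<exists>y. (Psi has_real_derivative y) (at x) \<and> 0 < y" if "s < x" "x < t" for x
    using Psi_deriv[of x] rho_pos[of x] assms that by auto
  show "continuous_on {s..t} Psi" by (rule continuous_on_subset[OF cont_Psi]) (use assms in auto)
qed

lemma rho_deriv: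
  assumes "0 < s" "s < 1"
  shows "(rho has_real_derivative - W' s * rho s ^ 3) (at s)"
proof -
  have W: "W s > 0" using W_pos assms by simp
  have "((\<lambda>s. 2 * W s) has_real_derivative 2 * W' s) (at s)" by (intro DERIV_cmult W_deriv assms)
  then have "((\<lambda>s. sqrt (2 * W s)) has_real_derivative inverse (sqrt (2 * W s)) / 2 * (2 * W' s)) (at s)"
    by (rule DERIV_chain2[OF DERIV_real_sqrt, rotated]) (use W in simp)
  from DERIV_inverse'[OF this] W
  have "((\<lambda>s. inverse (sqrt (2 * W s))) has_real_derivative - W' s * inverse (sqrt (2 * W s)) ^ 3) (at s)"
    by (simp add: power3_eq_cube algebra_simps)
  then show ?thesis unfolding rho_def by (simp add: divide_inverse)
qed

text \<open>By Modica \<open>Psi (u)\<close> has slope at most \<open>1\<close> along the segment from \<open>z\<close> to the first point outside \<open>\<Omega>\<close>, where it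
vanishes.\<close>
lemma Psi_u_le_dist:
  assumes q: "q \<notin> \<Omega>"
  shows "Psi (u z) \<le> dist z q"
proof (cases "z \<in> \<Omega>")
  case False
  then show ?thesis using u_outside by simp
next
  case True
  obtain t1 where t1: "0 < t1" "t1 \<le> 1" "z + t1 *\<^sub>R (q - z) \<notin> \<Omega>"
    "\<And>t. 0 \<le> t \<Longrightarrow> t < t1 \<Longrightarrow> z + t *\<^sub>R (q - z) \<in> \<Omega>" by (rule exit_segment[OF True q]) blast
  define v where "v = (\<lambda>t. u (z + t *\<^sub>R (q - z)))"
  have "Psi (v 0) + norm (q - z) * 0 \<le> Psi (v t1) + norm (q - z) * t1"
  proof (rule DERIV_nonneg_imp_increasing_open[OF less_imp_le[OF t1(1)]])
    fix t assume t: "0 < t" "t < t1"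
    then obtain d where d: "(v has_real_derivative d) (at t)" "\<bar>d\<bar> \<le> sqrt (2 * W (v t)) * norm (q - z)"
      using u_along_segment[of z t "q - z"] t1(4)[of t] unfolding v_def by auto
    have v: "0 < v t" "v t < 1" using u_less_1[OF q] t1(4)[of t] t u_pos_iff by (auto simp: v_def)
    have D: "((\<lambda>t. Psi (v t) + norm (q - z) * t) has_real_derivative rho (v t) * d + norm (q - z)) (at t)"
      by (rule derivative_eq_intros DERIV_chain2[OF Psi_deriv[OF v] d(1)] refl | simp)+
    have r: "rho (v t) > 0" and "W (v t) > 0" using v rho_pos W_pos by auto
    then have "rho (v t) * sqrt (2 * W (v t)) = 1" by (simp add: rho_def)
    have "rho (v t) * \<bar>d\<bar> \<le> rho (v t) * (sqrt (2 * W (v t)) * norm (q - z))" using d r by (intro mult_left_mono) auto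
    also have "\<dots> = norm (q - z)" using \<open>rho (v t) * sqrt (2 * W (v t)) = 1\<close> by (simp flip: mult.assoc)
    finally have "\<bar>rho (v t) * d\<bar> \<le> norm (q - z)" using r by (simp add: abs_mult)
    then have "rho (v t) * d + norm (q - z) \<ge> 0" by linarith
    with D show "\<exists>y. ((\<lambda>t. Psi (v t) + norm (q - z) * t) has_real_derivative y) (at t) \<and> 0 \<le> y" by blast
  next
    have "continuous_on {0..t1} (\<lambda>t. Psi (v t))"
      unfolding v_def using u_less_1[OF q] u_nonneg
      by (intro continuous_on_compose2[OF cont_Psi] cont_u_segment) auto
    then show "continuous_on {0..t1} (\<lambda>t. Psi (v t) + norm (q - z) * t)" by (intro continuous_intros)
  qed
  moreover have "v t1 = 0" using t1(3) u_outside by (simp add: v_def)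
  moreover have "norm (q - z) * t1 \<le> norm (q - z) * 1" using t1 by (intro mult_left_mono) auto
  ultimately show ?thesis by (simp add: v_def dist_norm norm_minus_commute)
qed

section \<open>Concavity of the free boundary\<close>

context
  fixes p \<tau> \<nu> g h
  assumes gc: "graph_chart \<Omega> p \<tau> \<nu> g h"
begin


definition "chart_map t s = t *\<^sub>R \<tau> + (g t + s) *\<^sub>R \<nu>"

definition "tangent t = \<tau> + deriv g t *\<^sub>R \<nu>"

lemma chart_facts:
  "h > 0" "norm \<tau> = 1" "norm \<nu> = 1" "\<tau> \<bullet> \<nu> = 0" "\<tau> \<bullet> \<tau> = 1" "\<nu> \<bullet> \<nu> = 1" "smooth_real g"
  "\<bar>t - p \<bullet> \<tau>\<bar> \<le> h \<Longrightarrow> 0 < s \<Longrightarrow> s \<le> h \<Longrightarrow> chart_map t s \<in> \<Omega>"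
  "\<bar>t - p \<bullet> \<tau>\<bar> \<le> h \<Longrightarrow> 0 \<le> s \<Longrightarrow> s \<le> h \<Longrightarrow> chart_map t s \<in> closure \<Omega>"
  "\<bar>t - p \<bullet> \<tau>\<bar> \<le> h \<Longrightarrow> chart_map t 0 \<notin> \<Omega>"
  "\<bar>t - p \<bullet> \<tau>\<bar> \<le> h \<Longrightarrow> chart_map t 0 \<in> frontier \<Omega>"
proof -
  show h: "h > 0" "norm \<tau> = 1" "norm \<nu> = 1" "\<tau> \<bullet> \<nu> = 0" "smooth_real g" using gc unfolding graph_chart_def by blast+
  then show "\<tau> \<bullet> \<tau> = 1" "\<nu> \<bullet> \<nu> = 1" by (simp_all add: norm_eq_1)
  have iff: "\<bar>t - p \<bullet> \<tau>\<bar> \<le> h \<Longrightarrow> \<bar>s\<bar> \<le> h \<Longrightarrow> chart_map t s \<in> \<Omega> \<longleftrightarrow> s > 0" for t s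
    using gc unfolding graph_chart_def chart_map_def by blast
  show "\<bar>t - p \<bullet> \<tau>\<bar> \<le> h \<Longrightarrow> 0 < s \<Longrightarrow> s \<le> h \<Longrightarrow> chart_map t s \<in> \<Omega>" using iff[of t s] by auto
  show cl: "\<bar>t - p \<bullet> \<tau>\<bar> \<le> h \<Longrightarrow> 0 \<le> s \<Longrightarrow> s \<le> h \<Longrightarrow> chart_map t s \<in> closure \<Omega>" for s
    unfolding chart_map_def by (rule graph_chart_closure[OF gc])
  show nin: "\<bar>t - p \<bullet> \<tau>\<bar> \<le> h \<Longrightarrow> chart_map t 0 \<notin> \<Omega>" using iff[of t 0] h by auto
  show "\<bar>t - p \<bullet> \<tau>\<bar> \<le> h \<Longrightarrow> chart_map t 0 \<in> frontier \<Omega>" using nin cl[of 0] h by (auto simp: frontier_Omega)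
qed

lemma has_derivative_chart_t: "((\<lambda>t. chart_map t s) has_derivative (\<lambda>k. k *\<^sub>R tangent t)) (at t)"
proof -
  have "(g has_derivative (\<lambda>k. k * deriv g t)) (at t)"
    using smooth_real_derivs(1)[OF chart_facts(7), of t] by (auto simp: has_field_derivative_def mult.commute elim!: has_derivative_eq_rhs)
  then show ?thesis unfolding chart_map_def tangent_def
    by (auto intro!: derivative_eq_intros simp: algebra_simps)
qed

lemma has_derivative_chart_s: "((\<lambda>s. chart_map t s) has_derivative (\<lambda>k. k *\<^sub>R \<nu>)) (at s)"
  unfolding chart_map_def by (auto intro!: derivative_eq_intros)

lemma cont_chart: "continuous_on S (\<lambda>(t, s). chart_map t s)"
  unfolding chart_map_def case_prod_unfold
  by (intro continuous_intros continuous_on_compose2[OF smooth_real_derivs(3)[OF chart_facts(7), of UNIV]]) auto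

lemma cont_closure_chart:
  fixes f :: "real^2 \<Rightarrow> 'b::topological_space"
  assumes "continuous_on (closure \<Omega>) f"
  shows "continuous_on ({p \<bullet> \<tau> - h..p \<bullet> \<tau> + h} \<times> {0..h}) (\<lambda>(t, s). f (chart_map t s))"
    and "\<bar>t - p \<bullet> \<tau>\<bar> \<le> h \<Longrightarrow> continuous_on {0..h} (\<lambda>s. f (chart_map t s))"
proof -
  show 1: "continuous_on ({p \<bullet> \<tau> - h..p \<bullet> \<tau> + h} \<times> {0..h}) (\<lambda>(t, s). f (chart_map t s))"
  proof -
    have "(\<lambda>(t, s). chart_map t s) ` ({p \<bullet> \<tau> - h..p \<bullet> \<tau> + h} \<times> {0..h}) \<subseteq> closure \<Omega>"
      by (auto intro!: chart_facts(9) simp: abs_le_iff)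
    from continuous_on_compose2[OF assms cont_chart this] show ?thesis by (simp add: case_prod_unfold)
  qed
  show "continuous_on {0..h} (\<lambda>s. f (chart_map t s))" if "\<bar>t - p \<bullet> \<tau>\<bar> \<le> h"
  proof -
    have "continuous_on {0..h} (\<lambda>s. (t, s))" by (intro continuous_intros)
    moreover have "(\<lambda>s. (t, s)) ` {0..h} \<subseteq> {p \<bullet> \<tau> - h..p \<bullet> \<tau> + h} \<times> {0..h}"
      using that by (auto simp: abs_le_iff)
    ultimately show ?thesis using continuous_on_compose2[OF 1] by fastforce
  qed
qed

lemma deriv_along:
  assumes \<gamma>: "(\<gamma> has_derivative (\<lambda>k. k *\<^sub>R v)) (at a)" and x: "\<gamma> a \<in> \<Omega>"
  shows "((\<lambda>a. u (\<gamma> a)) has_real_derivative G (\<gamma> a) \<bullet> v) (at a)"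
    and "((\<lambda>a. G (\<gamma> a)) has_derivative (\<lambda>k. k *\<^sub>R (H (\<gamma> a) *v v))) (at a)"
proof -
  have 1: "(u has_derivative (\<lambda>h. h \<bullet> G (\<gamma> a))) (at (\<gamma> a))"
    and 2: "(G has_derivative (\<lambda>h. H (\<gamma> a) *v h)) (at (\<gamma> a))"
    using twice_diff_u x by (auto simp: twice_diff_def gderiv_def)
  from has_derivative_compose[OF \<gamma> 1]
  show "((\<lambda>a. u (\<gamma> a)) has_real_derivative G (\<gamma> a) \<bullet> v) (at a)"
    by (auto simp: has_field_derivative_def inner_commute mult.commute elim!: has_derivative_eq_rhs)
  from has_derivative_compose[OF \<gamma> 2]
  show "((\<lambda>a. G (\<gamma> a)) has_derivative (\<lambda>k. k *\<^sub>R (H (\<gamma> a) *v v))) (at a)"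
    by (simp add: matrix_vector_mult_scaleR)
qed

lemma cont_tangent: "continuous_on S (\<lambda>y. tangent (fst y))"
  unfolding tangent_def
  by (intro continuous_intros continuous_on_compose2[OF smooth_real_derivs(4)[OF chart_facts(7), of UNIV]]) auto

lemma cont_deriv2: "continuous_on S (\<lambda>y. deriv (deriv g) (fst y))"
  by (intro continuous_intros continuous_on_compose2[OF smooth_real_derivs(5)[OF chart_facts(7), of UNIV]]) auto

lemma gradient_normal:
  assumes t: "\<bar>t - p \<bullet> \<tau>\<bar> \<le> h"
  shows "G (chart_map t 0) \<bullet> tangent t = 0"
proof (rule boundary_derivative_vanishes[where F="\<lambda>t s. u (chart_map t s)" and Fd="\<lambda>t s. G (chart_map t s) \<bullet> tangent t", OF chart_facts(1) _ _ _ _ t])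
  fix t s assume "\<bar>t - p \<bullet> \<tau>\<bar> \<le> h" "0 < s" "s \<le> h"
  then show "((\<lambda>t. u (chart_map t s)) has_real_derivative G (chart_map t s) \<bullet> tangent t) (at t)"
    by (intro deriv_along(1)[of "\<lambda>t. chart_map t s"] has_derivative_chart_t chart_facts(8))
next
  show "continuous_on ({p \<bullet> \<tau> - h..p \<bullet> \<tau> + h} \<times> {0..h}) (\<lambda>(t, s). u (chart_map t s))"
    by (intro cont_closure_chart(1) continuous_on_subset[OF cont_u]) auto
  show "continuous_on ({p \<bullet> \<tau> - h..p \<bullet> \<tau> + h} \<times> {0..h}) (\<lambda>(t, s). G (chart_map t s) \<bullet> tangent t)"
    using continuous_on_inner[OF cont_closure_chart(1)[OF cont_G] cont_tangent] by (simp add: case_prod_unfold)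
  show "u (chart_map t 0) = 0" if "\<bar>t - p \<bullet> \<tau>\<bar> \<le> h" for t
    using chart_facts(10)[OF that] u_outside by simp
qed

text \<open>The second derivative of the boundary identity \<open>u = 0\<close> along the graph.\<close>
lemma hessian_tangential:
  assumes t: "\<bar>t - p \<bullet> \<tau>\<bar> \<le> h"
  shows "(H (chart_map t 0) *v tangent t) \<bullet> tangent t + (G (chart_map t 0) \<bullet> \<nu>) * deriv (deriv g) t = 0"
proof (rule boundary_derivative_vanishes[where F="\<lambda>t s. G (chart_map t s) \<bullet> tangent t"
     and Fd="\<lambda>t s. (H (chart_map t s) *v tangent t) \<bullet> tangent t + (G (chart_map t s) \<bullet> \<nu>) * deriv (deriv g) t", OF chart_facts(1) _ _ _ _ t])
  fix t s assume ts: "\<bar>t - p \<bullet> \<tau>\<bar> \<le> h" "0 < s" "s \<le> h"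
  have "(deriv g has_derivative (\<lambda>k. k * deriv (deriv g) t)) (at t)"
    using smooth_real_derivs(2)[OF chart_facts(7), of t] by (auto simp: has_field_derivative_def mult.commute elim!: has_derivative_eq_rhs)
  then have "(tangent has_derivative (\<lambda>k. (k * deriv (deriv g) t) *\<^sub>R \<nu>)) (at t)"
    unfolding tangent_def by (auto intro!: derivative_eq_intros)
  from has_derivative_inner[OF deriv_along(2)[OF has_derivative_chart_t, of t s] this] chart_facts(8)[OF ts]
  show "((\<lambda>t. G (chart_map t s) \<bullet> tangent t) has_real_derivative
      (H (chart_map t s) *v tangent t) \<bullet> tangent t + (G (chart_map t s) \<bullet> \<nu>) * deriv (deriv g) t) (at t)"
    by (auto simp: has_field_derivative_def algebra_simps elim!: has_derivative_eq_rhs)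
next
  show "continuous_on ({p \<bullet> \<tau> - h..p \<bullet> \<tau> + h} \<times> {0..h}) (\<lambda>(t, s). G (chart_map t s) \<bullet> tangent t)"
    using continuous_on_inner[OF cont_closure_chart(1)[OF cont_G] cont_tangent] by (simp add: case_prod_unfold)
  show "continuous_on ({p \<bullet> \<tau> - h..p \<bullet> \<tau> + h} \<times> {0..h})
     (\<lambda>(t, s). (H (chart_map t s) *v tangent t) \<bullet> tangent t + (G (chart_map t s) \<bullet> \<nu>) * deriv (deriv g) t)"
    using cont_closure_chart(1)[OF cont_G] cont_closure_chart(1)[OF cont_H] unfolding case_prod_unfold
    by (intro continuous_intros cont_tangent cont_deriv2)
  show "G (chart_map t 0) \<bullet> tangent t = 0" if "\<bar>t - p \<bullet> \<tau>\<bar> \<le> h" for t by (rule gradient_normal[OF that])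
qed

text \<open>The gradient is normal to the graph and does not vanish by the free boundary condition; positivity of
\<open>u\<close> above the graph determines its direction.\<close>
lemma gradient_at_boundary:
  assumes t: "\<bar>t - p \<bullet> \<tau>\<bar> \<le> h"
  shows "G (chart_map t 0) = (G (chart_map t 0) \<bullet> \<nu>) *\<^sub>R (\<nu> - deriv g t *\<^sub>R \<tau>)"
    and "G (chart_map t 0) \<bullet> \<nu> > 0"
proof -
  let ?x = "chart_map t 0"
  define \<beta> where "\<beta> = G ?x \<bullet> \<nu>"
  have "G ?x \<bullet> \<tau> = - deriv g t * \<beta>" using gradient_normal[OF t] by (simp add: tangent_def inner_simps \<beta>_def)
  then have eq: "G ?x = \<beta> *\<^sub>R (\<nu> - deriv g t *\<^sub>R \<tau>)"
    using orthonormal_expansion[OF chart_facts(2-4), of "G ?x"] by (simp add: \<beta>_def algebra_simps)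
  then show "G ?x = (G ?x \<bullet> \<nu>) *\<^sub>R (\<nu> - deriv g t *\<^sub>R \<tau>)" by (simp add: \<beta>_def)
  have "norm (G ?x) = sqrt (2 * W 0)" using free_boundary chart_facts(11)[OF t] by blast
  moreover have "W 0 > 0" using W_pos by simp
  ultimately have "G ?x \<noteq> 0" by auto
  then have "\<beta> \<noteq> 0" using eq by auto
  moreover have "- \<beta> \<le> 0"
    unfolding \<beta>_def
  proof (rule one_sided_derivative_nonpos[where f="\<lambda>s. - u (chart_map t s)" and d="\<lambda>s. - (G (chart_map t s) \<bullet> \<nu>)", OF chart_facts(1)])
    show "((\<lambda>s. - u (chart_map t s)) has_real_derivative - (G (chart_map t s) \<bullet> \<nu>)) (at s)" if "0 < s" "s \<le> h" for s
      using deriv_along(1)[OF has_derivative_chart_s, of t s] chart_facts(8)[OF t that] by (intro DERIV_minus) auto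
    show "continuous_on {0..h} (\<lambda>s. - u (chart_map t s))"
      by (intro continuous_intros cont_closure_chart(2) t continuous_on_subset[OF cont_u]) auto
    show "continuous_on {0..h} (\<lambda>s. - (G (chart_map t s) \<bullet> \<nu>))"
      by (intro continuous_intros cont_closure_chart(2) t cont_G)
    show "- u (chart_map t 0) = 0" using chart_facts(10)[OF t] u_outside by simp
    show "- u (chart_map t s) \<le> 0" for s using u_nonneg by simp
  qed
  ultimately show "G ?x \<bullet> \<nu> > 0" by (simp add: \<beta>_def)
qed

lemma trace_H_boundary:
  assumes t: "\<bar>t - p \<bullet> \<tau>\<bar> \<le> h"
  shows "trace (H (chart_map t 0)) = W' 0"
proof -
  have c1: "continuous_on (closure \<Omega>) (\<lambda>x. trace (H x) - W' (u x))"
    unfolding trace_def sum_2 using u_nonneg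
    by (intro continuous_intros cont_H continuous_on_compose2[OF W'_cont] continuous_on_subset[OF cont_u]) auto
  have "trace (H x) - W' (u x) = 0" if "x \<in> closure \<Omega>" for x
    by (rule continuous_constant_on_closure[OF c1 _ that]) (use pde in auto)
  from this[of "chart_map t 0"] show ?thesis
    using chart_facts(9)[OF t, of 0] chart_facts(1) chart_facts(10)[OF t] u_outside by auto
qed

text \<open>The Modica function \<open>P\<close> is zero on the graph and at most zero above it. So its tangential derivative
vanishes and its normal derivative is at most zero, which bounds the second normal
derivative of \<open>u\<close> by \<open>W' 0 = \<Delta>u\<close>. The second tangential derivative of \<open>u\<close> is then nonnegative, and by
\<open>hessian_tangential\<close> the graph bends downwards.\<close>
lemma graph_concave:
  assumes t: "\<bar>t - p \<bullet> \<tau>\<bar> \<le> h"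
  shows "deriv (deriv g) t \<le> 0"
proof -
  define P where "P = (\<lambda>x. G x \<bullet> G x - 2 * W (u x))"
  let ?x = "chart_map t 0"
  define \<beta> where "\<beta> = G ?x \<bullet> \<nu>"
  define m where "m = deriv g t"
  define N where "N = \<nu> - m *\<^sub>R \<tau>"
  have \<beta>: "\<beta> > 0" "G ?x = \<beta> *\<^sub>R N" using gradient_at_boundary[OF t] by (auto simp: \<beta>_def N_def m_def)
  have Pder: "((\<lambda>a. P (\<gamma> a)) has_real_derivative 2 * ((H (\<gamma> a) *v v) \<bullet> G (\<gamma> a)) - 2 * (W' (u (\<gamma> a)) * (G (\<gamma> a) \<bullet> v))) (at a)"
    if \<gamma>: "(\<gamma> has_derivative (\<lambda>k. k *\<^sub>R v)) (at a)" "\<gamma> a \<in> \<Omega>" for \<gamma> v a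
  proof -
    have "((\<lambda>a. W (u (\<gamma> a))) has_real_derivative W' (u (\<gamma> a)) * (G (\<gamma> a) \<bullet> v)) (at a)"
      using that u_pos_iff by (intro DERIV_chain2[OF W_deriv] deriv_along(1)) auto
    moreover have "((\<lambda>a. G (\<gamma> a) \<bullet> G (\<gamma> a)) has_real_derivative 2 * ((H (\<gamma> a) *v v) \<bullet> G (\<gamma> a))) (at a)"
      using has_derivative_inner[OF deriv_along(2)[OF \<gamma>] deriv_along(2)[OF \<gamma>]]
      by (auto simp: has_field_derivative_def inner_commute algebra_simps elim!: has_derivative_eq_rhs)
    ultimately show ?thesis unfolding P_def by (intro DERIV_diff DERIV_cmult)
  qed
  have cWu: "continuous_on (closure \<Omega>) (\<lambda>x. W (u x))" and cW'u: "continuous_on (closure \<Omega>) (\<lambda>x. W' (u x))"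
    using u_nonneg by (auto intro!: continuous_on_compose2[OF W_cont] continuous_on_compose2[OF W'_cont] continuous_on_subset[OF cont_u])
  have cP: "continuous_on (closure \<Omega>) P"
    unfolding P_def by (intro continuous_intros cont_G cWu)
  have P0: "P (chart_map t 0) = 0" if "\<bar>t - p \<bullet> \<tau>\<bar> \<le> h" for t
    using free_boundary[OF chart_facts(11)[OF that]] u_outside[OF chart_facts(10)[OF that]] W_nonneg[of 0]
    by (simp add: P_def flip: power2_norm_eq_inner)
  have u0: "u ?x = 0" using u_outside[OF chart_facts(10)[OF t]] .
  have "2 * ((H ?x *v tangent t) \<bullet> G ?x) - 2 * (W' (u ?x) * (G ?x \<bullet> tangent t)) = 0"
  proof (rule boundary_derivative_vanishes[where F="\<lambda>t s. P (chart_map t s)"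
     and Fd="\<lambda>t s. 2 * ((H (chart_map t s) *v tangent t) \<bullet> G (chart_map t s)) - 2 * (W' (u (chart_map t s)) * (G (chart_map t s) \<bullet> tangent t))",
      OF chart_facts(1) _ _ _ P0 t])
    fix t s assume ts: "\<bar>t - p \<bullet> \<tau>\<bar> \<le> h" "0 < s" "s \<le> h"
    show "((\<lambda>t. P (chart_map t s)) has_real_derivative
      2 * ((H (chart_map t s) *v tangent t) \<bullet> G (chart_map t s)) - 2 * (W' (u (chart_map t s)) * (G (chart_map t s) \<bullet> tangent t))) (at t)"
      using ts by (intro Pder has_derivative_chart_t chart_facts(8))
  next
    show "continuous_on ({p \<bullet> \<tau> - h..p \<bullet> \<tau> + h} \<times> {0..h}) (\<lambda>(t, s). P (chart_map t s))"
      by (rule cont_closure_chart(1)[OF cP])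
    show "continuous_on ({p \<bullet> \<tau> - h..p \<bullet> \<tau> + h} \<times> {0..h}) (\<lambda>(t, s).
       2 * ((H (chart_map t s) *v tangent t) \<bullet> G (chart_map t s)) - 2 * (W' (u (chart_map t s)) * (G (chart_map t s) \<bullet> tangent t)))"
      using cont_closure_chart(1)[OF cont_G] cont_closure_chart(1)[OF cont_H] cont_closure_chart(1)[OF cW'u]
      unfolding case_prod_unfold by (intro continuous_intros cont_tangent)
  qed
  then have tang: "(H ?x *v tangent t) \<bullet> N = 0" using gradient_normal[OF t] \<beta> by simp
  have "2 * ((H ?x *v \<nu>) \<bullet> G ?x) - 2 * (W' (u ?x) * (G ?x \<bullet> \<nu>)) \<le> 0"
  proof (rule one_sided_derivative_nonpos[where f="\<lambda>s. P (chart_map t s)"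
      and d="\<lambda>s. 2 * ((H (chart_map t s) *v \<nu>) \<bullet> G (chart_map t s)) - 2 * (W' (u (chart_map t s)) * (G (chart_map t s) \<bullet> \<nu>))", OF chart_facts(1)])
    show "((\<lambda>s. P (chart_map t s)) has_real_derivative
       2 * ((H (chart_map t s) *v \<nu>) \<bullet> G (chart_map t s)) - 2 * (W' (u (chart_map t s)) * (G (chart_map t s) \<bullet> \<nu>))) (at s)"
      if "0 < s" "s \<le> h" for s using that t by (intro Pder has_derivative_chart_s chart_facts(8))
    show "continuous_on {0..h} (\<lambda>s. P (chart_map t s))" by (rule cont_closure_chart(2)[OF cP t])
    show "continuous_on {0..h} (\<lambda>s. 2 * ((H (chart_map t s) *v \<nu>) \<bullet> G (chart_map t s)) - 2 * (W' (u (chart_map t s)) * (G (chart_map t s) \<bullet> \<nu>)))"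
      by (intro continuous_intros cont_closure_chart(2)[OF cont_G t] cont_closure_chart(2)[OF cont_H t] cont_closure_chart(2)[OF cW'u t])
    show "P (chart_map t 0) = 0" by (rule P0[OF t])
    show "P (chart_map t s) \<le> 0" if "0 < s" "s \<le> h" for s
      using modica[OF chart_facts(8)[OF t that]] by (simp add: P_def power2_norm_eq_inner)
  qed
  moreover have "(H ?x *v \<nu>) \<bullet> G ?x = \<beta> * ((H ?x *v \<nu>) \<bullet> N)" by (subst \<beta>(2)) simp
  moreover have "W' (u ?x) * (G ?x \<bullet> \<nu>) = \<beta> * W' 0" by (simp only: u0 \<beta>_def mult.commute)
  ultimately have "\<beta> * ((H ?x *v \<nu>) \<bullet> N) \<le> \<beta> * W' 0" by linarith
  then have norml: "(H ?x *v \<nu>) \<bullet> N \<le> W' 0" by (rule mult_left_le_imp_le[OF _ \<beta>(1)])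
  define A where "A = H ?x"
  define a b c d where "a = (A *v \<tau>) \<bullet> \<tau>" and "b = (A *v \<tau>) \<bullet> \<nu>" and "c = (A *v \<nu>) \<bullet> \<tau>" and "d = (A *v \<nu>) \<bullet> \<nu>"
  have tr: "a + d = W' 0" using trace_orthonormal[OF chart_facts(2-4), of A] trace_H_boundary[OF t] by (simp add: a_def d_def A_def)
  have 1: "b - m * a + m * (d - m * c) = 0"
    using tang unfolding tangent_def N_def A_def[symmetric] m_def[symmetric]
    by (simp add: matrix_vector_right_distrib matrix_vector_mult_scaleR inner_simps a_def b_def c_def d_def algebra_simps)
  have 2: "d - m * c \<le> W' 0" using norml unfolding N_def A_def[symmetric] by (simp add: inner_simps c_def d_def)
  have "(A *v tangent t) \<bullet> tangent t = a + m * b + m * c + m\<^sup>2 * d"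
    unfolding tangent_def m_def[symmetric]
    by (simp add: matrix_vector_right_distrib matrix_vector_mult_scaleR inner_simps a_def b_def c_def d_def algebra_simps power2_eq_square)
  also have "\<dots> = (1 + m\<^sup>2) * (W' 0 - (d - m * c)) + m * (b - m * a + m * (d - m * c))"
    unfolding tr[symmetric] by (simp add: algebra_simps power2_eq_square)
  also have "\<dots> \<ge> 0" using 1 2 by (simp add: mult_nonneg_nonneg)
  finally have "(A *v tangent t) \<bullet> tangent t \<ge> 0" .
  then have "\<beta> * deriv (deriv g) t \<le> 0" using hessian_tangential[OF t] by (simp add: A_def \<beta>_def)
  then show ?thesis using \<beta> by (simp add: mult_le_0_iff)
qed

end


section \<open>Straight boundary lines and half planes\<close>

text \<open>At a boundary point the tangent line stays above the concave graph, that is, in the closure.\<close>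
lemma tip_free_closure_piece:
  assumes AB: "open A" "open B" "A \<union> B = \<Omega>" "A \<inter> B = {}"
  shows "tip_free (closure A)"
  unfolding tip_free_def
proof (intro ballI allI impI)
  fix p and r :: real assume p: "p \<in> closure A" and r: "r > 0"
  show "\<exists>v. v \<noteq> 0 \<and> norm v < r \<and> p + v \<in> closure A \<and> p - v \<in> closure A"
  proof (cases "p \<in> A")
    case True
    then obtain d where d: "d > 0" "ball p d \<subseteq> A" using AB open_contains_ball by blast
    define v :: "real^2" where "v = (min d r / 2) *\<^sub>R axis 1 1"
    have nv: "norm v = min d r / 2" using d r by (simp add: v_def norm_axis_1)
    have "v \<noteq> 0" "norm v < r" using nv d r by auto
    moreover have "p + v \<in> A" "p - v \<in> A" using d nv r by (auto intro!: subsetD[OF d(2)] simp: dist_norm)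
    ultimately show ?thesis using closure_subset by blast
  next
    case False
    have "p \<notin> B" using p AB by (metis IntI empty_iff open_Int_closure_eq_empty inf_commute)
    then have "p \<in> frontier \<Omega>" using p False AB closure_mono[of A \<Omega>] by (auto simp: frontier_Omega)
    then obtain \<tau> \<nu> g h where gc: "graph_chart \<Omega> p \<tau> \<nu> g h"
      by (rule frontier_graph_chart[OF smooth_Omega open_Omega])
    have gA: "graph_chart A p \<tau> \<nu> g h" by (rule graph_chart_piece[OF gc AB p])
    obtain \<rho> where \<rho>: "\<rho> > 0" "\<And>x. x \<in> ball p \<rho> \<Longrightarrow> (x \<in> closure A \<longleftrightarrow> g (x \<bullet> \<tau>) \<le> x \<bullet> \<nu>)"
      "\<And>x. x \<in> ball p \<rho> \<Longrightarrow> \<bar>x \<bullet> \<tau> - p \<bullet> \<tau>\<bar> < h"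
      by (rule graph_chart_closure_ball[OF gA]) blast
    note cf = chart_facts[OF gc]
    define t0 where "t0 = p \<bullet> \<tau>"
    define T where "T = \<tau> + deriv g t0 *\<^sub>R \<nu>"
    have T: "T \<bullet> \<tau> = 1" "T \<bullet> \<nu> = deriv g t0" using cf by (simp_all add: T_def inner_simps inner_commute)
    then have "T \<noteq> 0" by auto
    define I where "I = {t0 - h..t0 + h}"
    have conv: "convex_on I (\<lambda>t. - g t)"
    proof (rule f''_ge0_imp_convex)
      show "convex I" by (simp add: I_def)
      show "((\<lambda>t. - g t) has_real_derivative - deriv g t) (at t)" "((\<lambda>t. - deriv g t) has_real_derivative - deriv (deriv g) t) (at t)" for t
        by (intro DERIV_minus smooth_real_derivs(1,2) cf(7))+
      show "0 \<le> - deriv (deriv g) t" if "t \<in> I" for t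
        using graph_concave[OF gc, of t] that by (auto simp: I_def t0_def abs_le_iff)
    qed
    have below: "g t \<le> g t0 + deriv g t0 * (t - t0)" if "\<bar>t - t0\<bar> \<le> h" for t
    proof -
      have "- g t - - g t0 \<ge> - deriv g t0 * (t - t0)"
      proof (rule convex_on_imp_above_tangent[OF conv])
        show "connected I" by (simp add: I_def)
        show "t0 \<in> interior I" using cf(1) by (simp add: I_def)
        show "t \<in> I" using that by (simp add: I_def abs_le_iff)
        show "((\<lambda>t. - g t) has_real_derivative - deriv g t0) (at t0 within I)"
          by (rule has_field_derivative_at_within[OF DERIV_minus[OF smooth_real_derivs(1)[OF cf(7)]]])
      qed
      then show ?thesis by simp
    qed
    have pv: "p \<bullet> \<nu> = g t0" using gc by (simp add: graph_chart_def t0_def)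
    have inc: "p + \<sigma> *\<^sub>R T \<in> closure A" if "norm (\<sigma> *\<^sub>R T) < \<rho>" for \<sigma>
    proof -
      define x where "x = p + \<sigma> *\<^sub>R T"
      have xb: "x \<in> ball p \<rho>" using that by (simp add: x_def dist_norm)
      have x: "x \<bullet> \<tau> = t0 + \<sigma>" "x \<bullet> \<nu> = g t0 + deriv g t0 * \<sigma>" using T pv by (simp_all add: x_def inner_simps t0_def)
      have "g (x \<bullet> \<tau>) \<le> x \<bullet> \<nu>" using below[of "t0 + \<sigma>"] \<rho>(3)[OF xb] x by (simp add: t0_def)
      then show ?thesis using \<rho>(2)[OF xb] by (simp add: x_def)
    qed
    define \<epsilon> where "\<epsilon> = min \<rho> r / (2 * norm T)"
    have "norm (\<epsilon> *\<^sub>R T) = min \<rho> r / 2" using \<open>T \<noteq> 0\<close> \<rho>(1) r by (simp add: \<epsilon>_def)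
    then have e: "norm (\<epsilon> *\<^sub>R T) < \<rho>" "norm (\<epsilon> *\<^sub>R T) < r" "\<epsilon> *\<^sub>R T \<noteq> 0" using \<rho>(1) r by auto
    show ?thesis
      using e inc[of \<epsilon>] inc[of "- \<epsilon>"] by (intro exI[of _ "\<epsilon> *\<^sub>R T"]) auto
  qed
qed

text \<open>The line provided by the geometry consists of boundary points of \<open>A\<close>, so near \<open>p0\<close> it is the graph of a
chart. The chart is turned so that its graph becomes constant.\<close>
lemma flat_boundary_line:
  assumes AB: "open A" "open B" "A \<union> B = \<Omega>" "A \<inter> B = {}" "A \<noteq> {}" "B \<noteq> {}"
  obtains n c p0 e h where "norm n = 1" "p0 \<in> closure A" "\<And>z. z \<bullet> n = c \<Longrightarrow> z \<notin> \<Omega>"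
    "graph_chart \<Omega> p0 e n (\<lambda>_. c) h"
proof -
  have disj: "closure A \<inter> closure B = {}" by (rule pieces_closure_disjoint[OF smooth_Omega AB(1-4)])
  have tA: "tip_free (closure A)" by (rule tip_free_closure_piece[OF AB(1-4)])
  have tB: "tip_free (closure B)" by (rule tip_free_closure_piece[OF AB(2,1)]) (use AB in auto)
  obtain n c p0 b where geo: "norm n = 1" "p0 \<bullet> n = c" "b \<bullet> n < c"
    "\<And>z. z \<bullet> n = c \<Longrightarrow> z \<in> closure A \<and> z \<in> closure (- closure A)" "open_segment p0 b \<inter> closure A = {}"
  proof (rule disjoint_tip_free_boundary_line[OF closed_closure tA _ closed_closure tB _ disj])
    show "closure A \<noteq> {}" "closure B \<noteq> {}" using AB(5,6) by simp_all
  qed blast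
  have line: "z \<in> closure A" "z \<notin> A" "z \<notin> \<Omega>" if "z \<bullet> n = c" for z
  proof -
    show cl: "z \<in> closure A" using geo(4)[OF that] by simp
    have "A \<inter> - closure A = {}" using closure_subset by auto
    then have "A \<inter> closure (- closure A) = {}" using AB(1) open_Int_closure_eq_empty by blast
    then show "z \<notin> A" using geo(4)[OF that] by blast
    moreover have "z \<notin> B" using cl disj closure_subset by blast
    ultimately show "z \<notin> \<Omega>" using AB(3) by blast
  qed
  have "p0 \<in> frontier \<Omega>"
    using line[OF geo(2)] closure_mono[of A \<Omega>] AB(3) by (auto simp: frontier_Omega)
  then obtain \<tau> \<nu> g h where gc: "graph_chart \<Omega> p0 \<tau> \<nu> g h"
    by (rule frontier_graph_chart[OF smooth_Omega open_Omega])
  have gA: "graph_chart A p0 \<tau> \<nu> g h" by (rule graph_chart_piece[OF gc AB(1-4) line(1)[OF geo(2)]])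
  note cf = chart_facts[OF gc]
  obtain r1 where r1: "r1 > 0" "\<And>x. x \<in> ball p0 r1 \<Longrightarrow> (x \<in> A \<longleftrightarrow> g (x \<bullet> \<tau>) < x \<bullet> \<nu>)"
     "\<And>x. x \<in> ball p0 r1 \<Longrightarrow> (x \<in> closure A \<longleftrightarrow> g (x \<bullet> \<tau>) \<le> x \<bullet> \<nu>)"
    by (rule graph_chart_closure_ball[OF gA]) blast
  obtain r2 where r2: "r2 > 0" "\<And>x. x \<in> ball p0 r2 \<Longrightarrow> (x \<in> \<Omega> \<longleftrightarrow> g (x \<bullet> \<tau>) < x \<bullet> \<nu>)"
    by (rule graph_chart_ball[OF gc]) blast
  define r where "r = min r1 r2"
  have r: "r > 0" "\<And>x. x \<in> ball p0 r \<Longrightarrow> (x \<in> \<Omega> \<longleftrightarrow> g (x \<bullet> \<tau>) < x \<bullet> \<nu>)"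
    "\<And>x. x \<in> ball p0 r \<Longrightarrow> (x \<in> closure A \<longleftrightarrow> g (x \<bullet> \<tau>) \<le> x \<bullet> \<nu>)"
    using r1 r2 by (auto simp: r_def)
  have on_graph: "x \<bullet> \<nu> = g (x \<bullet> \<tau>)" if "x \<in> ball p0 r" "x \<bullet> n = c" for x
    using r(2,3)[OF that(1)] line[OF that(2)] by auto
  obtain e where e: "norm e = 1" "e \<bullet> n = 0" using exists_orthogonal_unit[OF geo(1)] .
  have p0line: "(p0 + s *\<^sub>R e) \<bullet> n = c" for s using geo(2) e by (simp add: inner_simps)
  have et: "e \<bullet> \<tau> \<noteq> 0"
  proof
    assume et: "e \<bullet> \<tau> = 0"
    then have e\<nu>: "e \<bullet> \<nu> \<noteq> 0" using orthonormal_expansion[OF cf(2-4), of e] e(1) by auto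
    have "p0 + (r / 2) *\<^sub>R e \<in> ball p0 r" using r e by (simp add: dist_norm)
    then have "(p0 + (r / 2) *\<^sub>R e) \<bullet> \<nu> = g ((p0 + (r / 2) *\<^sub>R e) \<bullet> \<tau>)" by (rule on_graph[OF _ p0line])
    moreover have "p0 \<bullet> \<nu> = g (p0 \<bullet> \<tau>)" using on_graph[of p0] r geo by simp
    ultimately show False using et e\<nu> r(1) by (simp add: inner_simps)
  qed
  define r' where "r' = min r (r * \<bar>e \<bullet> \<tau>\<bar>)"
  have r': "r' > 0" "r' \<le> r" "r' \<le> r * \<bar>e \<bullet> \<tau>\<bar>" using r(1) et by (auto simp: r'_def)
  have key: "\<exists>\<beta>. z \<bullet> n - c = \<beta> * (\<nu> \<bullet> n) \<and> (z \<in> \<Omega> \<longleftrightarrow> \<beta> > 0) \<and> (z \<in> closure A \<longleftrightarrow> \<beta> \<ge> 0)" if z: "z \<in> ball p0 r'" for z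
  proof -
    define \<sigma> where "\<sigma> = ((z - p0) \<bullet> \<tau>) / (e \<bullet> \<tau>)"
    define z' where "z' = p0 + \<sigma> *\<^sub>R e"
    have "\<bar>(z - p0) \<bullet> \<tau>\<bar> \<le> norm (z - p0)" using Cauchy_Schwarz_ineq2[of "z - p0" \<tau>] cf by simp
    also have "\<dots> < r * \<bar>e \<bullet> \<tau>\<bar>" using z r' by (simp add: dist_norm norm_minus_commute)
    finally have "\<bar>\<sigma>\<bar> < r" using et by (simp add: \<sigma>_def abs_divide divide_less_eq)
    then have z'b: "z' \<in> ball p0 r" using e by (simp add: z'_def dist_norm)
    have zt: "z' \<bullet> \<tau> = z \<bullet> \<tau>" using et by (simp add: z'_def \<sigma>_def inner_simps)
    define \<beta> where "\<beta> = (z - z') \<bullet> \<nu>"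
    have "(z - z') \<bullet> \<tau> = 0" using zt by (simp add: inner_simps)
    moreover have "z - z' = ((z - z') \<bullet> \<tau>) *\<^sub>R \<tau> + ((z - z') \<bullet> \<nu>) *\<^sub>R \<nu>"
      by (rule orthonormal_expansion[OF cf(2-4)])
    ultimately have "z - z' = \<beta> *\<^sub>R \<nu>" unfolding \<beta>_def by (simp only: scaleR_zero_left add_0)
    then have "(z - z') \<bullet> n = \<beta> * (\<nu> \<bullet> n)" by simp
    then have 1: "z \<bullet> n - c = \<beta> * (\<nu> \<bullet> n)" using p0line[of \<sigma>] by (simp add: z'_def inner_simps)
    have "z' \<bullet> \<nu> = g (z \<bullet> \<tau>)" using on_graph[OF z'b] p0line zt by (simp add: z'_def)
    then have "z \<bullet> \<nu> - g (z \<bullet> \<tau>) = \<beta>" by (simp add: \<beta>_def inner_simps)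
    moreover have "z \<in> ball p0 r" using z r' by auto
    ultimately show ?thesis using 1 r(2,3)[of z] by (intro exI[of _ \<beta>]) auto
  qed
  have "\<nu> \<bullet> n > 0"
  proof -
    define \<epsilon> where "\<epsilon> = min (1 / 2) (r' / (2 * norm (b - p0)))"
    have bp: "b \<noteq> p0" using geo by auto
    have \<epsilon>: "0 < \<epsilon>" "\<epsilon> < 1" "\<epsilon> * norm (b - p0) < r'"
    proof -
      show "0 < \<epsilon>" "\<epsilon> < 1" using bp r' by (auto simp: \<epsilon>_def)
      have "\<epsilon> * norm (b - p0) \<le> r' / (2 * norm (b - p0)) * norm (b - p0)" by (intro mult_right_mono) (auto simp: \<epsilon>_def)
      also have "\<dots> < r'" using bp r' by simp
      finally show "\<epsilon> * norm (b - p0) < r'" .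
    qed
    define z where "z = p0 + \<epsilon> *\<^sub>R (b - p0)"
    have "z \<in> open_segment p0 b" unfolding in_segment
      using \<epsilon> bp by (intro conjI exI[of _ \<epsilon>]) (auto simp: z_def algebra_simps)
    then have zn: "z \<notin> closure A" using geo(5) by blast
    have "z \<in> ball p0 r'" using \<epsilon> by (simp add: z_def dist_norm)
    from key[OF this] obtain \<beta> where \<beta>: "z \<bullet> n - c = \<beta> * (\<nu> \<bullet> n)" "z \<in> closure A \<longleftrightarrow> \<beta> \<ge> 0" by blast
    have "\<beta> < 0" using zn \<beta>(2) by simp
    have "z \<bullet> n - c = \<epsilon> * (b \<bullet> n - c)" using geo(2) by (simp add: z_def inner_simps algebra_simps)
    moreover have "\<epsilon> * (b \<bullet> n - c) < 0" using \<epsilon> geo(3) by (simp add: mult_less_0_iff)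
    ultimately have "\<beta> * (\<nu> \<bullet> n) < 0" using \<beta>(1) by simp
    then show ?thesis using \<open>\<beta> < 0\<close> by (simp add: mult_less_0_iff)
  qed
  have flat: "z \<in> \<Omega> \<longleftrightarrow> z \<bullet> n > c" if z: "z \<in> ball p0 r'" for z
  proof -
    obtain \<beta> where "z \<bullet> n - c = \<beta> * (\<nu> \<bullet> n)" "z \<in> \<Omega> \<longleftrightarrow> \<beta> > 0" using key[OF z] by blast
    then show ?thesis using \<open>\<nu> \<bullet> n > 0\<close> by (metis diff_gt_0_iff_gt zero_less_mult_pos2 mult_pos_pos)
  qed
  define h' where "h' = r' / 4"
  have h': "h' > 0" using r' by (simp add: h'_def)
  have p0eq: "p0 = (p0 \<bullet> e) *\<^sub>R e + c *\<^sub>R n" using orthonormal_expansion[OF e(1) geo(1) e(2), of p0] geo(2) by simp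
  have "t *\<^sub>R e + (c + s) *\<^sub>R n \<in> \<Omega> \<longleftrightarrow> s > 0" if ts: "\<bar>t - p0 \<bullet> e\<bar> \<le> h'" "\<bar>s\<bar> \<le> h'" for t s
  proof -
    define z where "z = t *\<^sub>R e + (c + s) *\<^sub>R n"
    have "z - p0 = (t - p0 \<bullet> e) *\<^sub>R e + s *\<^sub>R n" by (subst p0eq) (simp add: z_def algebra_simps)
    then have "dist z p0 \<le> \<bar>t - p0 \<bullet> e\<bar> + \<bar>s\<bar>"
      using norm_triangle_ineq[of "(t - p0 \<bullet> e) *\<^sub>R e" "s *\<^sub>R n"] e geo(1) by (simp add: dist_norm)
    also have "\<dots> < r'" using ts r' by (simp add: h'_def)
    finally have "z \<in> ball p0 r'" by (simp add: dist_commute)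
    moreover have "n \<bullet> n = 1" using geo(1) by (simp add: norm_eq_1)
    then have "z \<bullet> n = c + s" using e by (simp add: z_def inner_simps)
    ultimately show ?thesis using flat[of z] by (simp add: z_def)
  qed
  moreover have "smooth_real (\<lambda>_. c)"
  proof -
    have "(deriv ^^ n) (\<lambda>_::real. c) = (\<lambda>_. if n = 0 then c else 0)" for n
      by (induction n) simp_all
    then show ?thesis by (simp add: smooth_real_def)
  qed
  ultimately have "graph_chart \<Omega> p0 e n (\<lambda>_. c) h'"
    unfolding graph_chart_def using h' e geo by simp
  then show ?thesis using that[of n p0 c e h'] geo(1) line geo(2) by blast
qed

text \<open>On the half plane, \<open>w = z \<bullet> n - c - Psi (u z)\<close> is nonnegative by \<open>Psi_u_le_dist\<close>. Since
\<open>\<nabla>w = n - \<nabla>(Psi (u))\<close>, the Laplacian of \<open>w\<close> is \<open>- W'(u) rho(u)\<close> times \<open>1 - |\<nabla>(Psi (u))|\<^sup>2 \<le> 2 |\<nabla>w|\<close>. So Hopf's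
lemma applies. It shows that the zero set \<open>Z\<close> of \<open>w\<close> is open, and that it is nonempty because \<open>w\<close> vanishes to
first order at the boundary point \<open>p0\<close>.\<close>
lemma half_plane_solution:
  assumes n: "norm n = 1" and line: "\<And>z. z \<bullet> n = c \<Longrightarrow> z \<notin> \<Omega>"
    and gc: "graph_chart \<Omega> p0 e n (\<lambda>_. c) h"
    and z: "z \<bullet> n > c"
  shows "z \<in> \<Omega> \<and> Psi (u z) = z \<bullet> n - c"
proof -
  have nn: "n \<bullet> n = 1" using n by (simp add: norm_eq_1)
  have p0n: "p0 \<bullet> n = c" using gc by (simp add: graph_chart_def)
  have u1: "u x < 1" for x using u_less_1[OF line[OF p0n]] .
  have cu: "continuous_on S u" for S using cont_u continuous_on_subset by blast
  have cPu: "continuous_on S (\<lambda>x. Psi (u x))" for S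
    by (rule continuous_on_compose2[OF cont_Psi cu]) (use u1 u_nonneg in auto)
  define w where "w = (\<lambda>x. x \<bullet> n - c - Psi (u x))"
  have cw: "continuous_on S w" for S unfolding w_def by (intro continuous_intros cPu)
  have w_nonneg: "w x \<ge> 0" if "x \<bullet> n \<ge> c" for x
  proof -
    define q where "q = x - (x \<bullet> n - c) *\<^sub>R n"
    have "q \<bullet> n = c" by (simp add: q_def inner_simps nn)
    then have "Psi (u x) \<le> dist x q" by (intro Psi_u_le_dist line)
    then show ?thesis using that n by (simp add: w_def q_def dist_norm)
  qed
  have zero_in: "x \<in> \<Omega>" if "x \<bullet> n > c" "w x = 0" for x
  proof (rule ccontr)
    assume "x \<notin> \<Omega>"
    then have "u x = 0" by (rule u_outside)
    then show False using that by (simp add: w_def)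
  qed
  define gw where "gw = (\<lambda>x. n - 0 - rho (u x) *\<^sub>R G x)"
  define Lw where "Lw = (\<lambda>x h. 0 - 0 - (((- W' (u x) * rho (u x) ^ 3) * (h \<bullet> G x)) *\<^sub>R G x + rho (u x) *\<^sub>R (H x *v h)))"
  have tdw: "twice_diff w gw Lw \<Omega>"
    unfolding w_def gw_def Lw_def
    using u1 u_pos_iff
    by (intro twice_diff_diff twice_diff_inner twice_diff_const open_Omega
        twice_diff_compose[OF twice_diff_u, where \<phi>=Psi] Psi_deriv rho_deriv) auto
  define a where "a = (\<lambda>x. - (W' (u x) * rho (u x)))"
  have ca: "continuous_on S a" for S
    unfolding a_def
    by (intro continuous_intros continuous_on_compose2[OF W'_cont cu] continuous_on_compose2[OF cont_rho cu])
      (use u1 u_nonneg in auto)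
  have a0: "a x \<ge> 0" for x
    using W'_nonpos[OF u_nonneg u_le_1, of x] rho_pos[OF u_nonneg u1, of x] by (simp add: a_def mult_nonpos_nonneg)
  have trw: "tr (Lw x) \<le> 2 * a x * norm (gw x)" if x: "x \<in> \<Omega>" for x
  proof -
    define r where "r = rho (u x)"
    have "tr (Lw x) = - ((- W' (u x) * r ^ 3) * (G x \<bullet> G x) + r * W' (u x))"
    proof -
      have "tr (\<lambda>h. 0) = 0" by (simp add: tr_def)
      then show ?thesis unfolding Lw_def r_def
        by (simp only: tr_diff tr_add tr_outer_mult tr_scaleR tr_H[OF x])
    qed
    also have "\<dots> = a x * (1 - r\<^sup>2 * (G x \<bullet> G x))"
      by (simp add: a_def r_def power2_eq_square power3_eq_cube algebra_simps)
    also have "r\<^sup>2 * (G x \<bullet> G x) = (n - gw x) \<bullet> (n - gw x)" by (simp add: gw_def r_def power2_eq_square)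
    also have "1 - (n - gw x) \<bullet> (n - gw x) = 2 * (n \<bullet> gw x) - gw x \<bullet> gw x"
      by (simp add: inner_simps nn inner_commute)
    also have "a x * \<dots> \<le> a x * (2 * norm (gw x))"
    proof (intro mult_left_mono a0)
      have "n \<bullet> gw x \<le> norm (gw x)" using norm_cauchy_schwarz[of n "gw x"] n by simp
      then show "2 * (n \<bullet> gw x) - gw x \<bullet> gw x \<le> 2 * norm (gw x)" using inner_ge_zero[of "gw x"] by linarith
    qed
    finally show ?thesis by (simp add: algebra_simps)
  qed
  have bound: "\<exists>M\<ge>0. \<forall>x\<in>cball y r \<inter> \<Omega>. tr (Lw x) \<le> M * norm (gw x)" for y r
  proof -
    have "compact (a ` cball y r)" by (intro compact_continuous_image ca) auto
    then obtain B where B: "B > 0" "\<And>b. b \<in> a ` cball y r \<Longrightarrow> norm b \<le> B"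
      using compact_imp_bounded bounded_pos by metis
    have "tr (Lw x) \<le> (2 * B) * norm (gw x)" if x: "x \<in> cball y r \<inter> \<Omega>" for x
    proof -
      have "norm (a x) \<le> B" by (rule B) (use x in auto)
      then have "a x \<le> B" by simp
      then have "2 * a x * norm (gw x) \<le> 2 * B * norm (gw x)" by (intro mult_right_mono) auto
      then show ?thesis using trw[of x] x by auto
    qed
    then show ?thesis using B by (intro exI[of _ "2 * B"]) auto
  qed
  note cf = chart_facts[OF gc]
  define Z where "Z = {x. x \<bullet> n > c \<and> w x = 0}"
  have opZ: "open Z"
    unfolding open_contains_ball
  proof
    fix q assume q: "q \<in> Z"
    have qO: "q \<in> \<Omega>" using q zero_in by (auto simp: Z_def)
    have "open (\<Omega> \<inter> {x. x \<bullet> n > c})" by (intro open_Int open_Omega open_Collect_less continuous_intros)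
    then obtain r where r: "r > 0" "cball q r \<subseteq> \<Omega> \<inter> {x. x \<bullet> n > c}"
      using q qO open_contains_cball unfolding Z_def by blast
    obtain M where M: "M \<ge> 0" "\<And>x. x \<in> cball q r \<inter> \<Omega> \<Longrightarrow> tr (Lw x) \<le> M * norm (gw x)"
      using bound[of q r] by blast
    have "w z1 = 0" if z1: "z1 \<in> ball q (r / 3)" for z1
    proof (rule ccontr)
      assume nz: "w z1 \<noteq> 0"
      \<comment> \<open>A largest ball around \<open>z1\<close> without zeros touches a zero \<open>p\<close>, which is an interior minimum of \<open>w\<close>.\<close>
      define K where "K = {x \<in> cball q r. w x = 0}"
      have "compact K"
      proof -
        have "closed {x. w x = 0}" by (intro closed_Collect_eq cw continuous_intros)
        moreover have "K = cball q r \<inter> {x. w x = 0}" by (auto simp: K_def)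
        ultimately show ?thesis by (simp add: compact_Int_closed)
      qed
      moreover have "q \<in> K" using q r by (simp add: K_def Z_def)
      moreover have "continuous_on K (\<lambda>x. dist z1 x)" by (intro continuous_intros)
      ultimately obtain p where p: "p \<in> K" "\<And>x. x \<in> K \<Longrightarrow> dist z1 p \<le> dist z1 x"
        using continuous_attains_inf[of K "\<lambda>x. dist z1 x"] by blast
      define \<rho> where "\<rho> = dist z1 p"
      have \<rho>3: "\<rho> < r / 3" using p(2)[OF \<open>q \<in> K\<close>] z1 by (simp add: \<rho>_def dist_commute)
      have \<rho>0: "\<rho> > 0" using nz p(1) by (auto simp: \<rho>_def K_def)
      have incl: "dist q x < r" if "x \<in> cball z1 \<rho>" for x
        using dist_triangle[of q x z1] that z1 \<rho>3 r(1) by simp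
      have pos: "w x > 0" if "x \<in> ball z1 \<rho>" for x
      proof -
        have xr: "x \<in> cball q r" using incl[of x] that by auto
        then have "x \<bullet> n > c" using r by blast
        then have "w x \<ge> 0" using w_nonneg by simp
        moreover have "w x \<noteq> 0" using p(2)[of x] that xr by (auto simp: K_def \<rho>_def)
        ultimately show ?thesis by simp
      qed
      have sub: "ball z1 \<rho> \<subseteq> \<Omega>" "cball z1 \<rho> \<subseteq> cball q r" "cball z1 \<rho> \<subseteq> \<Omega>"
        using incl r(2) by (auto simp: subset_iff less_imp_le)
      have "\<exists>k>0. \<forall>t. 0 < t \<longrightarrow> t \<le> 1 / 2 \<longrightarrow> k * t \<le> w (p + t *\<^sub>R (z1 - p))"
      proof (rule hopf_boundary_point[OF \<rho>0 twice_diff_subset[OF tdw open_ball sub(1)] cw pos _ M(1) \<rho>_def[symmetric]])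
        show "tr (Lw x) \<le> M * norm (gw x)" if "x \<in> ball z1 \<rho>" for x
          using M(2)[of x] that sub by (auto simp: subset_iff)
        show "w p = 0" using p(1) by (simp add: K_def)
        show "w x \<ge> 0" if "x \<in> cball z1 \<rho>" for x
        proof -
          have "x \<bullet> n > c" using that sub r by blast
          then show ?thesis using w_nonneg by simp
        qed
      qed
      then obtain k where k: "k > 0" "\<And>t. 0 < t \<Longrightarrow> t \<le> 1 / 2 \<Longrightarrow> w (p + t *\<^sub>R (z1 - p)) \<ge> k * t" by blast
      have pN: "p \<in> ball q r" using incl[of p] by (simp add: \<rho>_def)
      have tdm: "twice_diff (\<lambda>x. (-1) * w x) (\<lambda>x. (-1) *\<^sub>R gw x) (\<lambda>x h. (-1) *\<^sub>R Lw x h) (ball q r)"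
        by (rule twice_diff_cmult[OF twice_diff_subset[OF tdw open_ball]]) (use r in auto)
      have g0: "gw p = 0"
      proof -
        have "(-1) *\<^sub>R gw p = 0"
        proof (rule local_max_test(1)[OF tdm pN])
          fix y assume "y \<in> ball q r"
          then have "y \<in> cball q r" by simp
          then have "y \<bullet> n > c" using r by blast
          then show "(-1) * w y \<le> (-1) * w p" using w_nonneg[of y] p(1) by (simp add: K_def)
        qed
        then show ?thesis by simp
      qed
      have pO: "p + 0 *\<^sub>R (z1 - p) \<in> \<Omega>" using sub(3) by (auto simp: \<rho>_def)
      have "((\<lambda>t. w (p + t *\<^sub>R (z1 - p))) has_real_derivative 0) (at 0)"
        using twice_diff_along_line(1)[OF tdw pO] g0 by simp
      then have "((\<lambda>t. w (p + t *\<^sub>R (z1 - p)) / t) \<longlongrightarrow> 0) (at_right 0)"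
        using p(1) by (auto simp: K_def has_field_derivative_iff intro: tendsto_mono[OF at_le])
      moreover have "eventually (\<lambda>t. k \<le> w (p + t *\<^sub>R (z1 - p)) / t) (at_right 0)"
        unfolding eventually_at_right_field using k(2) by (intro exI[of _ "1/2"]) (auto simp: field_simps)
      ultimately have "k \<le> 0" by (rule tendsto_lowerbound) simp
      then show False using k by simp
    qed
    then have "ball q (r / 3) \<subseteq> Z" using r by (auto simp: Z_def subset_iff)
    then show "\<exists>d>0. ball q d \<subseteq> Z" using r(1) by (intro exI[of _ "r / 3"]) auto
  qed
  have opZ': "open {x. x \<bullet> n > c \<and> w x > 0}"
    by (intro open_Collect_conj open_Collect_less cw continuous_intros)
  have neZ: "Z \<noteq> {}"
  proof
    assume emp: "Z = {}"
    have p0O: "p0 \<in> closure \<Omega>" "chart_map e n (\<lambda>_. c) (p0 \<bullet> e) s = p0 + s *\<^sub>R n" for s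
    proof -
      show eq: "chart_map e n (\<lambda>_. c) (p0 \<bullet> e) s = p0 + s *\<^sub>R n" for s
        using orthonormal_expansion[OF cf(2-4), of p0] p0n
        unfolding chart_map_def[OF gc] by (simp add: algebra_simps)
      show "p0 \<in> closure \<Omega>" using cf(9)[of "p0 \<bullet> e" 0] eq[of 0] cf(1) by simp
    qed
    obtain r where r: "r > 0" "\<And>x. x \<in> ball p0 r \<Longrightarrow> (x \<in> \<Omega> \<longleftrightarrow> c < x \<bullet> n) \<and> \<bar>x \<bullet> e - p0 \<bullet> e\<bar> < h \<and> \<bar>x \<bullet> n - c\<bar> < h"
      by (rule graph_chart_ball[OF gc]) blast
    define \<rho> where "\<rho> = r / 3"
    have \<rho>: "\<rho> > 0" using r by (simp add: \<rho>_def)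
    define z0 where "z0 = p0 + \<rho> *\<^sub>R n"
    have above: "x \<bullet> n > c" if "x \<in> ball z0 \<rho>" for x
    proof -
      have "\<bar>(x - z0) \<bullet> n\<bar> \<le> norm (x - z0)" using Cauchy_Schwarz_ineq2[of "x - z0" n] n by simp
      also have "\<dots> < \<rho>" using that by (simp add: dist_norm norm_minus_commute)
      finally show ?thesis by (simp add: z0_def inner_simps nn p0n)
    qed
    have above': "x \<bullet> n \<ge> c" if "x \<in> cball z0 \<rho>" for x
    proof -
      have "\<bar>(x - z0) \<bullet> n\<bar> \<le> norm (x - z0)" using Cauchy_Schwarz_ineq2[of "x - z0" n] n by simp
      also have "\<dots> \<le> \<rho>" using that by (simp add: dist_norm norm_minus_commute)
      finally show ?thesis by (simp add: z0_def inner_simps nn p0n)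
    qed
    have dz0: "dist z0 p0 = \<rho>" using n \<rho> by (simp add: z0_def dist_norm)
    have sub: "ball z0 \<rho> \<subseteq> \<Omega>"
    proof
      fix x assume x: "x \<in> ball z0 \<rho>"
      have "dist p0 x < r" using dist_triangle[of p0 x z0] dz0 x r(1) by (simp add: \<rho>_def dist_commute)
      then show "x \<in> \<Omega>" using r(2)[of x] above[OF x] by simp
    qed
    have pos: "w x > 0" if "x \<in> ball z0 \<rho>" for x
      using emp above[OF that] w_nonneg[of x] by (cases "w x = 0") (auto simp: Z_def)
    obtain M where M: "M \<ge> 0" "\<And>x. x \<in> cball z0 \<rho> \<inter> \<Omega> \<Longrightarrow> tr (Lw x) \<le> M * norm (gw x)"
      using bound[of z0 \<rho>] by blast
    have up0: "u p0 = 0" using u_outside line[OF p0n] by simp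
    have "\<exists>k>0. \<forall>t. 0 < t \<longrightarrow> t \<le> 1 / 2 \<longrightarrow> k * t \<le> w (p0 + t *\<^sub>R (z0 - p0))"
    proof (rule hopf_boundary_point[OF \<rho> twice_diff_subset[OF tdw open_ball sub] cw pos _ M(1) dz0])
      show "tr (Lw x) \<le> M * norm (gw x)" if "x \<in> ball z0 \<rho>" for x
        using M(2)[of x] that sub by (auto simp: subset_iff)
      show "w p0 = 0" using up0 p0n by (simp add: w_def)
      show "w x \<ge> 0" if "x \<in> cball z0 \<rho>" for x using w_nonneg above'[OF that] by simp
    qed
    then obtain k where k: "k > 0" "\<And>t. 0 < t \<Longrightarrow> t \<le> 1 / 2 \<Longrightarrow> w (p0 + t *\<^sub>R (z0 - p0)) \<ge> k * t" by blast
    have t0: "\<bar>p0 \<bullet> e - p0 \<bullet> e\<bar> \<le> h" using cf(1) by simp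
    have inO: "p0 + s *\<^sub>R n \<in> \<Omega>" if "0 < s" "s \<le> h" for s
      using cf(8)[OF t0 that] p0O(2)[of s] by simp
    \<comment> \<open>The derivative of \<open>Psi (u)\<close> along the normal tends to \<open>1\<close> at \<open>p0\<close>, against the linear growth of \<open>w\<close>.\<close>
    define d where "d = (\<lambda>s. rho (u (p0 + s *\<^sub>R n)) * (G (p0 + s *\<^sub>R n) \<bullet> n))"
    have cd: "continuous_on {0..h} d"
    proof -
      have "continuous_on {0..h} (\<lambda>s. G (p0 + s *\<^sub>R n))"
        using cont_closure_chart(2)[OF gc cont_G t0] by (simp add: p0O(2))
      moreover have "continuous_on {0..h} (\<lambda>s. rho (u (p0 + s *\<^sub>R n)))"
        by (rule continuous_on_compose2[OF cont_rho cont_u_segment]) (use u1 u_nonneg in auto)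
      ultimately show ?thesis unfolding d_def by (intro continuous_intros)
    qed
    have d0: "d 0 = 1"
    proof -
      have "G p0 = (G p0 \<bullet> n) *\<^sub>R n" and pos: "G p0 \<bullet> n > 0"
        using gradient_at_boundary[OF gc t0] p0O(2)[of 0] by simp_all
      then have "norm (G p0) = G p0 \<bullet> n" using n by (metis abs_of_pos mult.right_neutral norm_scaleR)
      moreover have "p0 \<in> frontier \<Omega>" using cf(11)[OF t0] p0O(2)[of 0] by simp
      ultimately have "G p0 \<bullet> n = sqrt (2 * W 0)" using free_boundary by simp
      then show ?thesis using up0 W_pos[of 0] by (simp add: d_def rho_def)
    qed
    have "0 \<in> {0..h}" using cf(1) by simp
    moreover have "k / (2 * \<rho>) > 0" using k \<rho> by simp
    ultimately obtain \<delta> where \<delta>: "\<delta> > 0" "\<And>s. s \<in> {0..h} \<Longrightarrow> dist s 0 < \<delta> \<Longrightarrow> dist (d s) (d 0) < k / (2 * \<rho>)"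
      using cd[unfolded continuous_on_iff] by meson
    define s where "s = min (min h (\<delta> / 2)) (\<rho> / 2)"
    have s: "0 < s" "s \<le> h" "s < \<delta>" "s \<le> \<rho> / 2" using cf(1) \<delta>(1) \<rho> by (auto simp: s_def)
    obtain \<xi> where \<xi>: "0 < \<xi>" "\<xi> < s" "Psi (u (p0 + s *\<^sub>R n)) - Psi (u (p0 + 0 *\<^sub>R n)) = (s - 0) * d \<xi>"
    proof (rule MVT_open[OF s(1), of "\<lambda>s. Psi (u (p0 + s *\<^sub>R n))" d])
      show "continuous_on {0..s} (\<lambda>s. Psi (u (p0 + s *\<^sub>R n)))"
        by (rule continuous_on_compose2[OF cont_Psi cont_u_segment]) (use u1 u_nonneg in auto)
      fix x assume x: "0 < x" "x < s"
      have xo: "p0 + x *\<^sub>R n \<in> \<Omega>" using inO[of x] x s by simp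
      then have "0 < u (p0 + x *\<^sub>R n)" by (simp add: u_pos_iff)
      from DERIV_chain2[OF Psi_deriv[OF this u1] twice_diff_along_line(1)[OF twice_diff_u xo]]
      show "((\<lambda>s. Psi (u (p0 + s *\<^sub>R n))) has_real_derivative d x) (at x)" by (simp add: d_def)
    qed blast
    have "\<bar>d \<xi> - 1\<bar> < k / (2 * \<rho>)" using \<delta>(2)[of \<xi>] \<xi> s d0 by (simp add: dist_real_def)
    then have small: "s * (1 - d \<xi>) < s * (k / (2 * \<rho>))" using s by (intro mult_strict_left_mono) auto
    have ws: "w (p0 + s *\<^sub>R n) = s * (1 - d \<xi>)"
      using \<xi>(3) up0 by (simp add: w_def inner_simps nn p0n algebra_simps)
    have "p0 + (s / \<rho>) *\<^sub>R (z0 - p0) = p0 + s *\<^sub>R n" using \<rho> by (simp add: z0_def)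
    then have "w (p0 + s *\<^sub>R n) \<ge> k * (s / \<rho>)" using k(2)[of "s / \<rho>"] s \<rho> by (simp add: field_simps)
    moreover have "k * (s / \<rho>) = 2 * (s * (k / (2 * \<rho>)))" using \<rho> by simp
    moreover have "s * (k / (2 * \<rho>)) > 0" using s k \<rho> by simp
    ultimately show False using small ws by linarith
  qed
  have "connected {x. x \<bullet> n > c}" 
    using convex_connected[OF convex_halfspace_gt[where a=n and b=c]] by (simp only: inner_commute[of n])
  moreover have "{x. x \<bullet> n > c} \<subseteq> Z \<union> {x. x \<bullet> n > c \<and> w x > 0}"
  proof
    fix x assume "x \<in> {x. x \<bullet> n > c}"
    then show "x \<in> Z \<union> {x. x \<bullet> n > c \<and> w x > 0}"
      using w_nonneg[of x] by (auto simp: Z_def)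
  qed
  moreover have "Z \<inter> {x. x \<bullet> n > c \<and> w x > 0} \<inter> {x. x \<bullet> n > c} = {}" by (auto simp: Z_def)
  moreover have "Z \<inter> {x. x \<bullet> n > c} \<noteq> {}" using neZ by (auto simp: Z_def)
  ultimately have "{x. x \<bullet> n > c \<and> w x > 0} \<inter> {x. x \<bullet> n > c} = {}"
    using connectedD[OF _ opZ opZ'] by blast
  then have "w z = 0" using z w_nonneg[of z] by fastforce
  then show ?thesis using zero_in[OF z] by (simp add: w_def)
qed

lemma piece_contains_half_plane:
  assumes AB: "open A" "open B" "A \<union> B = \<Omega>" "A \<inter> B = {}" "A \<noteq> {}" "B \<noteq> {}"
  obtains n c where "norm n = 1" "\<And>z. z \<bullet> n = c \<Longrightarrow> z \<notin> \<Omega>"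
    "\<And>z. z \<bullet> n > c \<Longrightarrow> z \<in> A" "\<And>z. z \<bullet> n > c \<Longrightarrow> Psi (u z) = z \<bullet> n - c"
proof -
  obtain n c p0 e h where f: "norm n = 1" "p0 \<in> closure A" "\<And>z. z \<bullet> n = c \<Longrightarrow> z \<notin> \<Omega>"
    "graph_chart \<Omega> p0 e n (\<lambda>_. c) h"
    by (rule flat_boundary_line[OF AB]) blast
  have sol: "z \<in> \<Omega> \<and> Psi (u z) = z \<bullet> n - c" if "z \<bullet> n > c" for z
    by (rule half_plane_solution[OF f(1,3,4) that])
  have gA: "graph_chart A p0 e n (\<lambda>_. c) h" by (rule graph_chart_piece[OF f(4) AB(1-4) f(2)])
  define y where "y = (p0 \<bullet> e) *\<^sub>R e + (c + h) *\<^sub>R n"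
  have "h > 0" "e \<bullet> n = 0" using gA by (auto simp: graph_chart_def)
  then have "y \<in> A" "y \<bullet> n > c"
    using gA f(1) unfolding graph_chart_def y_def by (auto simp: inner_simps norm_eq_1)
  moreover have "connected {x. x \<bullet> n > c}" 
    using convex_connected[OF convex_halfspace_gt[where a=n and b=c]] by (simp only: inner_commute[of n])
  moreover have "{x. x \<bullet> n > c} \<subseteq> A \<union> B" using sol AB by blast
  ultimately have "B \<inter> {x. x \<bullet> n > c} = {}" using connectedD[OF _ AB(1,2)] AB(4) by blast
  then have "z \<in> A" if "z \<bullet> n > c" for z using that sol AB(3) by blast
  then show ?thesis using that[OF f(1,3)] sol by blast
qed

end


section \<open>One dimensional symmetry\<close>

theorem theorem1p7:
  fixes W W' W'' :: "real \<Rightarrow> real" and u :: "real^2 \<Rightarrow> real"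
  assumes "admissible_potential W W' W''"
    and "classical_solution W W' u"
    and "\<not> connected {x. u x > 0}"
  shows "one_dimensional u"
proof -
  define \<Omega> where "\<Omega> = {x. u x > 0}"
  obtain G H where sol: "open \<Omega>" "smooth_boundary \<Omega>" "continuous_on UNIV u" "C2_closure \<Omega> u G H"
    "\<forall>x\<in>\<Omega>. trace (H x) = W' (u x)" "\<forall>x. x \<notin> \<Omega> \<longrightarrow> u x = 0" "\<forall>x\<in>frontier \<Omega>. norm (G x) = sqrt (2 * W 0)"
    using assms(2) unfolding classical_solution_def Let_def \<Omega>_def[symmetric] by blast
  have "free_boundary_solution W W' W'' u G H \<Omega>"
    by (rule free_boundary_solution.intro) (use assms(1) sol \<Omega>_def in blast)+
  then interpret free_boundary_solution W W' W'' u G H \<Omega> .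
  obtain A B where AB: "open A" "open B" "A \<union> B = \<Omega>" "A \<inter> B = {}" "A \<noteq> {}" "B \<noteq> {}"
  proof -
    obtain A B where "open A" "open B" "\<Omega> \<subseteq> A \<union> B" "A \<inter> B \<inter> \<Omega> = {}" "A \<inter> \<Omega> \<noteq> {}" "B \<inter> \<Omega> \<noteq> {}"
      using assms(3) unfolding \<Omega>_def[symmetric] connected_def by blast
    then show ?thesis using open_Omega by (intro that[of "A \<inter> \<Omega>" "B \<inter> \<Omega>"]) auto
  qed
  obtain n c where n: "norm n = 1" "\<And>z. z \<bullet> n = c \<Longrightarrow> z \<notin> \<Omega>" "\<And>z. z \<bullet> n > c \<Longrightarrow> z \<in> A"
    "\<And>z. z \<bullet> n > c \<Longrightarrow> Psi (u z) = z \<bullet> n - c"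
    by (rule piece_contains_half_plane[OF AB]) blast
  obtain m d where m: "norm m = 1" "\<And>z. z \<bullet> m = d \<Longrightarrow> z \<notin> \<Omega>" "\<And>z. z \<bullet> m > d \<Longrightarrow> z \<in> B"
    "\<And>z. z \<bullet> m > d \<Longrightarrow> Psi (u z) = z \<bullet> m - d"
    by (rule piece_contains_half_plane[of B A]) (use AB in blast)+
  have mn: "m = - n"
    by (rule disjoint_half_planes_opposite[OF n(1) m(1), of c d]) (use n(3) m(3) AB(4) in blast)
  \<comment> \<open>Were the part \<open>D\<close> of \<open>\<Omega>\<close> in the strip not empty, it would contain a half plane.\<close>
  define D where "D = \<Omega> \<inter> {z. z \<bullet> n < c} \<inter> {z. z \<bullet> m < d}"
  define E where "E = {z. z \<bullet> n > c} \<union> {z. z \<bullet> m > d}"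
  have "D = {}"
  proof (rule ccontr)
    assume "D \<noteq> {}"
    moreover have "open D" "open E" unfolding D_def E_def
      by (intro open_Int open_Un open_Omega open_Collect_less continuous_intros)+
    moreover have "D \<union> E = \<Omega>"
    proof
      show "D \<union> E \<subseteq> \<Omega>" using n(3) m(3) AB(3) by (auto simp: D_def E_def)
      show "\<Omega> \<subseteq> D \<union> E"
      proof
        fix x assume x: "x \<in> \<Omega>"
        then have "x \<bullet> n \<noteq> c" "x \<bullet> m \<noteq> d" using n(2) m(2) by auto
        then show "x \<in> D \<union> E" using x by (auto simp: D_def E_def)
      qed
    qed
    moreover have "D \<inter> E = {}" by (auto simp: D_def E_def)
    moreover have "E \<noteq> {}"
    proof -
      have "((c + 1) *\<^sub>R n) \<bullet> n > c" using n(1) by (simp add: norm_eq_1)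
      then show ?thesis unfolding E_def by blast
    qed
    ultimately obtain k f where k: "norm k = 1" "\<And>z. z \<bullet> k > f \<Longrightarrow> z \<in> D"
      using piece_contains_half_plane[of D E] by metis
    have "k = - n"
      by (rule disjoint_half_planes_opposite[OF n(1) k(1), of c f]) (use k(2) in \<open>force simp: D_def\<close>)
    moreover have "k = - m"
      by (rule disjoint_half_planes_opposite[OF m(1) k(1), of d f]) (use k(2) in \<open>force simp: D_def\<close>)
    ultimately have "n = - n" using mn by simp
    then have "n \<bullet> n = (- n) \<bullet> n" by (rule arg_cong)
    then show False using n(1) by (simp add: norm_eq_1)
  qed
  have "u x = u ((x \<bullet> n) *\<^sub>R n)" for x
  proof -
    define y where "y = (x \<bullet> n) *\<^sub>R n"
    have yn: "y \<bullet> n = x \<bullet> n" using n(1) by (simp add: y_def norm_eq_1)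
    have ym: "y \<bullet> m = x \<bullet> m" using yn by (simp add: mn)
    have u1: "u z < 1" for z
      using u_less_1[OF n(2)[of "c *\<^sub>R n"]] n(1) by (simp add: norm_eq_1)
    have inj: "u x = u y" if "Psi (u x) = Psi (u y)"
      using Psi_strict_mono[of "u x" "u y"] Psi_strict_mono[of "u y" "u x"] u1 u_nonneg that
      by (metis linorder_neqE_linordered_idom order_less_irrefl)
    consider "x \<bullet> n > c" | "x \<bullet> m > d" | "x \<notin> \<Omega>" "y \<notin> \<Omega>"
      using \<open>D = {}\<close> n(2) m(2) yn ym unfolding D_def by (fastforce simp: neq_iff)
    then have "u x = u y"
    proof cases
      case 1
      then show ?thesis using n(4)[of x] n(4)[of y] yn inj by simp
    next
      case 2
      then show ?thesis using m(4)[of x] m(4)[of y] ym inj by simp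
    next
      case 3
      then show ?thesis using u_outside by simp
    qed
    then show ?thesis by (simp add: y_def)
  qed
  then show ?thesis unfolding one_dimensional_def
    using n(1) by (intro exI[of _ n] exI[of _ "\<lambda>s. u (s *\<^sub>R n)"]) simp
qed

end
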